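(* Let $\{X_i\}_{i\in I}$ be a basic partition of $(X,\mu)$ into $N$ cells and let $\mathcal J_A,\mathcal J_B$ be two composite partitions of $I$ such that no two distinct basic cells are contained both in a common cell of $\mathcal J_A$ and in a common cell of $\mathcal J_B$, and such that the partition graph is connected. Let $J_0\in\mathcal J_A$ be a selected composite cell, let $D(i)=\mathrm{dist}(i,J_0)$ be the cell distance and $M=\max\{D(i):i\in I\}$. Let $\mu_{\min}=\min\{\|\mu_i\|:i\in I\}$. Let $\pi^{(0)}\in\Pi(\mu,\nu)$ be arbitrary and let $(\pi^{(\ell)})_{\ell\geq 0}$ be the iterates of the entropic domain decomposition algorithm. Then for every odd $\ell>M$ $$\Delta(\pi^{(\ell)})\le\frac{2MN\exp((6M+7)\|c\|/\varepsilon)}{\mu_{\min}^{2M+1}+2MN\exp((6M+7)\|c\|/\varepsilon)}\cdot\Delta(\pi^{(\ell-M)}).$$ The same holds for every even $\ell>M$ when the roles of $\mathcal J_A$ and $\mathcal J_B$ are swapped, i.e. when $J_0$ is selected in $\mathcal J_B$ and $D$, $M$ are defined with respect to this $J_0$. In particular, $\pi^{(\ell)}$ converges (weakly-$\ast$) to the optimal solution $\pi^\ast$ as $\ell\to\infty$.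
   Context: $X,Y$ are compact metric spaces, $\mu$ and $\nu$ are (Radon) probability measures on $X$ and $Y$, $c\in L^\infty(X\times Y,\mu\otimes\nu)$ is non-negative, $\|c\|$ is its $L^\infty$ norm, $\varepsilon>0$, $k=\exp(-c/\varepsilon)$, and $K=k\cdot(\mu\otimes\nu)$. The norm $\|\rho\|$ of a non-negative measure is its total mass; $\rho\llcorner S$ denotes restriction. $P_X,P_Y$ map a measure on $X\times Y$ to its marginals. For non-negative measures $\hat\mu,\hat\nu$ of equal mass, $\Pi(\hat\mu,\hat\nu)$ is the set of non-negative measures on $X\times Y$ with marginals $\hat\mu,\hat\nu$. $\mathrm{KL}(\rho|\sigma)=\int\varphi(\frac{d\rho}{d\sigma})\,d\sigma$ if $\rho\ll\sigma$, $\rho\ge0$, and $+\infty$ otherwise, where $\varphi(s)=s\log s-s+1$ for $s>0$, $\varphi(0)=1$. The problem is $\min\{\varepsilon\,\mathrm{KL}(\pi|K):\pi\in\Pi(\mu,\nu)\}$; it has a unique minimizer $\pi^\ast$. Suboptimality: $\Delta(\pi)=\mathrm{KL}(\pi|K)-\mathrm{KL}(\pi^\ast|K)$ for $\pi\in\Pi(\mu,\nu)$. Basic partition: a finite partition $\{X_i\}_{i\in I}$ of $X$ into measurable sets such that $\mu_i:=\mu\llcorner X_i$ satisfies $\|\mu_i\|>0$. Composite partition: a partition $\mathcal J$ of $I$; for $J\in\mathcal J$, $X_J=\bigcup_{i\in J}X_i$ and $\mu_J=\mu\llcorner X_J$. Entropic domain decomposition algorithm: given $\pi^{(0)}\in\Pi(\mu,\nu)$,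 for $\ell=1,2,\ldots$ let $\mathcal J^{(\ell)}=\mathcal J_A$ if $\ell$ is odd and $\mathcal J_B$ if $\ell$ is even. For each $J\in\mathcal J^{(\ell)}$ set $\nu_J^{(\ell)}=P_Y(\pi^{(\ell-1)}\llcorner(X_J\times Y))$ and let $\pi_J^{(\ell)}$ be the unique minimizer of $\varepsilon\,\mathrm{KL}(\cdot|K)$ over $\Pi(\mu_J,\nu_J^{(\ell)})$. Then $\pi^{(\ell)}=\sum_{J\in\mathcal J^{(\ell)}}\pi_J^{(\ell)}$. Partition graph: vertex set $I$, with an edge between $i$ and $j$ whenever there is some $J\in\mathcal J_A\cup\mathcal J_B$ with $\{i,j\}\subset J$. $\mathrm{dist}$ on $I\times I$ is the shortest-path metric of this graph with all edges of length 1, and $\mathrm{dist}(i,J_0)=\min\{\mathrm{dist}(i,j):j\in J_0\}$. *)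

theory Defs
  imports "HOL-Probability.Probability"
begin

text \<open>Total mass and restriction. A restricted measure keeps the ambient space and
  \<open>\<sigma>\<close>-algebra, so \<^const>\<open>restrict_space\<close> is not used.\<close>

definition mass :: "'a measure \<Rightarrow> real" where
  "mass \<rho> = measure \<rho> (space \<rho>)"

definition restr :: "'a measure \<Rightarrow> 'a set \<Rightarrow> 'a measure" where
  "restr \<rho> S = density \<rho> (indicator S)"

text \<open>The space \<open>L\<^sup>\<infinity>\<close> and its norm; membership makes the essential supremum of
  \<open>\<bar>f\<bar>\<close> finite.\<close>

definition in_Linf :: "'a measure \<Rightarrow> ('a \<Rightarrow> real) \<Rightarrow> bool" where
  "in_Linf M f \<longleftrightarrow> f \<in> borel_measurable M \<and> esssup M (\<lambda>x. ereal \<bar>f x\<bar>) < \<infinity>"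

definition Linf_norm :: "'a measure \<Rightarrow> ('a \<Rightarrow> real) \<Rightarrow> real" where
  "Linf_norm M f = real_of_ereal (esssup M (\<lambda>x. ereal \<bar>f x\<bar>))"

text \<open>The extended Kullback-Leibler divergence for measures of arbitrary mass. It differs from
  \<^const>\<open>KL_divergence\<close> by the terms \<open>- s + 1\<close> and by the value \<open>\<infinity>\<close> where absolute continuity
  fails. As \<open>\<phi> \<ge> 0\<close> on \<open>[0,\<infinity>)\<close>, the nonnegative integral is the right one. Note that
  \<^term>\<open>absolutely_continuous \<sigma> \<rho>\<close> means \<open>\<rho> \<lless> \<sigma>\<close> and \<^term>\<open>RN_deriv \<sigma> \<rho>\<close> is \<open>d\<rho>/d\<sigma>\<close>.\<close>

definition phi :: "real \<Rightarrow> real" where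
  "phi s = (if s > 0 then s * ln s - s + 1 else 1)"

definition KL :: "'a measure \<Rightarrow> 'a measure \<Rightarrow> ennreal" where
  "KL \<rho> \<sigma> = (if absolutely_continuous \<sigma> \<rho>
      then \<integral>\<^sup>+ x. ennreal (phi (enn2real (RN_deriv \<sigma> \<rho> x))) \<partial>\<sigma> else \<infinity>)"

definition gibbs :: "'a::topological_space measure \<Rightarrow> 'b::topological_space measure
    \<Rightarrow> ('a \<times> 'b \<Rightarrow> real) \<Rightarrow> real \<Rightarrow> ('a \<times> 'b) measure" where
  "gibbs \<mu> \<nu> c \<epsilon> = density (\<mu> \<Otimes>\<^sub>M \<nu>) (\<lambda>z. ennreal (exp (- c z / \<epsilon>)))"

text \<open>Measures on the product live on \<open>borel \<Otimes>\<^sub>M borel\<close>, which for compact metric spaces is the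
  Borel \<open>\<sigma>\<close>-algebra of the product.\<close>

definition marg_X :: "('a::topological_space \<times> 'b::topological_space) measure \<Rightarrow> 'a measure" where
  "marg_X \<pi> = distr \<pi> borel fst"

definition marg_Y :: "('a::topological_space \<times> 'b::topological_space) measure \<Rightarrow> 'b measure" where
  "marg_Y \<pi> = distr \<pi> borel snd"

definition couplings :: "'a::topological_space measure \<Rightarrow> 'b::topological_space measure
    \<Rightarrow> ('a \<times> 'b) measure set" where
  "couplings \<mu> \<nu> = {\<pi>. sets \<pi> = sets (borel \<Otimes>\<^sub>M borel) \<and> marg_X \<pi> = \<mu> \<and> marg_Y \<pi> = \<nu>}"

definition is_entropic_minimizer :: "real \<Rightarrow> ('a::topological_space \<times> 'b::topological_space) measure
    \<Rightarrow> 'a measure \<Rightarrow> 'b measure \<Rightarrow> ('a \<times> 'b) measure \<Rightarrow> bool" where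
  "is_entropic_minimizer \<epsilon> K \<mu> \<nu> \<pi> \<longleftrightarrow>
     is_arg_min (\<lambda>\<rho>. ennreal \<epsilon> * KL \<rho> K) (\<lambda>\<rho>. \<rho> \<in> couplings \<mu> \<nu>) \<pi>"

text \<open>Suboptimality of \<open>\<pi>\<close> relative to the minimizer \<open>\<pi>'\<close>. It is \<open>\<infinity>\<close> if \<^term>\<open>KL \<pi> K\<close> is.\<close>

definition subopt :: "'a measure \<Rightarrow> 'a measure \<Rightarrow> 'a measure \<Rightarrow> ereal" where
  "subopt K \<pi>' \<pi> = enn2ereal (KL \<pi> K) - enn2ereal (KL \<pi>' K)"

definition basic_partition :: "'a::topological_space measure \<Rightarrow> 'i set \<Rightarrow> ('i \<Rightarrow> 'a set) \<Rightarrow> bool" where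
  "basic_partition \<mu> I X \<longleftrightarrow> finite I \<and> (\<forall>i\<in>I. X i \<in> sets borel) \<and>
     disjoint_family_on X I \<and> (\<Union>i\<in>I. X i) = UNIV \<and> (\<forall>i\<in>I. mass (restr \<mu> (X i)) > 0)"

definition comp_cell :: "('i \<Rightarrow> 'a set) \<Rightarrow> 'i set \<Rightarrow> 'a set" where
  "comp_cell X J = (\<Union>i\<in>J. X i)"

definition measure_sum :: "'j set
    \<Rightarrow> ('j \<Rightarrow> ('a::topological_space \<times> 'b::topological_space) measure) \<Rightarrow> ('a \<times> 'b) measure" where
  "measure_sum A m = measure_of UNIV (sets (borel \<Otimes>\<^sub>M borel)) (\<lambda>B. \<Sum>j\<in>A. emeasure (m j) B)"

definition dd_step :: "real \<Rightarrow> ('a::topological_space \<times> 'b::topological_space) measure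
    \<Rightarrow> 'a measure \<Rightarrow> ('i \<Rightarrow> 'a set) \<Rightarrow> 'i set set
    \<Rightarrow> ('a \<times> 'b) measure \<Rightarrow> ('a \<times> 'b) measure \<Rightarrow> bool" where
  "dd_step \<epsilon> K \<mu> X \<J> \<pi> \<pi>' \<longleftrightarrow>
     (\<exists>\<pi>J. (\<forall>J\<in>\<J>. is_entropic_minimizer \<epsilon> K (restr \<mu> (comp_cell X J))
                    (marg_Y (restr \<pi> (comp_cell X J \<times> UNIV))) (\<pi>J J)) \<and>
           \<pi>' = measure_sum \<J> \<pi>J)"

text \<open>The sequence \<open>\<pi>\<close> is a run of the domain decomposition algorithm. Minimizers are unique, so
  the run is determined by \<open>\<pi> 0\<close>.\<close>

definition dd_iterates :: "real \<Rightarrow> ('a::topological_space \<times> 'b::topological_space) measure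
    \<Rightarrow> 'a measure \<Rightarrow> 'b measure \<Rightarrow> ('i \<Rightarrow> 'a set) \<Rightarrow> 'i set set \<Rightarrow> 'i set set
    \<Rightarrow> (nat \<Rightarrow> ('a \<times> 'b) measure) \<Rightarrow> bool" where
  "dd_iterates \<epsilon> K \<mu> \<nu> X \<J>A \<J>B \<pi> \<longleftrightarrow> \<pi> 0 \<in> couplings \<mu> \<nu> \<and>
     (\<forall>l\<ge>1. dd_step \<epsilon> K \<mu> X (if odd l then \<J>A else \<J>B) (\<pi> (l - 1)) (\<pi> l))"

text \<open>The adjacency relation of the partition graph (with loops, which affect neither connectedness
  nor distances). The power \<open>G ^^ n\<close> relates the end points of walks of length \<open>n\<close>.\<close>

definition part_graph :: "'i set \<Rightarrow> 'i set set \<Rightarrow> 'i set set \<Rightarrow> ('i \<times> 'i) set" where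
  "part_graph I \<J>A \<J>B = {(i, j). i \<in> I \<and> j \<in> I \<and> (\<exists>J\<in>\<J>A \<union> \<J>B. {i, j} \<subseteq> J)}"

definition graph_connected :: "'i set \<Rightarrow> ('i \<times> 'i) set \<Rightarrow> bool" where
  "graph_connected I G \<longleftrightarrow> (\<forall>i\<in>I. \<forall>j\<in>I. (i, j) \<in> G\<^sup>*)"

definition graph_dist :: "('i \<times> 'i) set \<Rightarrow> 'i \<Rightarrow> 'i \<Rightarrow> nat" where
  "graph_dist G i j = (LEAST n. (i, j) \<in> G ^^ n)"

definition cell_dist :: "('i \<times> 'i) set \<Rightarrow> 'i set \<Rightarrow> 'i \<Rightarrow> nat" where
  "cell_dist G J0 i = Min ((\<lambda>j. graph_dist G i j) ` J0)"

definition max_cell_dist :: "('i \<times> 'i) set \<Rightarrow> 'i set \<Rightarrow> 'i set \<Rightarrow> nat" where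
  "max_cell_dist G I J0 = Max (cell_dist G J0 ` I)"

definition min_mass :: "'a measure \<Rightarrow> 'i set \<Rightarrow> ('i \<Rightarrow> 'a set) \<Rightarrow> real" where
  "min_mass \<mu> I X = Min ((\<lambda>i. mass (restr \<mu> (X i))) ` I)"

text \<open>On a compact space continuous functions are bounded, so these are all the test functions.\<close>

definition weak_star_tendsto :: "(nat \<Rightarrow> 'a::topological_space measure) \<Rightarrow> 'a measure \<Rightarrow> bool" where
  "weak_star_tendsto \<pi> \<pi>' \<longleftrightarrow> (\<forall>f::'a \<Rightarrow> real. continuous_on UNIV f \<longrightarrow>
     (\<lambda>n. \<integral>x. f x \<partial>\<pi> n) \<longlonglongrightarrow> (\<integral>x. f x \<partial>\<pi>'))"

definition contraction_factor :: "nat \<Rightarrow> nat \<Rightarrow> real \<Rightarrow> real \<Rightarrow> real \<Rightarrow> real" where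
  "contraction_factor M N \<mu>min cnorm \<epsilon> =
     2 * real M * real N * exp ((6 * real M + 7) * cnorm / \<epsilon>) /
     (\<mu>min ^ (2 * M + 1) + 2 * real M * real N * exp ((6 * real M + 7) * cnorm / \<epsilon>))"

end

theory Submission
  imports Defs
begin

text \<open>A minimizer on a composite cell has a density \<open>U(x) V(y) k(x,y)\<close> by the Schroedinger system,
  which is solved by the contraction of the Sinkhorn iteration; being of this form, it satisfies a
  Pythagorean inequality: passing to it decreases the divergence by at least the squared Hellinger
  distance. Along the iterates the factor \<open>V\<close> depends on the composite cell only, and the optimal
  plan is the one with a single \<open>V\<close>. By weak duality, \<open>\<Delta>(\<pi>\<^sup>(\<^sup>l\<^sup>))\<close> is at most a sum over the
  basic cells of Hellinger-type distances between \<open>V\<^sub>i\<close> and a multiple of the factor of \<open>J\<^sub>0\<close>. A shortest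
  path from \<open>i\<close> to \<open>J\<^sub>0\<close> alternates between the two partitions, so these distances telescope into
  distances between the factors of the last two iterates, that is, into the last decrease of the
  divergence. All \<open>M\<close> steps are needed only to spread mass to \<open>J\<^sub>0\<close>: they bound the factor of
  \<open>J\<^sub>0\<close> from below.\<close>

subsection \<open>Scaling equations for bounded kernels\<close>

text \<open>The Hellinger distance mediates because a path argument needs a triangle inequality,
  which the divergence does not have. It also suits factors that are compared only up to constants:
  multiplying both functions by s multiplies its square by s. Passing from the divergence to the
  Hellinger distance is free (\<open>hellinger_le_dv\<close>), but the way back
  (\<open>dv_le_hellinger\<close>) costs the largest ratio of the two densities. This is where the
  lower bound on the factor of J0 enters quantitatively, and it is the source of M of the 2 M + 1
  powers of the minimal mass. One more comes from averaging over a basic cell; the remaining M are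
  traded against the number N of cells, N times the minimal mass being at most 1. The initial plan
  may be singular with infinite divergence; as l > M, only iterates from index 1 on enter the
  estimates. Uniqueness of minimizers is not presupposed: the Pythagorean inequality identifies any
  minimizer with the plan built from the scaling equations.\<close>

definition bpos :: "'a measure \<Rightarrow> ('a \<Rightarrow> real) \<Rightarrow> bool" where
  "bpos M u \<longleftrightarrow> u \<in> borel_measurable M \<and> (\<exists>c>0. \<exists>C. \<forall>x. c \<le> u x \<and> u x \<le> C)"

text \<open>Hilbert's projective metric in multiplicative form: \<open>u\<close> and
  \<open>u'\<close> are at distance at most ln (1 + w), and \<open>t\<close> is the scalar that a
  projective metric ignores.\<close>

definition ratio_close :: "real \<Rightarrow> ('a \<Rightarrow> real) \<Rightarrow> ('a \<Rightarrow> real) \<Rightarrow> bool" where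
  "ratio_close w u u' \<longleftrightarrow> (\<exists>t>0. \<forall>x. t * u x \<le> u' x \<and> u' x \<le> t * (1 + w) * u x)"

lemma bpos_pos: "bpos M u \<Longrightarrow> 0 < u x"
  unfolding bpos_def by (meson less_le_trans)

lemma bpos_const: "0 < c \<Longrightarrow> bpos M (\<lambda>_. c)"
  unfolding bpos_def by auto

lemma bpos_inverse:
  assumes "bpos M u" shows "bpos M (\<lambda>x. 1 / u x)"
proof -
  obtain c C where *: "c > 0" "\<And>x. c \<le> u x" "\<And>x. u x \<le> C" and m: "u \<in> borel_measurable M"
    using assms unfolding bpos_def by blast
  have C: "C > 0" using * by (meson less_le_trans)
  show ?thesis unfolding bpos_def
  proof (intro conjI exI allI)
    show "(\<lambda>x. 1 / u x) \<in> borel_measurable M" using m by measurable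
    show "1 / C > 0" using C by simp
    fix x show "1 / C \<le> 1 / u x" "1 / u x \<le> 1 / c"
      using * C by (auto intro!: divide_left_mono mult_pos_pos less_le_trans[OF *(1) *(2)])
  qed
qed

lemma bpos_integrable:
  assumes "finite_measure M" "bpos M u" shows "integrable M u"
proof -
  interpret finite_measure M by fact
  obtain C where *: "\<And>x. u x \<le> C" and m: "u \<in> borel_measurable M"
    using assms unfolding bpos_def by blast
  show ?thesis using * m bpos_pos[OF assms(2)]
    by (intro integrable_const_bound[of _ C]) (auto intro!: AE_I2 simp: abs_of_pos)
qed

lemma ratio_close_inverse:
  assumes "ratio_close w u u'" "bpos M u" "bpos M u'" "0 \<le> w"
  shows "ratio_close w (\<lambda>x. 1 / u x) (\<lambda>x. 1 / u' x)"
proof -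
  obtain t where t: "t > 0" "\<And>x. t * u x \<le> u' x" "\<And>x. u' x \<le> t * (1 + w) * u x"
    using assms(1) unfolding ratio_close_def by blast
  note p = bpos_pos[OF assms(2)] bpos_pos[OF assms(3)]
  have "1 / (t * (1 + w)) * (1 / u x) \<le> 1 / u' x" "1 / u' x \<le> 1 / (t * (1 + w)) * (1 + w) * (1 / u x)" for x
    using t(1) t(3)[of x] mult_left_mono[OF t(2)[of x], of "1 + w"] t(2)[of x] p[of x] assms(4)
    by (auto simp: field_simps)
  then show ?thesis unfolding ratio_close_def using t(1) assms(4)
    by (intro exI[of _ "1 / (t * (1 + w))"]) auto
qed

text \<open>The two half steps of the Sinkhorn iteration average the same kernel in either variable.
  The locale covers one direction and is instantiated twice, the second time with the arguments of
  \<open>h\<close> exchanged.\<close>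

locale pos_kernel = finite_measure \<alpha> for \<alpha> :: "'a measure" +
  fixes \<beta> :: "'b measure" and h :: "'a \<Rightarrow> 'b \<Rightarrow> real" and a :: real
  assumes space_alpha: "space \<alpha> = UNIV" and mass_pos: "0 < measure \<alpha> (space \<alpha>)"
    and kernel_measurable: "case_prod h \<in> borel_measurable (\<alpha> \<Otimes>\<^sub>M \<beta>)"
    and space_beta: "space \<beta> = UNIV"
    and a_pos: "0 < a" and kernel_ge: "\<And>x y. a \<le> h x y" and kernel_le: "\<And>x y. h x y \<le> 1"
begin

definition avg :: "('a \<Rightarrow> real) \<Rightarrow> 'b \<Rightarrow> real" where
  "avg u y = (\<integral>x. h x y * u x \<partial>\<alpha>)"

lemma a_le_1: "a \<le> 1"
  using kernel_ge kernel_le order_trans by blast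

lemma kernel_section: "(\<lambda>x. h x y) \<in> borel_measurable \<alpha>"
  using measurable_compose[OF measurable_Pair2'[of y \<beta> \<alpha>] kernel_measurable] space_beta by simp

lemma kernel_nonneg: "0 \<le> h x y"
  using kernel_ge a_pos by (meson less_imp_le order_trans)

lemma integrable_kernel_mult:
  assumes "integrable \<alpha> u" shows "integrable \<alpha> (\<lambda>x. h x y * u x)"
  by (rule Bochner_Integration.integrable_bound[OF assms])
     (use kernel_section assms kernel_le kernel_nonneg in \<open>auto simp: abs_mult intro!: AE_I2 mult_left_le_one_le\<close>)

lemma avg_mono_bounds:
  assumes "integrable \<alpha> u" "\<And>x. 0 \<le> u x"
  shows "a * (\<integral>x. u x \<partial>\<alpha>) \<le> avg u y" "avg u y \<le> (\<integral>x. u x \<partial>\<alpha>)"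
proof -
  have "a * (\<integral>x. u x \<partial>\<alpha>) = (\<integral>x. a * u x \<partial>\<alpha>)" by simp
  also have "\<dots> \<le> avg u y" unfolding avg_def
    by (intro integral_mono integrable_kernel_mult assms integrable_mult_right mult_right_mono kernel_ge)
  finally show "a * (\<integral>x. u x \<partial>\<alpha>) \<le> avg u y" .
  show "avg u y \<le> (\<integral>x. u x \<partial>\<alpha>)" unfolding avg_def
    by (intro integral_mono integrable_kernel_mult assms mult_left_le_one_le kernel_le kernel_nonneg)
qed

lemma avg_measurable:
  assumes "u \<in> borel_measurable \<alpha>" shows "avg u \<in> borel_measurable \<beta>"
proof -
  have "case_prod (\<lambda>y x. h x y * u x) \<in> borel_measurable (\<beta> \<Otimes>\<^sub>M \<alpha>)"
  proof -
    have "(\<lambda>z. case_prod h (snd z, fst z)) \<in> borel_measurable (\<beta> \<Otimes>\<^sub>M \<alpha>)"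
      by (rule measurable_compose[OF _ kernel_measurable]) simp
    moreover have "(\<lambda>z. u (snd z)) \<in> borel_measurable (\<beta> \<Otimes>\<^sub>M \<alpha>)"
      by (rule measurable_compose[OF measurable_snd assms])
    ultimately show ?thesis by (simp add: case_prod_beta)
  qed
  from borel_measurable_lebesgue_integral[OF this] show ?thesis
    unfolding avg_def[abs_def] by simp
qed

lemma avg_bpos:
  assumes "bpos \<alpha> u" shows "bpos \<beta> (avg u)"
proof -
  obtain c C where *: "c > 0" "\<And>x. c \<le> u x" "\<And>x. u x \<le> C" and m: "u \<in> borel_measurable \<alpha>"
    using assms unfolding bpos_def by blast
  have i: "integrable \<alpha> u" using bpos_integrable assms finite_measure_axioms by blast
  have "c * measure \<alpha> (space \<alpha>) = (\<integral>x. c \<partial>\<alpha>)" by simp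
  also have "\<dots> \<le> (\<integral>x. u x \<partial>\<alpha>)" by (intro integral_mono i) (use * in auto)
  finally have "0 < (\<integral>x. u x \<partial>\<alpha>)" using * mass_pos by (smt (verit) mult_pos_pos)
  moreover have "0 \<le> u x" for x using * by (meson less_imp_le order_trans)
  ultimately show ?thesis unfolding bpos_def
    using avg_measurable[OF m] avg_mono_bounds[OF i] a_pos
    by (intro conjI exI[of _ "a * (\<integral>x. u x \<partial>\<alpha>)"] exI[of _ "\<integral>x. u x \<partial>\<alpha>"]) auto
qed

text \<open>A Birkhoff type contraction. If t <= u'/u <= s, then u' - t u and s u - u' are
  nonnegative, and averaging against a kernel that is at least \<open>a\<close> retains at least the
  fraction \<open>a\<close> of their integrals. So both bounds on the ratio move by that fraction
  towards the ratio \<open>e\<close> of the total masses, and the gap s - t shrinks to (1 - a) (s -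
  t).\<close>

lemma avg_contract:
  assumes u: "bpos \<alpha> u" "bpos \<alpha> u'" and w: "0 \<le> w" and cl: "ratio_close w u u'"
  shows "ratio_close ((1 - a) * w) (avg u) (avg u')"
proof -
  obtain t where t: "t > 0" "\<And>x. t * u x \<le> u' x" "\<And>x. u' x \<le> t * (1 + w) * u x"
    using cl unfolding ratio_close_def by blast
  have i: "integrable \<alpha> u" "integrable \<alpha> u'" using bpos_integrable u finite_measure_axioms by blast+
  define s where "s = t * (1 + w)"
  define Z where "Z = (\<integral>x. u x \<partial>\<alpha>)"
  define e where "e = (\<integral>x. u' x \<partial>\<alpha>) / Z"
  have av: "avg u y > 0" for y using bpos_pos[OF avg_bpos[OF u(1)]] .
  have Z: "avg u y \<le> Z" for y
    unfolding Z_def using avg_mono_bounds(2)[OF i(1)] bpos_pos[OF u(1)] less_imp_le by blast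
  have Z0: "Z > 0" using av[of undefined] Z[of undefined] by simp
  have lin: "avg (\<lambda>x. u' x - r * u x) y = avg u' y - r * avg u y"
            "(\<integral>x. u' x - r * u x \<partial>\<alpha>) = (e - r) * Z"
            "avg (\<lambda>x. r * u x - u' x) y = r * avg u y - avg u' y"
            "(\<integral>x. r * u x - u' x \<partial>\<alpha>) = (r - e) * Z" for r y
  proof -
    have 1: "avg (\<lambda>x. u' x - r * u x) y = (\<integral>x. h x y * u' x - r * (h x y * u x) \<partial>\<alpha>)"
      unfolding avg_def by (simp add: algebra_simps)
    show "avg (\<lambda>x. u' x - r * u x) y = avg u' y - r * avg u y"
      unfolding 1 by (subst Bochner_Integration.integral_diff)
         (auto intro!: integrable_kernel_mult i integrable_mult_right simp: avg_def)
    have 2: "avg (\<lambda>x. r * u x - u' x) y = (\<integral>x. r * (h x y * u x) - h x y * u' x \<partial>\<alpha>)"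
      unfolding avg_def by (simp add: algebra_simps)
    show "avg (\<lambda>x. r * u x - u' x) y = r * avg u y - avg u' y"
      unfolding 2 by (subst Bochner_Integration.integral_diff)
         (auto intro!: integrable_kernel_mult i integrable_mult_right simp: avg_def)
    show "(\<integral>x. u' x - r * u x \<partial>\<alpha>) = (e - r) * Z" "(\<integral>x. r * u x - u' x \<partial>\<alpha>) = (r - e) * Z"
      using i Z0 by (auto simp: e_def Z_def field_simps)
  qed
  have "0 \<le> (e - t) * Z" unfolding lin(2)[symmetric] by (intro integral_nonneg_AE AE_I2) (use t in auto)
  then have te: "t \<le> e" using Z0 by (simp add: zero_le_mult_iff)
  have "0 \<le> (s - e) * Z" unfolding lin(4)[symmetric] by (intro integral_nonneg_AE AE_I2) (use t in \<open>auto simp: s_def\<close>)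
  then have es: "e \<le> s" using Z0 by (simp add: zero_le_mult_iff)
  define t' s' where "t' = t + a * (e - t)" and "s' = s - a * (s - e)"
  have lo: "t' * avg u y \<le> avg u' y" for y
  proof -
    have "a * ((e - t) * Z) \<le> avg u' y - t * avg u y"
      unfolding lin(1,2)[symmetric] by (intro avg_mono_bounds(1)) (use i t in auto)
    moreover have "a * (e - t) * avg u y \<le> a * (e - t) * Z"
      using te a_pos Z by (intro mult_left_mono) auto
    ultimately show ?thesis unfolding t'_def by (simp add: algebra_simps)
  qed
  have hi: "avg u' y \<le> s' * avg u y" for y
  proof -
    have "a * ((s - e) * Z) \<le> s * avg u y - avg u' y"
      unfolding lin(3,4)[symmetric] by (intro avg_mono_bounds(1)) (use i t in \<open>auto simp: s_def\<close>)
    moreover have "a * (s - e) * avg u y \<le> a * (s - e) * Z"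
      using es a_pos Z by (intro mult_left_mono) auto
    ultimately show ?thesis unfolding s'_def by (simp add: algebra_simps)
  qed
  have tt: "t \<le> t'" using te a_pos by (simp add: t'_def)
  have "s' - t' = (1 - a) * w * t" unfolding s'_def t'_def s_def by (simp add: algebra_simps)
  also have "\<dots> \<le> (1 - a) * w * t'" using tt a_le_1 w by (intro mult_left_mono) auto
  finally have "s' \<le> t' * (1 + (1 - a) * w)" by (simp add: algebra_simps)
  then have "s' * avg u y \<le> t' * (1 + (1 - a) * w) * avg u y" for y
    using av by (intro mult_right_mono) (auto intro: less_imp_le)
  then show ?thesis unfolding ratio_close_def using lo hi tt t(1)
    by (intro exI[of _ t']) (auto intro: order_trans)
qed

lemma avg_limit:
  fixes u :: "nat \<Rightarrow> 'a \<Rightarrow> real"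
  assumes "\<And>n. u n \<in> borel_measurable \<alpha>" "v \<in> borel_measurable \<alpha>"
    and "\<And>n x. 0 \<le> u n x" "\<And>n x. u n x \<le> C" "\<And>x. (\<lambda>n. u n x) \<longlonglongrightarrow> v x"
  shows "(\<lambda>n. avg (u n) y) \<longlonglongrightarrow> avg v y"
  unfolding avg_def
proof (rule integral_dominated_convergence[where w = "\<lambda>_. C"])
  show "(\<lambda>x. h x y * v x) \<in> borel_measurable \<alpha>" "(\<lambda>x. h x y * u n x) \<in> borel_measurable \<alpha>" for n
    using kernel_section assms by auto
  have "h x y * u n x \<le> 1 * C" for x n
    using assms(3,4) kernel_nonneg kernel_le by (intro mult_mono) auto
  then show "AE x in \<alpha>. norm (h x y * u n x) \<le> C" for n
    using assms(3) kernel_nonneg by (intro AE_I2) (auto simp: abs_mult)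
qed (use assms in \<open>auto intro!: tendsto_mult\<close>)

end

section \<open>The Sinkhorn iteration and its limit\<close>

locale sinkhorn = al: pos_kernel \<alpha> \<beta> h a + be: pos_kernel \<beta> \<alpha> "\<lambda>y x. h x y" a
  for \<alpha> :: "'a measure" and \<beta> :: "'b measure" and h a +
  assumes same_mass: "measure \<alpha> (space \<alpha>) = measure \<beta> (space \<beta>)"
begin

definition half :: "('a \<Rightarrow> real) \<Rightarrow> 'b \<Rightarrow> real" where
  "half u y = 1 / al.avg u y"

definition full :: "('a \<Rightarrow> real) \<Rightarrow> 'a \<Rightarrow> real" where
  "full u x = 1 / be.avg (half u) x"

lemma half_bpos: "bpos \<alpha> u \<Longrightarrow> bpos \<beta> (half u)"
  unfolding half_def[abs_def] by (intro bpos_inverse al.avg_bpos)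

lemma full_bpos: "bpos \<alpha> u \<Longrightarrow> bpos \<alpha> (full u)"
  unfolding full_def[abs_def] by (intro bpos_inverse be.avg_bpos half_bpos)

lemma full_contract:
  assumes "bpos \<alpha> u" "bpos \<alpha> u'" "0 \<le> w" "ratio_close w u u'"
  shows "ratio_close ((1 - a) * ((1 - a) * w)) (full u) (full u')"
proof -
  have "ratio_close ((1 - a) * w) (half u) (half u')" unfolding half_def[abs_def]
    by (rule ratio_close_inverse[OF al.avg_contract[OF assms] al.avg_bpos al.avg_bpos])
       (use al.a_le_1 assms in auto)
  then show ?thesis unfolding full_def[abs_def]
    by (intro ratio_close_inverse[OF be.avg_contract be.avg_bpos be.avg_bpos] half_bpos)
       (use al.a_le_1 assms in auto)
qed

lemma swap_integral:
  assumes "bpos \<alpha> u" "bpos \<beta> v"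
  shows "(\<integral>x. u x * be.avg v x \<partial>\<alpha>) = (\<integral>y. v y * al.avg u y \<partial>\<beta>)"
proof -
  interpret pair_sigma_finite \<alpha> \<beta> ..
  interpret fp: finite_measure "\<alpha> \<Otimes>\<^sub>M \<beta>" 
    by (intro finite_measure_pair_measure al.finite_measure_axioms be.finite_measure_axioms)
  obtain C where C: "\<And>x. u x \<le> C" and um: "u \<in> borel_measurable \<alpha>"
    using assms unfolding bpos_def by blast
  obtain D where D: "\<And>x. v x \<le> D" and vm: "v \<in> borel_measurable \<beta>"
    using assms unfolding bpos_def by blast
  have up: "0 \<le> u x" for x using bpos_pos[OF assms(1)] less_imp_le by blast
  have vp: "0 \<le> v x" for x using bpos_pos[OF assms(2)] less_imp_le by blast
  note [measurable] = um vm al.kernel_measurable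
  have m: "case_prod (\<lambda>x y. u x * (h x y * v y)) \<in> borel_measurable (\<alpha> \<Otimes>\<^sub>M \<beta>)"
    using al.kernel_measurable by (simp add: case_prod_beta)
  have b: "u x * (h x y * v y) \<le> C * (1 * D)" for x y
    using C[of x] D[of y] up vp al.kernel_nonneg al.kernel_le order_trans[OF up C] 
    by (intro mult_mono) auto
  have int: "integrable (\<alpha> \<Otimes>\<^sub>M \<beta>) (case_prod (\<lambda>x y. u x * (h x y * v y)))"
    by (rule fp.integrable_const_bound[OF _ m, of "C * (1 * D)"])
       (use b up vp al.kernel_nonneg in \<open>auto intro!: AE_I2 simp: abs_mult\<close>)
  have "(\<integral>y. \<integral>x. u x * (h x y * v y) \<partial>\<alpha> \<partial>\<beta>) = (\<integral>x. \<integral>y. u x * (h x y * v y) \<partial>\<beta> \<partial>\<alpha>)"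
    by (rule Fubini_integral[OF int])
  moreover have "(\<integral>y. u x * (h x y * v y) \<partial>\<beta>) = u x * be.avg v x" for x
    unfolding be.avg_def by (rule integral_mult_right_zero)
  moreover have "(\<integral>x. u x * (h x y * v y) \<partial>\<alpha>) = v y * al.avg u y" for y
    unfolding al.avg_def by (subst integral_mult_right_zero[symmetric]) (simp add: mult_ac)
  ultimately show ?thesis by (simp only:)
qed

text \<open>Comparing total masses locates the scaling factor of \<^const>\<open>ratio_close\<close> around \<open>1\<close>.\<close>

lemma ratio_close_full:
  assumes u: "bpos \<alpha> u" and w: "0 \<le> w" and cl: "ratio_close w u (full u)"
  shows "\<bar>ln (full u x) - ln (u x)\<bar> \<le> w"
proof -
  obtain t where t: "t > 0" "\<And>x. t * u x \<le> full u x" "\<And>x. full u x \<le> t * (1 + w) * u x"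
    using cl unfolding ratio_close_def by blast
  let ?m = "measure \<alpha> (space \<alpha>)"
  define g where "g x = u x * be.avg (half u) x" for x
  have gp: "0 < g x" for x
    unfolding g_def by (intro mult_pos_pos bpos_pos[OF u] bpos_pos[OF be.avg_bpos] half_bpos u)
  \<comment> \<open>\<open>half\<close> makes the second marginal exact, so the plan already has the
    right total mass before the first marginal is corrected; \<open>g\<close> is the density of that
    first marginal.\<close>
  have gm: "(\<integral>x. g x \<partial>\<alpha>) = ?m"
  proof -
    have "(\<integral>x. g x \<partial>\<alpha>) = (\<integral>y. half u y * al.avg u y \<partial>\<beta>)"
      unfolding g_def by (rule swap_integral[OF u half_bpos[OF u]])
    also have "\<dots> = (\<integral>y. 1 \<partial>\<beta>)"
      using bpos_pos[OF al.avg_bpos[OF u]] by (intro Bochner_Integration.integral_cong) (auto simp: half_def less_imp_neq[symmetric])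
    finally show ?thesis using same_mass by simp
  qed
  have gi: "integrable \<alpha> g"
    using gm al.mass_pos not_integrable_integral_eq[of \<alpha> g] by force
  have av: "be.avg (half u) x > 0" for x using bpos_pos[OF be.avg_bpos[OF half_bpos[OF u]]] .
  have g1: "t * g x \<le> 1" "1 \<le> t * (1 + w) * g x" for x
    using t(2)[of x] t(3)[of x] av[of x] by (auto simp: g_def full_def field_simps)
  have "t * ?m = (\<integral>x. t * g x \<partial>\<alpha>)" using gm by simp
  also have "\<dots> \<le> (\<integral>x. 1 \<partial>\<alpha>)" using gi g1 by (intro integral_mono) auto
  finally have t1: "t \<le> 1" using al.mass_pos by simp
  have "?m = (\<integral>x. 1 \<partial>\<alpha>)" by simp
  also have "\<dots> \<le> (\<integral>x. t * (1 + w) * g x \<partial>\<alpha>)" using gi g1 by (intro integral_mono) auto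
  also have "\<dots> = t * (1 + w) * ?m" using gm by simp
  finally have t2: "1 \<le> t * (1 + w)" using al.mass_pos by simp
  have ux: "0 < u x" using bpos_pos[OF u] .
  have fx: "0 < full u x" using bpos_pos[OF full_bpos[OF u]] .
  have "full u x \<le> (1 + w) * u x"
    using t(3)[of x] mult_right_mono[OF t1, of "(1 + w) * u x"] ux w
    by (simp add: mult.assoc) (use order_trans in fastforce)
  then have "ln (full u x) \<le> ln ((1 + w) * u x)" using fx ux w by (subst ln_le_cancel_iff) auto
  also have "\<dots> = ln (1 + w) + ln (u x)" using ux w by (subst ln_mult) auto
  finally have 1: "ln (full u x) - ln (u x) \<le> w" using ln_add_one_self_le_self[OF w] by simp
  have "u x \<le> (t * (1 + w)) * u x" using t2 ux by simp
  also have "\<dots> = (1 + w) * (t * u x)" by simp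
  also have "\<dots> \<le> (1 + w) * full u x" using t(2)[of x] w by (intro mult_left_mono) auto
  finally have "ln (u x) \<le> ln ((1 + w) * full u x)" using fx ux w by (subst ln_le_cancel_iff) auto
  also have "\<dots> = ln (1 + w) + ln (full u x)" using fx w by (subst ln_mult) auto
  finally have 2: "ln (u x) - ln (full u x) \<le> w" using ln_add_one_self_le_self[OF w] by simp
  show ?thesis using 1 2 by linarith
qed


text \<open>The contraction makes the logarithmic increments summable, uniformly in x. Hence the
  iterates converge pointwise and stay between exp (- B) and exp B, which is the domination needed
  to pass to the limit under both averages. The limit is a fixed point of \<open>full\<close>, that
  is, a solution of both equations.\<close>

lemma scaling_exists:
  "\<exists>u v. bpos \<alpha> u \<and> bpos \<beta> v \<and> (\<forall>x. u x * be.avg v x = 1) \<and> (\<forall>y. v y * al.avg u y = 1)"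
proof -
  define un where "un n = (full ^^ n) (\<lambda>_. 1)" for n :: nat
  have un_Suc: "un (Suc n) = full (un n)" for n by (simp add: un_def)
  have unb: "bpos \<alpha> (un n)" for n
    by (induction n) (auto simp: un_def bpos_const intro: full_bpos)
  obtain c C where cC: "c > 0" "\<And>x. c \<le> un 1 x" "\<And>x. un 1 x \<le> C"
    using unb[of 1] unfolding bpos_def by blast
  define w0 where "w0 = C / c - 1"
  have w0: "0 \<le> w0" using cC order_trans[OF cC(2,3)] by (simp add: w0_def)
  have "ratio_close w0 (un 0) (un 1)"
    unfolding ratio_close_def using cC by (intro exI[of _ c]) (auto simp: un_def w0_def)
  define th where "th = (1 - a) * (1 - a)"
  have th: "0 \<le> th" "th < 1"
    using al.a_pos al.a_le_1 by (auto simp: th_def) (smt (verit) mult_left_le_one_le)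
  have cl: "ratio_close (th ^ n * w0) (un n) (un (Suc n))" for n
  proof (induction n)
    case 0 then show ?case using \<open>ratio_close w0 (un 0) (un 1)\<close> by simp
  next
    case (Suc n)
    from full_contract[OF unb unb _ Suc] show ?case
      using th w0 by (simp add: un_Suc th_def mult_ac)
  qed
  define L where "L n x = ln (un n x)" for n x
  have step: "\<bar>L (Suc n) x - L n x\<bar> \<le> th ^ n * w0" for n x
    unfolding L_def un_Suc using ratio_close_full[OF unb _ cl[of n, unfolded un_Suc]] th w0 by simp
  have summ: "summable (\<lambda>n. th ^ n * w0)" using th by (intro summable_mult2 summable_geometric) auto
  have summL: "summable (\<lambda>n. L (Suc n) x - L n x)" for x
    by (rule summable_comparison_test'[OF summ, of 0]) (use step in simp)
  define B where "B = (\<Sum>n. th ^ n * w0)"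
  have telL: "L n x = (\<Sum>i<n. L (Suc i) x - L i x)" for n x
    using sum_lessThan_telescope[of "\<lambda>i. L i x" n] by (simp add: L_def un_def)
  define l where "l x = (\<Sum>n. L (Suc n) x - L n x)" for x
  have lim: "(\<lambda>n. L n x) \<longlonglongrightarrow> l x" for x
    using summable_LIMSEQ[OF summL[of x]] unfolding l_def telL[symmetric] .
  have Lb: "\<bar>L n x\<bar> \<le> B" for n x
  proof -
    have "\<bar>L n x\<bar> \<le> (\<Sum>i<n. \<bar>L (Suc i) x - L i x\<bar>)" unfolding telL[of n] by (rule sum_abs)
    also have "\<dots> \<le> (\<Sum>i<n. th ^ i * w0)" by (intro sum_mono step)
    also have "\<dots> \<le> B" unfolding B_def by (intro sum_le_suminf summ) (use th w0 in auto)
    finally show ?thesis .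
  qed
  have unexp: "un n x = exp (L n x)" for n x using bpos_pos[OF unb] by (simp add: L_def)
  have unB: "exp (- B) \<le> un n x" "un n x \<le> exp B" for n x
    using Lb[of n x] by (auto simp: unexp)
  define u where "u x = exp (l x)" for x
  have limu: "(\<lambda>n. un n x) \<longlonglongrightarrow> u x" for x
    unfolding unexp u_def by (intro tendsto_exp lim)
  have um: "u \<in> borel_measurable \<alpha>"
    by (rule borel_measurable_LIMSEQ_real[OF limu]) (use unb in \<open>auto simp: bpos_def\<close>)
  have uB: "exp (- B) \<le> u x" "u x \<le> exp B" for x
    by (rule LIMSEQ_le_const[OF limu], use unB in auto) (rule LIMSEQ_le_const2[OF limu], use unB in auto)
  have ub: "bpos \<alpha> u" unfolding bpos_def using um uB by (intro conjI exI[of _ "exp (-B)"] exI[of _ "exp B"]) auto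
  have lima: "(\<lambda>n. al.avg (un n) y) \<longlonglongrightarrow> al.avg u y" for y
    by (rule al.avg_limit[where C = "exp B"])
       (use unb um limu unB bpos_pos[OF unb] in \<open>auto simp: bpos_def intro: less_imp_le\<close>)
  define v where "v = half u"
  have vb: "bpos \<beta> v" unfolding v_def by (rule half_bpos[OF ub])
  have limv: "(\<lambda>n. half (un n) y) \<longlonglongrightarrow> v y" for y
    unfolding v_def half_def using bpos_pos[OF al.avg_bpos[OF ub], of y]
    by (intro tendsto_divide lima tendsto_const) auto
  define D where "D = 1 / (a * (exp (- B) * measure \<alpha> (space \<alpha>)))"
  have halfB: "half (un n) y \<le> D" for n y
  proof -
    have i: "integrable \<alpha> (un n)" using bpos_integrable[OF al.finite_measure_axioms unb] .
    have "exp (- B) * measure \<alpha> (space \<alpha>) = (\<integral>x. exp (- B) \<partial>\<alpha>)" by simp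
    also have "\<dots> \<le> (\<integral>x. un n x \<partial>\<alpha>)" by (intro integral_mono i) (use unB in auto)
    finally have "a * (exp (- B) * measure \<alpha> (space \<alpha>)) \<le> a * (\<integral>x. un n x \<partial>\<alpha>)"
      using al.a_pos by (intro mult_left_mono) auto
    also have "\<dots> \<le> al.avg (un n) y"
      using al.avg_mono_bounds(1)[OF i] bpos_pos[OF unb] by (meson less_imp_le)
    finally show ?thesis unfolding D_def half_def
      using al.a_pos al.mass_pos by (intro divide_left_mono mult_pos_pos) (auto intro: less_le_trans[rotated])
  qed
  have limb: "(\<lambda>n. be.avg (half (un n)) x) \<longlonglongrightarrow> be.avg v x" for x
    by (rule be.avg_limit[where C = D])
       (use half_bpos[OF unb] vb limv halfB bpos_pos[OF half_bpos[OF unb]] in \<open>auto simp: bpos_def intro: less_imp_le\<close>)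
  have "(\<lambda>n. un (Suc n) x) \<longlonglongrightarrow> 1 / be.avg v x" for x
    unfolding un_Suc full_def using bpos_pos[OF be.avg_bpos[OF vb], of x]
    by (intro tendsto_divide limb tendsto_const) auto
  moreover have "(\<lambda>n. un (Suc n) x) \<longlonglongrightarrow> u x" for x using limu by (rule LIMSEQ_Suc)
  ultimately have "u x = 1 / be.avg v x" for x using LIMSEQ_unique by blast
  then have "u x * be.avg v x = 1" for x using bpos_pos[OF be.avg_bpos[OF vb], of x] by simp
  moreover have "v y * al.avg u y = 1" for y
    using bpos_pos[OF al.avg_bpos[OF ub], of y] by (simp add: v_def half_def)
  ultimately show ?thesis using ub vb by blast
qed

end

subsection \<open>Entropic projections\<close>

text \<open>The Kullback-Leibler integrand \<open>b * phi (a / b)\<close> for two densities relative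
  to a common reference measure.\<close>

definition dv :: "real \<Rightarrow> real \<Rightarrow> real" where
  "dv a b = (if a > 0 then a * ln (a / b) - a + b else b)"

lemma phi_scaled: "0 \<le> a \<Longrightarrow> 0 < b \<Longrightarrow> b * phi (a / b) = dv a b"
  unfolding phi_def dv_def by (auto simp: field_simps)

text \<open>The three-point identity of a Bregman divergence. When b / c is a product U V, the
  middle term becomes a sum of functions of one variable each, so its integral depends on
  \<open>a\<close> through marginals only.\<close>

lemma dv_split:
  assumes "0 \<le> a" "0 < b" "0 < c"
  shows "dv a c = dv a b + a * ln (b / c) - b + c"
  using assms unfolding dv_def by (auto simp: ln_div algebra_simps)

text \<open>This is ln x <= x - 1 at x = sqrt (b / a), multiplied by 2 a.\<close>

lemma hellinger_le_dv:
  assumes "0 \<le> a" "0 < b" shows "(sqrt a - sqrt b)\<^sup>2 \<le> dv a b"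
proof (cases "a = 0")
  case True then show ?thesis using assms by (simp add: dv_def)
next
  case False
  then have a: "a > 0" using assms by simp
  have "ln (b / a) \<le> 2 * (sqrt (b / a) - 1)"
    using ln_le_minus_one[of "sqrt (b / a)"] a assms by (simp add: ln_sqrt)
  then have "a * ln (b / a) \<le> a * (2 * (sqrt (b / a) - 1))" using a by (intro mult_left_mono) auto
  also have "\<dots> = 2 * (sqrt a * sqrt b) - 2 * a"
  proof -
    have "a * sqrt (b / a) = sqrt a * sqrt a * (sqrt b / sqrt a)" using a by (simp add: real_sqrt_divide)
    also have "\<dots> = sqrt a * sqrt b" using a by (simp add: field_simps)
    finally show ?thesis by (simp add: algebra_simps)
  qed
  finally have 1: "a * ln (b / a) \<le> 2 * (sqrt a * sqrt b) - 2 * a" .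
  have "(sqrt a - sqrt b)\<^sup>2 = a - 2 * (sqrt a * sqrt b) + b"
    using a assms by (simp add: power2_diff)
  then show ?thesis using 1 a assms by (simp add: dv_def ln_div algebra_simps)
qed

lemma dv_nonneg: "0 \<le> a \<Longrightarrow> 0 < b \<Longrightarrow> 0 \<le> dv a b"
  using hellinger_le_dv[of a b] by (meson order_trans zero_le_power2)

text \<open>The converse of \<open>hellinger_le_dv\<close> fails without an upper bound on a / b,
  because a ln a outgrows a. The chi-square integrand (a - b)^2 / b lies in between; it factors into
  the Hellinger term and a factor that is at most 4 R.\<close>

lemma dv_le_hellinger:
  assumes "0 \<le> a" "0 < b" "a \<le> R * b" "1 \<le> R"
  shows "dv a b \<le> 4 * R * (sqrt a - sqrt b)\<^sup>2"
proof -
  have "dv a b \<le> (a - b)\<^sup>2 / b"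
  proof (cases "a = 0")
    case True then show ?thesis using assms by (simp add: dv_def power2_eq_square)
  next
    case False
    then have "a > 0" using assms by simp
    then have "a * ln (a / b) \<le> a * (a / b - 1)"
      using ln_le_minus_one[of "a / b"] assms by (intro mult_left_mono) auto
    then have "dv a b \<le> a * (a / b - 1) - a + b" using \<open>a > 0\<close> by (simp add: dv_def)
    also have "\<dots> = (a - b)\<^sup>2 / b" using assms by (simp add: field_simps power2_eq_square)
    finally show ?thesis .
  qed
  also have "\<dots> = (sqrt a - sqrt b)\<^sup>2 * (sqrt a + sqrt b)\<^sup>2 / b"
  proof -
    have "a - b = (sqrt a - sqrt b) * (sqrt a + sqrt b)" using assms by (simp add: algebra_simps)
    then show ?thesis by (simp add: power_mult_distrib)
  qed
  also have "\<dots> \<le> (sqrt a - sqrt b)\<^sup>2 * (4 * R * b) / b"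
  proof -
    have "sqrt a \<le> sqrt (R * b)" using assms by (intro real_sqrt_le_mono)
    moreover have "sqrt b \<le> sqrt (R * b)" using assms by (intro real_sqrt_le_mono) simp
    ultimately have "sqrt a + sqrt b \<le> 2 * sqrt (R * b)" by linarith
    then have "(sqrt a + sqrt b)\<^sup>2 \<le> (2 * sqrt (R * b))\<^sup>2" using assms by (intro power_mono) auto
    also have "\<dots> = 4 * R * b" using assms by (simp add: power_mult_distrib)
    finally show ?thesis using assms by (intro divide_right_mono mult_left_mono) auto
  qed
  also have "\<dots> = 4 * R * (sqrt a - sqrt b)\<^sup>2" using assms by simp
  finally show ?thesis .
qed

lemma hellinger_le_add: "0 \<le> a \<Longrightarrow> 0 \<le> b \<Longrightarrow> (sqrt a - sqrt b)\<^sup>2 \<le> a + b"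
  by (simp add: power2_diff)

lemma dv_measurable [measurable]:
  assumes [measurable]: "f \<in> borel_measurable M" "g \<in> borel_measurable M"
  shows "(\<lambda>x. dv (f x) (g x)) \<in> borel_measurable M"
  unfolding dv_def by measurable

lemma x_ln_bounds:
  fixes x :: real assumes "0 \<le> x" "x \<le> C" shows "- 1 \<le> x * ln x" "x * ln x \<le> C * C"
proof -
  show "- 1 \<le> x * ln x"
  proof (cases "x = 0")
    case False
    then have "ln (1 / x) \<le> 1 / x - 1" using assms by (intro ln_le_minus_one) auto
    then have "x * ln (1 / x) \<le> x * (1 / x - 1)" using assms by (intro mult_left_mono) auto
    then show ?thesis using False assms by (simp add: ln_div algebra_simps)
  qed simp
  show "x * ln x \<le> C * C"
  proof (cases "x = 0")
    case False
    then have "ln x \<le> C" using ln_le_minus_one[of x] assms by simp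
    then have "x * ln x \<le> x * C" using assms by (intro mult_left_mono) auto
    also have "\<dots> \<le> C * C" using assms by (intro mult_right_mono) auto
    finally show ?thesis .
  qed (use assms in simp)
qed

lemma dv_bound:
  assumes p: "0 \<le> p" "p \<le> C" and k: "0 < l" "l \<le> k" "k \<le> 1"
  shows "\<bar>dv p k\<bar> \<le> C * C + C * \<bar>ln l\<bar> + 1"
proof -
  have C0: "0 \<le> C" using p by simp
  have "dv p k \<le> C * C + C * \<bar>ln l\<bar> + 1"
  proof (cases "p = 0")
    case True
    have "0 \<le> C * C" "0 \<le> C * \<bar>ln l\<bar>" using C0 by auto
    moreover have "dv p k = k" using True by (simp add: dv_def)
    ultimately show ?thesis using k by linarith
  next
    case False
    then have "p > 0" using p by simp
    have "- ln k \<le> \<bar>ln l\<bar>" using k ln_le_cancel_iff[of l k] by auto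
    then have "p * (- ln k) \<le> p * \<bar>ln l\<bar>" using p by (intro mult_left_mono) auto
    also have "\<dots> \<le> C * \<bar>ln l\<bar>" using p by (intro mult_right_mono) auto
    finally have "- p * ln k \<le> C * \<bar>ln l\<bar>" by simp
    then show ?thesis using x_ln_bounds[OF p] \<open>p > 0\<close> k p by (simp add: dv_def ln_div algebra_simps)
  qed
  moreover have "0 \<le> dv p k" using dv_nonneg p k by simp
  ultimately show ?thesis by simp
qed

lemma (in finite_measure) integrable_bounded:
  fixes f :: "'a \<Rightarrow> real"
  assumes "f \<in> borel_measurable M" "\<And>x. \<bar>f x\<bar> \<le> B" shows "integrable M f"
  by (rule integrable_const_bound[of _ B]) (use assms in auto)

text \<open>\<open>V\<close> may vanish; truncating it from below avoids the singularity of \<open>ln\<close> at \<open>0\<close>.\<close>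

lemma (in finite_measure) dv_projection:
  fixes k U V q p :: "'a \<Rightarrow> real"
  assumes [measurable]: "k \<in> borel_measurable M" "U \<in> borel_measurable M" "V \<in> borel_measurable M"
    and k: "0 < a" "\<And>z. a \<le> k z" "\<And>z. k z \<le> 1"
    and U: "\<And>z. 1 \<le> U z" "\<And>z. U z \<le> C" and V: "\<And>z. 0 \<le> V z" "\<And>z. V z \<le> C"
    and q: "integrable M q" "\<And>z. 0 \<le> q z"
    and p_def: "\<And>z. p z = U z * V z * k z"
    and eqU: "(\<integral>z. q z * ln (U z) \<partial>M) = (\<integral>z. p z * ln (U z) \<partial>M)"
    and eqV: "\<And>\<delta>. 0 < \<delta> \<Longrightarrow> (\<integral>z. q z * ln (max (V z) \<delta>) \<partial>M) = (\<integral>z. p z * ln (max (V z) \<delta>) \<partial>M)"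
  shows "ennreal ((\<integral>z. dv (p z) (k z) \<partial>M) + (\<integral>z. (sqrt (q z) - sqrt (p z))\<^sup>2 \<partial>M)) \<le> (\<integral>\<^sup>+z. ennreal (dv (q z) (k z)) \<partial>M)"
proof (cases "(\<integral>\<^sup>+z. ennreal (dv (q z) (k z)) \<partial>M) = \<infinity>")
  case False
  have [measurable]: "q \<in> borel_measurable M" using q by auto
  have C: "1 \<le> C" using U order_trans by blast
  have k0: "0 < k z" for z using k less_le_trans by blast
  have pm [measurable]: "p \<in> borel_measurable M"
    by (subst measurable_cong[of M p "\<lambda>z. U z * V z * k z"]) (auto simp: p_def)
  have p0: "0 \<le> p z" for z using U[of z] V[of z] k0[of z] by (simp add: p_def)
  have pC: "p z \<le> C * C * 1" for z unfolding p_def using U[of z] V[of z] k0[of z] k C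
    by (intro mult_mono) auto
  have dp: "integrable M (\<lambda>z. dv (p z) (k z))"
    by (rule integrable_bounded[OF _ dv_bound[OF p0 pC k(1) k(2) k(3)]]) measurable
  have dq: "integrable M (\<lambda>z. dv (q z) (k z))"
    using False dv_nonneg[OF q(2) k0] by (intro integrableI_nonneg) (auto simp: top.not_eq_extremum)
  have dqe: "(\<integral>\<^sup>+z. ennreal (dv (q z) (k z)) \<partial>M) = ennreal (\<integral>z. dv (q z) (k z) \<partial>M)"
    using dq dv_nonneg[OF q(2) k0] by (intro nn_integral_eq_integral) auto
  have ki: "integrable M k" using k0 k by (intro integrable_bounded[where B = 1]) (auto simp: abs_of_pos)
  have pint: "integrable M p" using p0 pC by (intro integrable_bounded[where B = "C * C * 1"]) (auto simp: abs_of_nonneg)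
  \<comment> \<open>Only \<open>V\<close> is truncated, so the logarithm of
    \<open>pd d z / k z\<close> still splits into a part from \<open>U\<close> and a part from
    \<open>V\<close>, to which \<open>eqU\<close> and \<open>eqV\<close> apply.\<close>
  define pd where "pd d z = U z * max (V z) d * k z" for d z
  have pdm [measurable]: "pd d \<in> borel_measurable M" for d unfolding pd_def by measurable
  have pd0: "0 < pd d z" if "0 < d" for d z unfolding pd_def
    using U[of z] V[of z] k0[of z] that by (intro mult_pos_pos) auto
  have pdp: "pd d z \<le> p z + C * d" if "0 < d" for d z
  proof -
    have "pd d z \<le> U z * (V z + d) * k z" unfolding pd_def
      using U[of z] V[of z] k0[of z] that by (intro mult_right_mono mult_left_mono) auto
    also have "\<dots> = p z + U z * d * k z" by (simp add: p_def algebra_simps)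
    also have "U z * d * k z \<le> C * d * 1"
      using U[of z] V[of z] k0[of z] that k C by (intro mult_mono) auto
    finally show ?thesis by simp
  qed
  have pdC: "pd d z \<le> C * C + C" if "0 < d" "d \<le> 1" for d z
    using pdp[OF that(1), of z] pC[of z] mult_left_mono[OF that(2), of C] C by linarith
  have hellb: "(sqrt (q z) - sqrt (pd d z))\<^sup>2 \<le> q z + (C * C + C)" if "0 < d" "d \<le> 1" for d z
    using hellinger_le_add[OF q(2) less_imp_le[OF pd0[OF that(1)]], of z z] pdC[OF that, of z] by linarith
  have hint: "integrable M (\<lambda>z. (sqrt (q z) - sqrt (pd d z))\<^sup>2)" if "0 < d" "d \<le> 1" for d
  proof (rule Bochner_Integration.integrable_bound[of M "\<lambda>z. q z + (C * C + C)"])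
    show "AE z in M. norm ((sqrt (q z) - sqrt (pd d z))\<^sup>2) \<le> norm (q z + (C * C + C))"
    proof (intro AE_I2)
      fix z show "norm ((sqrt (q z) - sqrt (pd d z))\<^sup>2) \<le> norm (q z + (C * C + C))"
        using hellb[OF that, of z] by simp
    qed
  qed (use q in auto)
  \<comment> \<open>Split \<open>dv (q z) (k z)\<close> through \<open>pd d\<close>, bound the
    divergence from q to \<open>pd d\<close> below by the Hellinger term, and exchange q for p under
    the two logarithms. The resulting expression in p exceeds the divergence of p up to the mass
    added by the truncation, at most C * d at each point.\<close>
  have key: "(\<integral>z. dv (p z) (k z) \<partial>M) + (\<integral>z. (sqrt (q z) - sqrt (pd d z))\<^sup>2 \<partial>M) - C * d * measure M (space M)
      \<le> (\<integral>z. dv (q z) (k z) \<partial>M)" if d: "0 < d" "d \<le> 1" for d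
  proof -
    have lnU: "0 \<le> ln (U z)" "ln (U z) \<le> ln C" for z using U[of z] by auto
    have lnV: "\<bar>ln (max (V z) d)\<bar> \<le> ln C + \<bar>ln d\<bar>" for z
    proof -
      have "max (V z) d \<le> C" using V C d by simp
      then have "ln (max (V z) d) \<le> ln C" using d C by (subst ln_le_cancel_iff) auto
      moreover have "ln d \<le> ln (max (V z) d)" using d by (subst ln_le_cancel_iff) auto
      moreover have "0 \<le> ln C" using C by simp
      ultimately show ?thesis by linarith
    qed
    have multi: "integrable M (\<lambda>z. f z * g z)" if "integrable M f" "g \<in> borel_measurable M" "\<And>z. \<bar>g z\<bar> \<le> B" for f g :: "'a \<Rightarrow> real" and B
    proof -
      have "integrable M (\<lambda>z. \<bar>f z\<bar> * B)" by (intro integrable_mult_left integrable_abs that)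
      then show ?thesis
      proof (rule Bochner_Integration.integrable_bound)
        have "\<bar>f z\<bar> * \<bar>g z\<bar> \<le> \<bar>\<bar>f z\<bar> * B\<bar>" for z
          using mult_left_mono[OF that(3) abs_ge_zero, of "f z" z] by linarith
        then show "AE z in M. norm (f z * g z) \<le> norm (\<bar>f z\<bar> * B)" by (simp add: abs_mult)
      qed (use that in measurable)
    qed
    have iU: "integrable M (\<lambda>z. f z * ln (U z))" if "integrable M f" for f
      using lnU by (intro multi[OF that, where B = "ln C"]) auto
    have iV: "integrable M (\<lambda>z. f z * ln (max (V z) d))" if "integrable M f" for f
      using lnV by (intro multi[OF that, where B = "ln C + \<bar>ln d\<bar>"]) auto
    have pdi: "integrable M (pd d)"
      using pd0[OF d(1)] pdC[OF d] by (intro integrable_bounded[where B = "C * C + C"]) (auto simp: abs_of_pos)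
    have "(\<integral>z. (sqrt (q z) - sqrt (pd d z))\<^sup>2 + q z * ln (U z) + q z * ln (max (V z) d) - pd d z + k z \<partial>M)
        \<le> (\<integral>z. dv (q z) (k z) \<partial>M)"
    proof (rule integral_mono)
      fix z
      have "pd d z / k z = U z * max (V z) d" using k0[of z] by (simp add: pd_def)
      then have "ln (pd d z / k z) = ln (U z) + ln (max (V z) d)"
        using U[of z] d by (simp add: ln_mult max_def)
      then show "(sqrt (q z) - sqrt (pd d z))\<^sup>2 + q z * ln (U z) + q z * ln (max (V z) d) - pd d z + k z \<le> dv (q z) (k z)"
        using dv_split[OF q(2) pd0[OF d(1)] k0, of z] hellinger_le_dv[OF q(2)[of z] pd0[OF d(1)], of z]
        by (simp add: algebra_simps)
    qed (use hint[OF d] iU[OF q(1)] iV[OF q(1)] pdi ki dq in auto)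
    also have "(\<integral>z. (sqrt (q z) - sqrt (pd d z))\<^sup>2 + q z * ln (U z) + q z * ln (max (V z) d) - pd d z + k z \<partial>M)
      = (\<integral>z. (sqrt (q z) - sqrt (pd d z))\<^sup>2 \<partial>M) + (\<integral>z. p z * ln (U z) \<partial>M) + (\<integral>z. p z * ln (max (V z) d) \<partial>M)
        - (\<integral>z. pd d z \<partial>M) + (\<integral>z. k z \<partial>M)"
      using hint[OF d] iU[OF q(1)] iV[OF q(1)] pdi ki eqU eqV[OF d(1)] by simp
    finally have 1: "(\<integral>z. (sqrt (q z) - sqrt (pd d z))\<^sup>2 \<partial>M) + (\<integral>z. p z * ln (U z) \<partial>M) + (\<integral>z. p z * ln (max (V z) d) \<partial>M)
        - (\<integral>z. pd d z \<partial>M) + (\<integral>z. k z \<partial>M) \<le> (\<integral>z. dv (q z) (k z) \<partial>M)" .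
    have "(\<integral>z. dv (p z) (k z) \<partial>M) \<le> (\<integral>z. p z * ln (U z) + p z * ln (max (V z) d) - (pd d z - C * d) + k z \<partial>M)"
    proof (rule integral_mono)
      fix z
      show "dv (p z) (k z) \<le> p z * ln (U z) + p z * ln (max (V z) d) - (pd d z - C * d) + k z"
      proof (cases "V z = 0")
        case True
        then show ?thesis using pdp[OF d(1), of z] by (simp add: p_def dv_def)
      next
        case False
        then have V0: "V z > 0" using V[of z] by simp
        have "p z > 0" unfolding p_def using U[of z] V0 k0[of z] by (intro mult_pos_pos) auto
        have "p z / k z = U z * V z" using k0[of z] by (simp add: p_def)
        then have "dv (p z) (k z) = p z * ln (U z) + p z * ln (V z) - p z + k z"
          using \<open>p z > 0\<close> U[of z] V0 by (simp add: dv_def ln_mult algebra_simps)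
        moreover have "p z * ln (V z) \<le> p z * ln (max (V z) d)"
          using V0 p0 by (intro mult_left_mono) auto
        ultimately show ?thesis using pdp[OF d(1), of z] by simp
      qed
    qed (use iU[OF pint] iV[OF pint] pdi ki dp in auto)
    also have "\<dots> = (\<integral>z. p z * ln (U z) \<partial>M) + (\<integral>z. p z * ln (max (V z) d) \<partial>M)
        - ((\<integral>z. pd d z \<partial>M) - C * d * measure M (space M)) + (\<integral>z. k z \<partial>M)"
      using iU[OF pint] iV[OF pint] pdi ki by simp
    finally show ?thesis using 1 by linarith
  qed
  define dn where "dn n = 1 / real (Suc n)" for n
  have dn: "0 < dn n" "dn n \<le> 1" for n by (auto simp: dn_def)
  have dn0: "dn \<longlonglongrightarrow> 0" unfolding dn_def by (rule LIMSEQ_Suc) (rule lim_1_over_n)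
  have "(\<lambda>n. \<integral>z. (sqrt (q z) - sqrt (pd (dn n) z))\<^sup>2 \<partial>M) \<longlonglongrightarrow> (\<integral>z. (sqrt (q z) - sqrt (p z))\<^sup>2 \<partial>M)"
  proof (rule integral_dominated_convergence[where w = "\<lambda>z. q z + (C * C + C)"])
    show "AE z in M. norm ((sqrt (q z) - sqrt (pd (dn n) z))\<^sup>2) \<le> q z + (C * C + C)" for n
      using hellb[OF dn] by (intro AE_I2) simp
    have "(\<lambda>n. pd (dn n) z) \<longlonglongrightarrow> U z * max (V z) 0 * k z" for z
      unfolding pd_def by (intro tendsto_intros dn0)
    then have "(\<lambda>n. pd (dn n) z) \<longlonglongrightarrow> p z" for z by (simp add: p_def max_absorb1[OF V(1)])
    then show "AE z in M. (\<lambda>n. (sqrt (q z) - sqrt (pd (dn n) z))\<^sup>2) \<longlonglongrightarrow> (sqrt (q z) - sqrt (p z))\<^sup>2"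
      by (intro AE_I2 tendsto_intros)
  qed (use q in auto)
  then have "(\<lambda>n. (\<integral>z. dv (p z) (k z) \<partial>M) + (\<integral>z. (sqrt (q z) - sqrt (pd (dn n) z))\<^sup>2 \<partial>M) - C * dn n * measure M (space M))
     \<longlonglongrightarrow> (\<integral>z. dv (p z) (k z) \<partial>M) + (\<integral>z. (sqrt (q z) - sqrt (p z))\<^sup>2 \<partial>M) - C * 0 * measure M (space M)"
    by (intro tendsto_intros dn0)
  then have "(\<integral>z. dv (p z) (k z) \<partial>M) + (\<integral>z. (sqrt (q z) - sqrt (p z))\<^sup>2 \<partial>M) - C * 0 * measure M (space M) \<le> (\<integral>z. dv (q z) (k z) \<partial>M)"
    by (rule LIMSEQ_le_const2) (use key[OF dn] in auto)
  then show ?thesis unfolding dqe by (intro ennreal_leI) simp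
qed simp

subsection \<open>Minimizers on a single composite cell\<close>

lemma sets_restr [simp]: "sets (restr \<rho> S) = sets \<rho>" and space_restr [simp]: "space (restr \<rho> S) = space \<rho>"
  by (auto simp: restr_def)

lemma emeasure_restr: "S \<in> sets \<rho> \<Longrightarrow> A \<in> sets \<rho> \<Longrightarrow> emeasure (restr \<rho> S) A = emeasure \<rho> (S \<inter> A)"
  unfolding restr_def by (simp add: emeasure_density nn_integral_set_ennreal[symmetric] sets.Int flip: indicator_inter_arith)

lemma restr_eq_density: "restr \<rho> S = density \<rho> (\<lambda>x. ennreal (indicator S x))"
  unfolding restr_def by (rule arg_cong[where f = "density \<rho>"]) (auto simp: fun_eq_iff indicator_def)

lemma is_entropic_minimizerD:
  assumes "is_entropic_minimizer \<epsilon> K \<mu> \<nu> \<pi>" "0 < \<epsilon>"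
  shows "\<pi> \<in> couplings \<mu> \<nu>" "\<rho> \<in> couplings \<mu> \<nu> \<Longrightarrow> KL \<pi> K \<le> KL \<rho> K"
proof -
  show "\<pi> \<in> couplings \<mu> \<nu>" using assms by (auto simp: is_entropic_minimizer_def is_arg_min_def)
  assume "\<rho> \<in> couplings \<mu> \<nu>"
  then have "\<not> ennreal \<epsilon> * KL \<rho> K < ennreal \<epsilon> * KL \<pi> K"
    using assms by (auto simp: is_entropic_minimizer_def is_arg_min_def)
  then show "KL \<pi> K \<le> KL \<rho> K"
    using assms(2) by (auto simp: not_less[symmetric] ennreal_mult_strict_left_mono)
qed

text \<open>\<open>\<kappa>\<close> stands for the norm of c divided by \<epsilon>. The bounds on
  \<open>k\<close> hold at every point, although those on c hold only almost everywhere; this allows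
  the scaling equations to be solved at every point.\<close>

locale ot = pair_prob_space \<mu> \<nu> for \<mu> :: "'a::topological_space measure" and \<nu> :: "'b::topological_space measure" +
  fixes k :: "'a \<times> 'b \<Rightarrow> real" and \<kappa> :: real
  assumes sets_mu [measurable_cong]: "sets \<mu> = sets borel" and sets_nu [measurable_cong]: "sets \<nu> = sets borel"
    and k_meas [measurable]: "k \<in> borel_measurable (\<mu> \<Otimes>\<^sub>M \<nu>)"
    and kappa_nonneg: "0 \<le> \<kappa>" and k_ge: "\<And>z. exp (- \<kappa>) \<le> k z" and k_le: "\<And>z. k z \<le> 1"
begin

abbreviation "M \<equiv> \<mu> \<Otimes>\<^sub>M \<nu>"

abbreviation dens :: "('a \<times> 'b \<Rightarrow> real) \<Rightarrow> ('a \<times> 'b) measure" where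
  "dens p \<equiv> density M (\<lambda>z. ennreal (p z))"

abbreviation hell :: "('a \<times> 'b \<Rightarrow> real) \<Rightarrow> ('a \<times> 'b \<Rightarrow> real) \<Rightarrow> real" where
  "hell p q \<equiv> (\<integral>z. (sqrt (p z) - sqrt (q z))\<^sup>2 \<partial>M)"

definition "K = dens k"

definition "ent p = (\<integral>z. dv (p z) (k z) \<partial>M)"

lemma k_pos: "0 < k z"
  using k_ge[of z] by (meson exp_gt_zero less_le_trans)

lemma space_mu: "space \<mu> = UNIV" and space_nu: "space \<nu> = UNIV"
  using sets_eq_imp_space_eq[OF sets_mu] sets_eq_imp_space_eq[OF sets_nu] by auto

lemma space_M: "space M = UNIV"
  by (simp add: space_pair_measure space_mu space_nu)

lemma sets_M: "sets M = sets (borel \<Otimes>\<^sub>M borel)"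
  by (intro sets_pair_measure_cong sets_mu sets_nu)

lemma finite_K: "finite_measure K"
proof
  have "emeasure K (space K) = (\<integral>\<^sup>+z. ennreal (k z) \<partial>M)"
    unfolding K_def by (simp add: emeasure_density)
  also have "\<dots> \<le> (\<integral>\<^sup>+z. 1 \<partial>M)" using k_le by (intro nn_integral_mono) auto
  also have "\<dots> < \<infinity>" by (simp add: P.emeasure_space_1)
  finally show "emeasure K (space K) \<noteq> \<infinity>" by simp
qed

lemma KL_density:
  assumes [measurable]: "p \<in> borel_measurable M" and p: "\<And>z. 0 \<le> p z"
  shows "KL (dens p) K = (\<integral>\<^sup>+z. ennreal (dv (p z) (k z)) \<partial>M)"
proof -
  interpret K: finite_measure K by (rule finite_K)
  define r where "r z = p z / k z" for z
  have [measurable]: "r \<in> borel_measurable M" unfolding r_def by measurable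
  have rK [measurable]: "r \<in> borel_measurable K" unfolding K_def by measurable
  have r0: "0 \<le> r z" for z unfolding r_def by (intro divide_nonneg_pos p k_pos)
  have eq: "dens p = density K (\<lambda>z. ennreal (r z))"
    unfolding K_def
    by (subst density_density_eq) (auto intro!: density_cong simp: ennreal_mult[symmetric] r_def p k_pos less_imp_le less_imp_neq[OF k_pos, symmetric])
  have ac: "absolutely_continuous K (dens p)"
    unfolding eq by (rule absolutely_continuousI_density) measurable
  have "AE z in K. ennreal (r z) = RN_deriv K (dens p) z"
    by (rule K.RN_deriv_unique) (auto simp: eq)
  then have "KL (dens p) K = (\<integral>\<^sup>+z. ennreal (phi (r z)) \<partial>K)"
    unfolding KL_def using ac
    by (auto intro!: nn_integral_cong_AE elim!: eventually_mono) (metis enn2real_ennreal r0)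
  also have "\<dots> = (\<integral>\<^sup>+z. ennreal (k z) * ennreal (phi (r z)) \<partial>M)"
    unfolding K_def by (rule nn_integral_density) (auto simp: phi_def)
  also have "\<dots> = (\<integral>\<^sup>+z. ennreal (dv (p z) (k z)) \<partial>M)"
    using k_pos phi_scaled[OF p k_pos] by (auto intro!: nn_integral_cong simp: ennreal_mult'[symmetric] less_imp_le r_def)
  finally show ?thesis .
qed

lemma dv_integrable:
  assumes "p \<in> borel_measurable M" "\<And>z. 0 \<le> p z" "\<And>z. p z \<le> C"
  shows "integrable M (\<lambda>z. dv (p z) (k z))"
  by (rule P.integrable_bounded[OF _ dv_bound[OF assms(2,3) exp_gt_zero k_ge k_le]])
     (use assms(1) in measurable)

lemma KL_density_bounded:
  assumes "p \<in> borel_measurable M" "\<And>z. 0 \<le> p z" "\<And>z. p z \<le> C"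
  shows "KL (dens p) K = ennreal (ent p)"
  unfolding KL_density[OF assms(1,2)] ent_def
  by (rule nn_integral_eq_integral[OF dv_integrable[OF assms]])
     (use dv_nonneg assms(2) k_pos in auto)

text \<open>Lets an arbitrary minimizer, of which only a finite divergence is known, enter the
  integral inequalities. No bound on its density is available at that stage.\<close>

lemma KL_finite_density:
  assumes "KL \<rho> K < \<infinity>" "sets \<rho> = sets M" "finite_measure \<rho>"
  shows "\<exists>q. q \<in> borel_measurable M \<and> (\<forall>z. 0 \<le> q z) \<and> integrable M q \<and> \<rho> = dens q"
proof -
  interpret K: finite_measure K by (rule finite_K)
  interpret R: finite_measure \<rho> by fact
  have acK: "absolutely_continuous K \<rho>" using assms(1) by (auto simp: KL_def split: if_splits)
  have "absolutely_continuous M K" unfolding K_def by (rule absolutely_continuousI_density) measurable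
  then have ac: "absolutely_continuous M \<rho>" using acK unfolding absolutely_continuous_def by blast
  let ?r = "RN_deriv M \<rho>"
  have rho: "density M ?r = \<rho>" by (rule P.density_RN_deriv[OF ac assms(2)])
  have fin: "AE z in M. ?r z \<noteq> \<infinity>"
    by (rule P.RN_deriv_finite[OF R.sigma_finite_measure_axioms ac assms(2)])
  define q where "q z = enn2real (?r z)" for z
  have qm [measurable]: "q \<in> borel_measurable M" unfolding q_def by measurable
  have eq: "\<rho> = dens q"
  proof -
    have "density M ?r = dens q"
      by (rule density_cong) (use fin in \<open>auto simp: q_def less_top elim!: eventually_mono\<close>)
    then show ?thesis using rho by simp
  qed
  have "(\<integral>\<^sup>+z. ennreal (q z) \<partial>M) = emeasure \<rho> (space M)"
    unfolding eq by (simp add: emeasure_density)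
  also have "\<dots> < \<infinity>" using R.emeasure_finite[of "space M"] unfolding infinity_ennreal_def by (simp only: top.not_eq_extremum)
  finally have "integrable M q" by (intro integrableI_nonneg) (auto simp: q_def)
  then show ?thesis using eq qm by (intro exI[of _ q]) (auto simp: q_def)
qed

lemma section_X [measurable]:
  assumes "p \<in> borel_measurable M" shows "(\<lambda>y. p (x, y)) \<in> borel_measurable \<nu>"
  using measurable_compose[OF measurable_Pair1'[of x \<mu> \<nu>] assms] by (simp add: space_mu)

lemma section_Y [measurable]:
  assumes "p \<in> borel_measurable M" shows "(\<lambda>x. p (x, y)) \<in> borel_measurable \<mu>"
  using measurable_compose[OF measurable_Pair2'[of y \<nu> \<mu>] assms] by (simp add: space_nu)

lemma marg_X_density:
  assumes [measurable]: "p \<in> borel_measurable M" "g \<in> borel_measurable \<mu>"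
    and "\<And>x. (\<integral>\<^sup>+y. p (x, y) \<partial>\<nu>) = g x"
  shows "marg_X (density M p) = density \<mu> g"
proof (rule measure_eqI)
  fix A assume "A \<in> sets (marg_X (density M p))"
  then have [measurable]: "A \<in> sets borel" by (simp add: marg_X_def)
  have "emeasure (marg_X (density M p)) A = emeasure (density M p) (fst -` A \<inter> space M)"
    unfolding marg_X_def by (subst emeasure_distr) auto
  also have "\<dots> = (\<integral>\<^sup>+z. p z * indicator A (fst z) \<partial>M)"
    by (subst emeasure_density) (auto intro!: nn_integral_cong simp: indicator_def)
  also have "\<dots> = (\<integral>\<^sup>+x. \<integral>\<^sup>+y. p (x, y) * indicator A x \<partial>\<nu> \<partial>\<mu>)"
    by (subst M2.nn_integral_fst[symmetric]) auto
  also have "\<dots> = (\<integral>\<^sup>+x. g x * indicator A x \<partial>\<mu>)"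
    using assms(3) by (subst nn_integral_multc) auto
  also have "\<dots> = emeasure (density \<mu> g) A" by (subst emeasure_density) auto
  finally show "emeasure (marg_X (density M p)) A = emeasure (density \<mu> g) A" .
qed (simp add: marg_X_def sets_mu)

lemma marg_Y_density:
  assumes [measurable]: "p \<in> borel_measurable M" "g \<in> borel_measurable \<nu>"
    and "\<And>y. (\<integral>\<^sup>+x. p (x, y) \<partial>\<mu>) = g y"
  shows "marg_Y (density M p) = density \<nu> g"
proof (rule measure_eqI)
  fix A assume "A \<in> sets (marg_Y (density M p))"
  then have [measurable]: "A \<in> sets borel" by (simp add: marg_Y_def)
  have "emeasure (marg_Y (density M p)) A = emeasure (density M p) (snd -` A \<inter> space M)"
    unfolding marg_Y_def by (subst emeasure_distr) auto
  also have "\<dots> = (\<integral>\<^sup>+z. p z * indicator A (snd z) \<partial>M)"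
    by (subst emeasure_density) (auto intro!: nn_integral_cong simp: indicator_def)
  also have "\<dots> = (\<integral>\<^sup>+y. \<integral>\<^sup>+x. p (x, y) * indicator A y \<partial>\<mu> \<partial>\<nu>)"
    by (subst nn_integral_snd[symmetric]) auto
  also have "\<dots> = (\<integral>\<^sup>+y. g y * indicator A y \<partial>\<nu>)"
    using assms(3) by (subst nn_integral_multc) auto
  also have "\<dots> = emeasure (density \<nu> g) A" by (subst emeasure_density) auto
  finally show "emeasure (marg_Y (density M p)) A = emeasure (density \<nu> g) A" .
qed (simp add: marg_Y_def sets_nu)

lemma integral_marg_X:
  fixes g :: "'a \<Rightarrow> real"
  assumes [measurable]: "q \<in> borel_measurable M" "g \<in> borel_measurable borel" and "\<And>z. 0 \<le> q z"
  shows "(\<integral>z. q z * g (fst z) \<partial>M) = (\<integral>x. g x \<partial>marg_X (dens q))"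
  unfolding marg_X_def
  by (subst integral_distr) (auto simp: integral_density assms)

lemma integral_marg_Y:
  fixes g :: "'b \<Rightarrow> real"
  assumes [measurable]: "q \<in> borel_measurable M" "g \<in> borel_measurable borel" and "\<And>z. 0 \<le> q z"
  shows "(\<integral>z. q z * g (snd z) \<partial>M) = (\<integral>x. g x \<partial>marg_Y (dens q))"
  unfolding marg_Y_def
  by (subst integral_distr) (auto simp: integral_density assms)


lemma pair_cong_meas:
  "sets \<alpha> = sets \<mu> \<Longrightarrow> sets \<beta> = sets \<nu> \<Longrightarrow> borel_measurable (\<alpha> \<Otimes>\<^sub>M \<beta>) = borel_measurable M"
  by (intro measurable_cong_sets sets_pair_measure_cong) auto

text \<open>The scaling freedom between \<open>U\<close> and \<open>V\<close> is fixed by making \<open>V\<close> a probability density.\<close>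

lemma schroedinger_system:
  assumes S: "S \<in> sets borel" "0 < measure \<mu> S"
    and f [measurable]: "f \<in> borel_measurable \<nu>" and f01: "\<And>y. 0 \<le> f y" "\<And>y. f y \<le> 1"
    and mass: "(\<integral>y. f y \<partial>\<nu>) = measure \<mu> S"
  shows "\<exists>U V C. U \<in> borel_measurable \<mu> \<and> (\<forall>x. 1 \<le> U x \<and> U x \<le> exp \<kappa>)
    \<and> V \<in> borel_measurable \<nu> \<and> (\<forall>y. 0 \<le> V y \<and> V y \<le> C) \<and> (\<integral>y. V y \<partial>\<nu>) = 1
    \<and> (\<forall>x. (\<integral>y. U x * V y * k (x, y) \<partial>\<nu>) = 1) \<and> (\<forall>y. (\<integral>x. indicator S x * (U x * V y * k (x, y)) \<partial>\<mu>) = f y)"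
proof -
  have Sm [measurable]: "S \<in> sets \<mu>" using S sets_mu by simp
  \<comment> \<open>The scaling problem is posed between the restricted first measure and the
    prescribed second marginal; \<open>mass\<close> says that their total masses agree.\<close>
  define \<alpha> where "\<alpha> = density \<mu> (\<lambda>x. ennreal (indicator S x))"
  define \<beta> where "\<beta> = density \<nu> (\<lambda>y. ennreal (f y))"
  have int\<alpha>: "(\<integral>x. g x \<partial>\<alpha>) = (\<integral>x. indicator S x * g x \<partial>\<mu>)" if "g \<in> borel_measurable \<mu>" for g :: "'a \<Rightarrow> real"
    unfolding \<alpha>_def using that by (subst integral_density) auto
  have int\<beta>: "(\<integral>x. g x \<partial>\<beta>) = (\<integral>x. f x * g x \<partial>\<nu>)" if "g \<in> borel_measurable \<nu>" for g :: "'b \<Rightarrow> real"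
    unfolding \<beta>_def using that f01 by (subst integral_density) auto
  interpret A: finite_measure \<alpha>
  proof
    have "emeasure \<alpha> (space \<alpha>) = (\<integral>\<^sup>+x. ennreal (indicator S x) * indicator (space \<mu>) x \<partial>\<mu>)"
      unfolding \<alpha>_def by (subst emeasure_density) auto
    also have "\<dots> \<le> (\<integral>\<^sup>+x. 1 \<partial>\<mu>)" by (rule nn_integral_mono) (simp add: indicator_def)
    finally have "emeasure \<alpha> (space \<alpha>) \<le> 1" by (simp add: M1.emeasure_space_1)
    then show "emeasure \<alpha> (space \<alpha>) \<noteq> \<infinity>" by (auto simp: top_unique)
  qed
  interpret B: finite_measure \<beta>
  proof
    have "emeasure \<beta> (space \<beta>) = (\<integral>\<^sup>+y. ennreal (f y) * indicator (space \<nu>) y \<partial>\<nu>)"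
      unfolding \<beta>_def by (subst emeasure_density) auto
    also have "\<dots> \<le> (\<integral>\<^sup>+y. 1 \<partial>\<nu>)" by (rule nn_integral_mono) (simp add: indicator_def f01)
    finally have "emeasure \<beta> (space \<beta>) \<le> 1" by (simp add: M2.emeasure_space_1)
    then show "emeasure \<beta> (space \<beta>) \<noteq> \<infinity>" by (auto simp: top_unique)
  qed
  have sp: "space \<alpha> = UNIV" "space \<beta> = UNIV" by (auto simp: \<alpha>_def \<beta>_def space_mu space_nu)
  have m\<alpha>: "measure \<alpha> UNIV = measure \<mu> S"
    using int\<alpha>[of "\<lambda>_. 1"] by (simp add: sp)
  have m\<beta>: "measure \<beta> UNIV = measure \<mu> S"
    using int\<beta>[of "\<lambda>_. 1"] mass by (simp add: sp)
  have sa: "sets \<alpha> = sets \<mu>" and sb: "sets \<beta> = sets \<nu>" by (auto simp: \<alpha>_def \<beta>_def)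
  interpret sinkhorn \<alpha> \<beta> "\<lambda>x y. k (x, y)" "exp (- \<kappa>)"
  proof unfold_locales
    show "(\<lambda>(x, y). k (x, y)) \<in> borel_measurable (\<alpha> \<Otimes>\<^sub>M \<beta>)"
      unfolding pair_cong_meas[OF sa sb] by simp
    have "(\<lambda>z. k (snd z, fst z)) \<in> borel_measurable (\<nu> \<Otimes>\<^sub>M \<mu>)"
      by (rule measurable_compose[OF _ k_meas]) simp
    moreover have "(borel_measurable (\<beta> \<Otimes>\<^sub>M \<alpha>) :: ('b \<times> 'a \<Rightarrow> real) set) = borel_measurable (\<nu> \<Otimes>\<^sub>M \<mu>)"
      by (intro measurable_cong_sets sets_pair_measure_cong sa sb) auto
    ultimately show "(\<lambda>(y, x). k (x, y)) \<in> borel_measurable (\<beta> \<Otimes>\<^sub>M \<alpha>)"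
      by (simp only: case_prod_beta')
  qed (use S k_ge k_le in \<open>auto simp: m\<alpha> m\<beta> sp\<close>)
  obtain u v where u: "bpos \<alpha> u" and v: "bpos \<beta> v"
    and ux: "\<And>x. u x * be.avg v x = 1" and vy: "\<And>y. v y * al.avg u y = 1"
    using scaling_exists by blast
  have um [measurable]: "u \<in> borel_measurable \<mu>" and vm [measurable]: "v \<in> borel_measurable \<nu>"
    using u v measurable_cong_sets[OF sa refl] measurable_cong_sets[OF sb refl] by (auto simp: bpos_def)
  \<comment> \<open>\<open>U\<close> will be \<open>T\<close> divided by an average of k against a
    measure of total mass \<open>T\<close>. As k lies between exp (- \<kappa>) and 1, this puts
    \<open>U\<close> between 1 and exp \<kappa>, and the reciprocal factor makes \<open>V\<close>
    integrate to 1.\<close>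
  define T where "T = (\<integral>y. f y * v y \<partial>\<nu>)"
  have T: "T = (\<integral>y. v y \<partial>\<beta>)" using int\<beta>[of v] by (simp add: T_def)
  have vi: "integrable \<beta> v" using bpos_integrable[OF B.finite_measure_axioms v] .
  have v0: "0 < v y" for y using bpos_pos[OF v] .
  have avb: "exp (- \<kappa>) * T \<le> be.avg v x" "be.avg v x \<le> T" for x
    unfolding T using be.avg_mono_bounds[OF vi] v0 less_imp_le by blast+
  have av0: "0 < be.avg v x" for x using bpos_pos[OF be.avg_bpos[OF v]] .
  have T0: "0 < T" using av0 avb(2) less_le_trans by blast
  define U where "U x = u x * T" for x
  \<comment> \<open>Absorbing \<open>f\<close> turns the plan into a density against the product
    measure; this is why \<open>V\<close> may vanish.\<close>
  define V where "V y = v y * f y / T" for y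
  obtain Cv where Cv: "\<And>y. v y \<le> Cv" using v unfolding bpos_def by blast
  have avg_v: "be.avg v x = (\<integral>y. f y * (k (x, y) * v y) \<partial>\<nu>)" for x
    unfolding be.avg_def by (subst int\<beta>) auto
  have avg_u: "al.avg u y = (\<integral>x. indicator S x * (k (x, y) * u x) \<partial>\<mu>)" for y
    unfolding al.avg_def by (subst int\<alpha>) auto
  have Ueq: "U x = T / be.avg v x" for x
    using ux[of x] av0[of x] by (simp add: U_def field_simps)
  have "1 \<le> U x" for x unfolding Ueq using avb(2)[of x] av0[of x] by simp
  moreover have "U x \<le> exp \<kappa>" for x unfolding Ueq using avb(1)[of x] av0[of x] by (simp add: field_simps exp_minus)
  moreover have "0 \<le> V y" for y using v0[of y] f01[of y] T0 by (simp add: V_def)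
  moreover have "V y \<le> Cv / T" for y
  proof -
    have "v y * f y \<le> Cv * 1" using v0[of y] f01[of y] Cv[of y] by (intro mult_mono) auto
    then show ?thesis using T0 by (simp add: V_def divide_right_mono)
  qed
  moreover have "(\<integral>y. V y \<partial>\<nu>) = 1"
    using T0 by (simp add: V_def T_def mult.commute)
  moreover have "(\<integral>y. U x * V y * k (x, y) \<partial>\<nu>) = 1" for x
  proof -
    have "(\<integral>y. U x * V y * k (x, y) \<partial>\<nu>) = (\<integral>y. u x * (f y * (k (x, y) * v y)) \<partial>\<nu>)"
      using T0 by (intro Bochner_Integration.integral_cong) (auto simp: U_def V_def)
    also have "\<dots> = 1" unfolding ux[of x, symmetric] avg_v by simp
    finally show ?thesis .
  qed
  moreover have "(\<integral>x. indicator S x * (U x * V y * k (x, y)) \<partial>\<mu>) = f y" for y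
  proof -
    have "(\<integral>x. indicator S x * (U x * V y * k (x, y)) \<partial>\<mu>) = (\<integral>x. f y * v y * (indicator S x * (k (x, y) * u x)) \<partial>\<mu>)"
      using T0 by (intro Bochner_Integration.integral_cong) (auto simp: U_def V_def)
    also have "\<dots> = f y * (v y * al.avg u y)" unfolding avg_u by simp
    also have "\<dots> = f y" by (simp add: vy)
    finally show ?thesis .
  qed
  moreover have "U \<in> borel_measurable \<mu>" "V \<in> borel_measurable \<nu>" unfolding U_def V_def by measurable
  ultimately show ?thesis
    by (intro exI[of _ U] exI[of _ V] exI[of _ "Cv / T"] conjI allI)
qed

text \<open>The scaling equations give an admissible \<open>p\<close>, and the minimizer has a
  density \<open>q\<close> with the same marginals. The Pythagorean inequality and minimality
  squeeze: ent p + hell q p is at most the divergence of the minimizer, which is at most ent p. So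
  the Hellinger distance vanishes, and the form and the uniqueness of the minimizer come out
  together.\<close>

lemma minimizer_density:
  assumes S: "S \<in> sets borel" "0 < measure \<mu> S"
    and f [measurable]: "f \<in> borel_measurable \<nu>" and f01: "\<And>y. 0 \<le> f y" "\<And>y. f y \<le> 1"
    and mass: "(\<integral>y. f y \<partial>\<nu>) = measure \<mu> S"
    and min: "is_entropic_minimizer \<epsilon> K (restr \<mu> S) (density \<nu> (\<lambda>y. ennreal (f y))) \<rho>" "0 < \<epsilon>"
  shows "\<exists>U V C. U \<in> borel_measurable \<mu> \<and> (\<forall>x. 1 \<le> U x \<and> U x \<le> exp \<kappa>)
    \<and> V \<in> borel_measurable \<nu> \<and> (\<forall>y. 0 \<le> V y \<and> V y \<le> C) \<and> (\<integral>y. V y \<partial>\<nu>) = 1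
    \<and> (\<forall>x. (\<integral>y. U x * V y * k (x, y) \<partial>\<nu>) = 1) \<and> (\<forall>y. (\<integral>x. indicator S x * (U x * V y * k (x, y)) \<partial>\<mu>) = f y)
    \<and> \<rho> = density M (\<lambda>(x, y). ennreal (indicator S x * (U x * V y * k (x, y))))"
proof -
  obtain U V C where U [measurable]: "U \<in> borel_measurable \<mu>" and U1: "\<And>x. 1 \<le> U x" "\<And>x. U x \<le> exp \<kappa>"
    and V [measurable]: "V \<in> borel_measurable \<nu>" and V0: "\<And>y. 0 \<le> V y" "\<And>y. V y \<le> C" and V1: "(\<integral>y. V y \<partial>\<nu>) = 1"
    and Ux: "\<And>x. (\<integral>y. U x * V y * k (x, y) \<partial>\<nu>) = 1"
    and Vy: "\<And>y. (\<integral>x. indicator S x * (U x * V y * k (x, y)) \<partial>\<mu>) = f y"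
    using schroedinger_system[OF S f f01 mass] by blast
  have Sm [measurable]: "S \<in> sets \<mu>" using S sets_mu by simp
  have Ub [measurable]: "U \<in> borel_measurable borel" and Vb [measurable]: "V \<in> borel_measurable borel"
    using U V by measurable
  define W where "W z = indicator S (fst z) * V (snd z)" for z :: "'a \<times> 'b"
  define p where "p z = U (fst z) * W z * k z" for z
  have Wm [measurable]: "W \<in> borel_measurable M" unfolding W_def by measurable
  have pm [measurable]: "p \<in> borel_measurable M" unfolding p_def by measurable
  have C: "0 \<le> C" using V0 order_trans by blast
  have W0: "0 \<le> W z" "W z \<le> C" for z using V0 C by (auto simp: W_def indicator_def)
  have U0: "0 \<le> U x" for x using U1(1)[of x] by simp
  have p0: "0 \<le> p z" for z unfolding p_def using U0 W0 k_pos by (simp add: less_imp_le)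
  have pC: "p z \<le> exp \<kappa> * C * 1" for z
    unfolding p_def using U0[of "fst z"] U1(2)[of "fst z"] W0[of z] k_pos[of z] k_le[of z] C by (intro mult_mono) auto
  have pxy: "p (x, y) = indicator S x * (U x * V y * k (x, y))" for x y by (simp add: p_def W_def)
  have bnd: "integrable \<nu> (\<lambda>y. p (x, y))" "integrable \<mu> (\<lambda>x. p (x, y))" for x y
    using p0 pC by (auto intro!: M1.integrable_bounded[where B = "exp \<kappa> * C * 1"] M2.integrable_bounded[where B = "exp \<kappa> * C * 1"] simp: abs_of_nonneg)
  have "marg_X (dens p) = density \<mu> (\<lambda>x. ennreal (indicator S x))"
  proof (rule marg_X_density)
    fix x
    have "(\<integral>\<^sup>+y. ennreal (p (x, y)) \<partial>\<nu>) = ennreal (\<integral>y. p (x, y) \<partial>\<nu>)"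
      by (rule nn_integral_eq_integral) (use bnd p0 in auto)
    also have "(\<integral>y. p (x, y) \<partial>\<nu>) = indicator S x" unfolding pxy by (simp add: Ux)
    finally show "(\<integral>\<^sup>+y. ennreal (p (x, y)) \<partial>\<nu>) = ennreal (indicator S x)" .
  qed measurable
  moreover have "marg_Y (dens p) = density \<nu> (\<lambda>y. ennreal (f y))"
  proof (rule marg_Y_density)
    fix y
    have "(\<integral>\<^sup>+x. ennreal (p (x, y)) \<partial>\<mu>) = ennreal (\<integral>x. p (x, y) \<partial>\<mu>)"
      by (rule nn_integral_eq_integral) (use bnd p0 in auto)
    also have "(\<integral>x. p (x, y) \<partial>\<mu>) = f y" unfolding pxy by (rule Vy)
    finally show "(\<integral>\<^sup>+x. ennreal (p (x, y)) \<partial>\<mu>) = ennreal (f y)" .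
  qed measurable
  ultimately have p_cpl: "dens p \<in> couplings (restr \<mu> S) (density \<nu> (\<lambda>y. ennreal (f y)))"
    by (simp add: couplings_def sets_M restr_eq_density)
  note mD = is_entropic_minimizerD[OF min]
  have KLp: "KL (dens p) K = ennreal (ent p)"
    by (rule KL_density_bounded[OF pm p0 pC])
  have le: "KL \<rho> K \<le> ennreal (ent p)" using mD(2)[OF p_cpl] KLp by simp
  have rho: "sets \<rho> = sets M" "marg_X \<rho> = restr \<mu> S" "marg_Y \<rho> = density \<nu> (\<lambda>y. ennreal (f y))"
    using mD(1) sets_M by (auto simp: couplings_def)
  have "finite_measure \<rho>"
  proof
    have "emeasure \<rho> (space \<rho>) = emeasure (marg_X \<rho>) UNIV"
      unfolding marg_X_def using rho(1) by (subst emeasure_distr) (auto simp: measurable_cong_sets[OF rho(1) refl])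
    also have "\<dots> = emeasure \<mu> S" unfolding rho(2) using sets.top[of \<mu>] by (subst emeasure_restr) (auto simp: space_mu)
    finally show "emeasure \<rho> (space \<rho>) \<noteq> \<infinity>" by simp
  qed
  then obtain q where q [measurable]: "q \<in> borel_measurable M" and q0: "\<And>z. 0 \<le> q z" and qi: "integrable M q"
    and rq: "\<rho> = dens q"
    using KL_finite_density[OF _ rho(1)] le by (metis ennreal_less_top infinity_ennreal_def order_le_less_trans)
  have margX: "marg_X (dens q) = marg_X (dens p)"
    and margY: "marg_Y (dens q) = marg_Y (dens p)"
    using rho rq p_cpl by (auto simp: couplings_def)
  \<comment> \<open>\<open>W\<close> contains the indicator of \<open>S\<close> and so is not a
    function of y alone. As both densities vanish off \<open>S\<close>, it can be replaced by
    \<open>V\<close> under the integrals, where equality of the second marginals suffices.\<close>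
  have qS: "AE z in M. fst z \<notin> S \<longrightarrow> q z = 0"
  proof -
    have "(\<integral>\<^sup>+z. ennreal (q z) * indicator (- S) (fst z) \<partial>M) = emeasure \<rho> (fst -` (- S) \<inter> space M)"
      unfolding rq by (subst emeasure_density) (auto intro!: nn_integral_cong simp: indicator_def space_mu space_nu)
    also have "\<dots> = emeasure (marg_X \<rho>) (- S)"
      unfolding marg_X_def using S(1) rho(1)
      by (subst emeasure_distr) (auto simp: measurable_cong_sets[OF rho(1) refl] sets_eq_imp_space_eq[OF rho(1)])
    also have "\<dots> = 0" unfolding rho(2) using S(1) by (subst emeasure_restr) (auto simp: sets_mu)
    finally have "AE z in M. ennreal (q z) * indicator (- S) (fst z) = 0"
      using S(1) by (subst (asm) nn_integral_0_iff_AE) auto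
    then show ?thesis by eventually_elim (auto simp: indicator_def q0 ennreal_eq_0_iff intro: antisym)
  qed
  have "ennreal ((\<integral>z. dv (p z) (k z) \<partial>M) + hell q p) \<le> (\<integral>\<^sup>+z. ennreal (dv (q z) (k z)) \<partial>M)"
  proof (rule P.dv_projection[where U = "\<lambda>z. U (fst z)" and V = W and C = "max C (exp \<kappa>)" and a = "exp (- \<kappa>)"])
    show "(\<integral>z. q z * ln (U (fst z)) \<partial>M) = (\<integral>z. p z * ln (U (fst z)) \<partial>M)"
      using integral_marg_X[of q "\<lambda>x. ln (U x)"] integral_marg_X[of p "\<lambda>x. ln (U x)"] q0 p0 margX by simp
    fix \<delta> :: real assume "0 < \<delta>"
    have red: "(\<integral>z. r z * ln (max (W z) \<delta>) \<partial>M) = (\<integral>z. r z * ln (max (V (snd z)) \<delta>) \<partial>M)"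
      if "AE z in M. fst z \<notin> S \<longrightarrow> r z = 0" and [measurable]: "r \<in> borel_measurable M" for r
      by (rule integral_cong_AE) (use that(1) in \<open>auto elim!: eventually_mono simp: W_def indicator_def\<close>)
    have "(\<integral>z. q z * ln (max (V (snd z)) \<delta>) \<partial>M) = (\<integral>z. p z * ln (max (V (snd z)) \<delta>) \<partial>M)"
      using integral_marg_Y[of q "\<lambda>x. ln (max (V x) \<delta>)"] integral_marg_Y[of p "\<lambda>x. ln (max (V x) \<delta>)"] q0 p0 margY by simp
    moreover have "AE z in M. fst z \<notin> S \<longrightarrow> p z = 0" by (auto simp: p_def W_def)
    ultimately show "(\<integral>z. q z * ln (max (W z) \<delta>) \<partial>M) = (\<integral>z. p z * ln (max (W z) \<delta>) \<partial>M)"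
      using red[OF qS] red[of p] by simp
  qed (use U1 W0 qi q0 k_ge k_le p_def in \<open>auto simp: le_max_iff_disj\<close>)
  also have "\<dots> = KL \<rho> K" unfolding rq by (rule KL_density[OF q q0, symmetric])
  also have "\<dots> \<le> ennreal (ent p)" by (rule le)
  finally have "ent p + hell q p \<le> ent p"
    unfolding ent_def
    by (subst (asm) ennreal_le_iff) (auto intro!: integral_nonneg_AE simp: dv_nonneg p0 k_pos)
  then have H0: "hell q p = 0"
    by (intro antisym integral_nonneg_AE) auto
  have "integrable M (\<lambda>z. (sqrt (q z) - sqrt (p z))\<^sup>2)"
  proof (rule Bochner_Integration.integrable_bound[of M "\<lambda>z. q z + p z"])
    have "integrable M p"
      by (rule P.integrable_bounded[OF pm, where B = "exp \<kappa> * C * 1"]) (use p0 pC in \<open>simp only: abs_of_nonneg\<close>)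
    with qi show "integrable M (\<lambda>z. q z + p z)" by (rule Bochner_Integration.integrable_add)
    show "AE z in M. norm ((sqrt (q z) - sqrt (p z))\<^sup>2) \<le> norm (q z + p z)"
    proof (rule AE_I2)
      fix z show "norm ((sqrt (q z) - sqrt (p z))\<^sup>2) \<le> norm (q z + p z)"
        using hellinger_le_add[OF q0[of z] p0[of z]] q0[of z] p0[of z] by simp
    qed
  qed measurable
  then have "AE z in M. (sqrt (q z) - sqrt (p z))\<^sup>2 = 0"
    using H0 by (subst (asm) integral_nonneg_eq_0_iff_AE) auto
  then have "\<rho> = dens p"
    unfolding rq by (intro density_cong) (auto elim!: eventually_mono)
  also have "(\<lambda>z. ennreal (p z)) = (\<lambda>(x, y). ennreal (indicator S x * (U x * V y * k (x, y))))"
    by (auto simp: fun_eq_iff pxy)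
  finally have "\<rho> = density M (\<lambda>(x, y). ennreal (indicator S x * (U x * V y * k (x, y))))" .
  then show ?thesis
    by (intro exI[of _ U] exI[of _ V] exI[of _ C] conjI allI) (rule U U1 V V0 V1 Ux Vy)+
qed

end

subsection \<open>Densities adapted to a basic partition\<close>

locale ot_cells = ot \<mu> \<nu> k \<kappa>
  for \<mu> :: "'a::topological_space measure" and \<nu> :: "'b::topological_space measure" and k \<kappa> +
  fixes I :: "'i set" and X :: "'i \<Rightarrow> 'a set"
  assumes fin_I: "finite I" and X_sets: "\<And>i. i \<in> I \<Longrightarrow> X i \<in> sets borel"
    and X_disj: "disjoint_family_on X I" and X_cover: "(\<Union>i\<in>I. X i) = UNIV"
    and X_pos: "\<And>i. i \<in> I \<Longrightarrow> 0 < measure \<mu> (X i)"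
begin

definition cell :: "'a \<Rightarrow> 'i" where "cell x = (THE i. i \<in> I \<and> x \<in> X i)"

lemma cell_unique: "i \<in> I \<Longrightarrow> x \<in> X i \<Longrightarrow> cell x = i"
  unfolding cell_def using X_disj by (intro the_equality) (auto simp: disjoint_family_on_def)

lemma cell_in: "cell x \<in> I" "x \<in> X (cell x)"
proof -
  have "x \<in> (\<Union>i\<in>I. X i)" using X_cover by simp
  then obtain i where "i \<in> I" "x \<in> X i" by blast
  then show "cell x \<in> I" "x \<in> X (cell x)" using cell_unique by auto
qed

lemma X_measurable: "i \<in> I \<Longrightarrow> X i \<in> sets \<mu>"
  using X_sets sets_mu by simp

lemma indicator_cell: "i \<in> I \<Longrightarrow> indicator (X i) x = (if cell x = i then 1 else 0 :: real)"
  using cell_unique[of i x] cell_in[of x] by (auto simp: indicator_def)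

lemma sum_cells: "(\<Sum>i\<in>I. indicator (X i) x * g i) = (g (cell x) :: real)"
proof -
  have "(\<Sum>i\<in>I. indicator (X i) x * g i) = (\<Sum>i\<in>I. if i = cell x then g i else 0)"
    by (intro sum.cong) (auto simp: indicator_cell)
  also have "\<dots> = g (cell x)" using fin_I cell_in(1)[of x] by simp
  finally show ?thesis .
qed

definition "m i = measure \<mu> (X i)"

lemma m_pos: "i \<in> I \<Longrightarrow> 0 < m i" by (simp add: m_def X_pos)

lemma m_le_1: "m i \<le> 1" by (simp add: m_def)

lemma integral_indicator_cell: "i \<in> I \<Longrightarrow> (\<integral>x. indicator (X i) x \<partial>\<mu>) = m i"
  using X_measurable[of i] by (simp add: m_def)

lemma integrable_indicator_cell: "i \<in> I \<Longrightarrow> integrable \<mu> (\<lambda>x. indicator (X i) x :: real)"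
  using X_measurable[of i] by (simp add: less_top[symmetric])

lemma sum_m: "(\<Sum>i\<in>I. m i) = 1"
proof -
  have "(\<Sum>i\<in>I. m i) = (\<integral>x. (\<Sum>i\<in>I. indicator (X i) x * 1) \<partial>\<mu>)"
    using integrable_indicator_cell by (subst Bochner_Integration.integral_sum) (auto simp: m_def space_mu)
  also have "\<dots> = 1" unfolding sum_cells by (simp add: M1.prob_space)
  finally show ?thesis .
qed

lemma sum_partition:
  fixes h :: "'i \<Rightarrow> real"
  assumes "partition_on I \<J>" shows "(\<Sum>i\<in>I. h i) = (\<Sum>J\<in>\<J>. \<Sum>i\<in>J. h i)"
  using sum.Union_disjoint[of \<J> h] assms fin_I finite_subset[of _ I]
  by (auto simp: partition_on_def disjoint_def)

text \<open>The density, relative to \<nu>, of the second marginal of the part of the plan that lies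
  over one basic cell.\<close>

definition Fy :: "('a \<times> 'b \<Rightarrow> real) \<Rightarrow> 'i \<Rightarrow> 'b \<Rightarrow> real" where
  "Fy p i y = (\<integral>x. indicator (X i) x * p (x, y) \<partial>\<mu>)"

lemma Fy_measurable [measurable]:
  assumes [measurable]: "p \<in> borel_measurable M" and i: "i \<in> I"
  shows "Fy p i \<in> borel_measurable \<nu>"
proof -
  note [measurable] = X_measurable[OF i]
  have "case_prod (\<lambda>y x. indicator (X i) x * p (x, y)) \<in> borel_measurable (\<nu> \<Otimes>\<^sub>M \<mu>)"
    by measurable
  from M1.borel_measurable_lebesgue_integral[OF this] show ?thesis unfolding Fy_def[abs_def] by simp
qed

text \<open>Bounded densities of couplings. The first marginal is exact at every x, as the scaling
  equations provide it there; the second is exact only almost everywhere, as the prescribed cell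
  marginals are Radon-Nikodym derivatives.\<close>

definition bdd_density :: "('a \<times> 'b \<Rightarrow> real) \<Rightarrow> bool" where
  "bdd_density p \<longleftrightarrow> p \<in> borel_measurable M \<and> (\<forall>z. 0 \<le> p z) \<and> (\<exists>B. \<forall>z. p z \<le> B) \<and> (\<forall>x. (\<integral>y. p (x, y) \<partial>\<nu>) = 1)
    \<and> (AE y in \<nu>. (\<Sum>i\<in>I. Fy p i y) = 1)"

lemma bounded_integrable_M:
  fixes f :: "'a \<times> 'b \<Rightarrow> real"
  assumes "f \<in> borel_measurable M" "\<And>z. \<bar>f z\<bar> \<le> B" shows "integrable M f"
  using P.integrable_bounded[OF assms] .

lemma abs_mult_bound: "\<bar>f\<bar> \<le> B \<Longrightarrow> \<bar>g\<bar> \<le> C \<Longrightarrow> \<bar>f * g\<bar> \<le> B * (C :: real)"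
  unfolding abs_mult by (intro mult_mono) auto

lemma bdd_densityD:
  assumes "bdd_density p"
  shows "p \<in> borel_measurable M" "0 \<le> p z" "\<exists>B\<ge>0. \<forall>z. \<bar>p z\<bar> \<le> B" "integrable M p"
    "integrable M (\<lambda>z. dv (p z) (k z))"
proof -
  obtain B where B: "\<And>z. p z \<le> B" using assms unfolding bdd_density_def by blast
  show p: "p \<in> borel_measurable M" and p0: "\<And>z. 0 \<le> p z" using assms unfolding bdd_density_def by auto
  show "\<exists>B\<ge>0. \<forall>z. \<bar>p z\<bar> \<le> B"
    using B p0 order_trans[OF p0 B] by (intro exI[of _ B]) auto
  show "integrable M p" by (rule bounded_integrable_M[OF p, of B]) (use B p0 in auto)
  show "integrable M (\<lambda>z. dv (p z) (k z))" by (rule dv_integrable[OF p p0 B])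
qed

lemma integral_M_fst:
  assumes p: "bdd_density p" and g: "g \<in> borel_measurable \<mu>" "\<And>x. \<bar>g x\<bar> \<le> C"
  shows "integrable M (\<lambda>z. p z * g (fst z))" "(\<integral>z. p z * g (fst z) \<partial>M) = (\<integral>x. g x \<partial>\<mu>)"
proof -
  note [measurable] = bdd_densityD(1)[OF p] g(1)
  obtain B where B: "\<And>z. \<bar>p z\<bar> \<le> B" using bdd_densityD(3)[OF p] by blast
  show int: "integrable M (\<lambda>z. p z * g (fst z))"
    by (rule bounded_integrable_M[of _ "B * C"]) (measurable, rule abs_mult_bound[OF B g(2)])
  have "(\<integral>z. p z * g (fst z) \<partial>M) = (\<integral>x. \<integral>y. p (x, y) * g x \<partial>\<nu> \<partial>\<mu>)"
    using integral_fst[of "\<lambda>x y. p (x, y) * g x"] int by (simp add: case_prod_beta')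
  also have "\<dots> = (\<integral>x. g x \<partial>\<mu>)" using p by (simp add: bdd_density_def)
  finally show "(\<integral>z. p z * g (fst z) \<partial>M) = (\<integral>x. g x \<partial>\<mu>)" .
qed

lemma integral_M_cell:
  assumes p [measurable]: "p \<in> borel_measurable M" and B: "\<And>z. \<bar>p z\<bar> \<le> B"
    and g [measurable]: "g \<in> borel_measurable \<nu>" and C: "\<And>x. \<bar>g x\<bar> \<le> C" and i: "i \<in> I"
  shows "integrable M (\<lambda>z. indicator (X i) (fst z) * p z * g (snd z))"
    "(\<integral>z. indicator (X i) (fst z) * p z * g (snd z) \<partial>M) = (\<integral>y. Fy p i y * g y \<partial>\<nu>)"
    "integrable \<nu> (\<lambda>y. Fy p i y * g y)"
proof -
  note [measurable] = X_measurable[OF i]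
  show int: "integrable M (\<lambda>z. indicator (X i) (fst z) * p z * g (snd z))"
    by (rule bounded_integrable_M[of _ "1 * B * C"])
       (measurable, rule abs_mult_bound[OF abs_mult_bound[OF _ B] C], auto simp: indicator_def)
  then have int': "integrable M (\<lambda>(x, y). indicator (X i) x * p (x, y) * g y)"
    by (simp add: case_prod_beta')
  have *: "(\<integral>x. indicator (X i) x * p (x, y) * g y \<partial>\<mu>) = Fy p i y * g y" for y
    unfolding Fy_def by simp
  show "(\<integral>z. indicator (X i) (fst z) * p z * g (snd z) \<partial>M) = (\<integral>y. Fy p i y * g y \<partial>\<nu>)"
    using integral_snd[OF int'] unfolding * by (simp add: case_prod_beta')
  show "integrable \<nu> (\<lambda>y. Fy p i y * g y)"
    using integrable_snd[OF int'] unfolding * .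
qed

lemma integral_M_snd:
  assumes p: "bdd_density p" and g: "g \<in> borel_measurable \<nu>" "\<And>x. \<bar>g x\<bar> \<le> C"
  shows "integrable M (\<lambda>z. p z * g (snd z))" "(\<integral>z. p z * g (snd z) \<partial>M) = (\<integral>y. g y \<partial>\<nu>)"
proof -
  note [measurable] = bdd_densityD(1)[OF p] g(1)
  obtain B where B: "\<And>z. \<bar>p z\<bar> \<le> B" using bdd_densityD(3)[OF p] by blast
  note c = integral_M_cell[OF bdd_densityD(1)[OF p] B g]
  show "integrable M (\<lambda>z. p z * g (snd z))"
    by (rule bounded_integrable_M[of _ "B * C"]) (measurable, rule abs_mult_bound[OF B g(2)])
  have "(\<integral>z. p z * g (snd z) \<partial>M) = (\<integral>z. (\<Sum>i\<in>I. indicator (X i) (fst z) * p z * g (snd z)) \<partial>M)"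
    using sum_cells[of _ "\<lambda>_. 1"] by (simp add: sum_distrib_right[symmetric])
  also have "\<dots> = (\<Sum>i\<in>I. \<integral>z. indicator (X i) (fst z) * p z * g (snd z) \<partial>M)"
    using c(1) by (rule Bochner_Integration.integral_sum)
  also have "\<dots> = (\<Sum>i\<in>I. \<integral>y. Fy p i y * g y \<partial>\<nu>)" using c(2) by simp
  also have "\<dots> = (\<integral>y. (\<Sum>i\<in>I. Fy p i y * g y) \<partial>\<nu>)"
    by (rule Bochner_Integration.integral_sum[OF c(3), symmetric])
  also have "\<dots> = (\<integral>y. g y \<partial>\<nu>)"
  proof (rule integral_cong_AE)
    show "AE y in \<nu>. (\<Sum>i\<in>I. Fy p i y * g y) = g y"
      using p unfolding bdd_density_def by (auto elim!: eventually_mono simp: sum_distrib_right[symmetric])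
  qed measurable
  finally show "(\<integral>z. p z * g (snd z) \<partial>M) = (\<integral>y. g y \<partial>\<nu>)" .
qed

text \<open>The shape of the densities of the iterates.\<close>

definition structured :: "'i set set \<Rightarrow> ('a \<times> 'b \<Rightarrow> real) \<Rightarrow> ('a \<Rightarrow> real) \<Rightarrow> ('i \<Rightarrow> 'b \<Rightarrow> real) \<Rightarrow> real \<Rightarrow> bool" where
  "structured \<J> p U V C \<longleftrightarrow> bdd_density p \<and> U \<in> borel_measurable \<mu> \<and> (\<forall>x. 1 \<le> U x \<and> U x \<le> exp \<kappa>)
     \<and> (\<forall>i\<in>I. V i \<in> borel_measurable \<nu> \<and> (\<forall>y. 0 \<le> V i y \<and> V i y \<le> C) \<and> (\<integral>y. V i y \<partial>\<nu>) = 1)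
     \<and> (\<forall>J\<in>\<J>. \<forall>i\<in>J. \<forall>j\<in>J. V i = V j)
     \<and> (\<forall>x y. p (x, y) = U x * V (cell x) y * k (x, y))"

lemma structuredD:
  assumes "structured \<J> p U V C"
  shows "bdd_density p" "U \<in> borel_measurable \<mu>" "1 \<le> U x" "U x \<le> exp \<kappa>"
    "i \<in> I \<Longrightarrow> V i \<in> borel_measurable \<nu>" "i \<in> I \<Longrightarrow> 0 \<le> V i y" "i \<in> I \<Longrightarrow> V i y \<le> C" "i \<in> I \<Longrightarrow> (\<integral>y. V i y \<partial>\<nu>) = 1"
    "J \<in> \<J> \<Longrightarrow> i \<in> J \<Longrightarrow> j \<in> J \<Longrightarrow> V i = V j"
    "p (x, y) = U x * V (cell x) y * k (x, y)"
  using assms unfolding structured_def by blast+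

text \<open>Over one basic cell \<open>V\<close> depends on y alone, while U k stays between exp (-
  \<kappa>) and exp \<kappa>. So a factor and its cell marginal control each other, and both
  directions are used below.\<close>

lemma Fy_bounds:
  assumes st: "structured \<J> p U V C" and i: "i \<in> I"
  shows "exp (- \<kappa>) * m i * V i y \<le> Fy p i y" "Fy p i y \<le> exp \<kappa> * m i * V i y"
proof -
  note D = structuredD[OF st]
  have le: "exp (- \<kappa>) \<le> U x * k (x, y)" "U x * k (x, y) \<le> exp \<kappa>" for x
  proof -
    have "1 * exp (- \<kappa>) \<le> U x * k (x, y)" using D(3)[of x] k_ge[of "(x, y)"] by (intro mult_mono) auto
    then show "exp (- \<kappa>) \<le> U x * k (x, y)" by simp
    have "U x * k (x, y) \<le> exp \<kappa> * 1" using D(3,4)[of x] k_le[of "(x, y)"] k_pos[of "(x, y)"] by (intro mult_mono) auto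
    then show "U x * k (x, y) \<le> exp \<kappa>" by simp
  qed
  obtain B where B: "\<And>z. \<bar>p z\<bar> \<le> B" using bdd_densityD(3)[OF D(1)] by blast
  note [measurable] = X_measurable[OF i] bdd_densityD(1)[OF D(1)]
  have int: "integrable \<mu> (\<lambda>x. indicator (X i) x * p (x, y))"
    by (rule M1.integrable_bounded[of _ "1 * B"]) (measurable, rule abs_mult_bound[OF _ B], auto simp: indicator_def)
  have eq: "indicator (X i) x * p (x, y) = indicator (X i) x * (V i y * (U x * k (x, y)))" for x
    using i by (auto simp: indicator_cell D(10))
  have "exp (- \<kappa>) * m i * V i y = (\<integral>x. indicator (X i) x * (V i y * exp (- \<kappa>)) \<partial>\<mu>)"
    using integral_indicator_cell[OF i] by (simp del: integral_indicator)
  also have "\<dots> \<le> Fy p i y" unfolding Fy_def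
    using integrable_indicator_cell[OF i] int le D(6)[OF i]
    by (intro integral_mono) (auto simp: eq intro!: mult_left_mono)
  finally show "exp (- \<kappa>) * m i * V i y \<le> Fy p i y" .
  have "Fy p i y \<le> (\<integral>x. indicator (X i) x * (V i y * exp \<kappa>) \<partial>\<mu>)" unfolding Fy_def
    using integrable_indicator_cell[OF i] int le D(6)[OF i]
    by (intro integral_mono) (auto simp: eq intro!: mult_left_mono)
  also have "\<dots> = exp \<kappa> * m i * V i y" using integral_indicator_cell[OF i] by (simp del: integral_indicator)
  finally show "Fy p i y \<le> exp \<kappa> * m i * V i y" .
qed

lemma Fy_nonneg: "structured \<J> p U V C \<Longrightarrow> i \<in> I \<Longrightarrow> 0 \<le> Fy p i y"
  using Fy_bounds(1)[of \<J> p U V C i y] structuredD(6)[of \<J> p U V C i y] m_pos[of i]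
  by (meson exp_ge_zero less_imp_le mult_nonneg_nonneg order_trans)

text \<open>One cell cannot contribute more than the whole second marginal, whose density is
  1.\<close>

lemma V_le:
  assumes st: "structured \<J> p U V C" and i: "i \<in> I"
  shows "AE y in \<nu>. V i y \<le> exp \<kappa> / m i"
proof -
  have "AE y in \<nu>. (\<Sum>i\<in>I. Fy p i y) = 1" using structuredD(1)[OF st] by (simp add: bdd_density_def)
  then show ?thesis
  proof eventually_elim
    case (elim y)
    have "exp (- \<kappa>) * m i * V i y \<le> Fy p i y" by (rule Fy_bounds[OF st i])
    also have "\<dots> \<le> (\<Sum>i\<in>I. Fy p i y)"
      using Fy_nonneg[OF st] i fin_I by (intro member_le_sum) auto
    finally show ?case using elim m_pos[OF i] by (simp add: field_simps exp_minus)
  qed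
qed

text \<open>The logarithm of \<open>V\<close> depends on x only through the composite cell. Its
  integral against a plan is therefore determined by the marginals over composite cells, which q and
  p share, and the Pythagorean inequality applies. This serves for a step of the algorithm and, with
  the one-cell partition, for the comparison with the optimal plan.\<close>

lemma ent_decrease:
  assumes st: "structured \<J> p U V C" and part: "partition_on I \<J>" and q: "bdd_density q"
    and F: "AE y in \<nu>. \<forall>J\<in>\<J>. (\<Sum>i\<in>J. Fy q i y) = (\<Sum>i\<in>J. Fy p i y)"
  shows "ent p + hell q p \<le> ent q"
proof -
  note D = structuredD[OF st]
  note q0 = bdd_densityD(2)[OF q] and p0 = bdd_densityD(2)[OF D(1)]
  note [measurable] = bdd_densityD(1)[OF q] bdd_densityD(1)[OF D(1)] D(2,5) X_measurable
  obtain Bp where Bp: "\<And>z. \<bar>p z\<bar> \<le> Bp" using bdd_densityD(3)[OF D(1)] by blast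
  obtain Bq where Bq: "\<And>z. \<bar>q z\<bar> \<le> Bq" using bdd_densityD(3)[OF q] by blast
  define W where "W z = V (cell (fst z)) (snd z)" for z
  have W_sum: "W z = (\<Sum>i\<in>I. indicator (X i) (fst z) * V i (snd z))" for z
    unfolding W_def by (rule sum_cells[symmetric])
  have Wm [measurable]: "W \<in> borel_measurable M" unfolding W_sum[abs_def] by measurable
  have W0: "0 \<le> W z" "W z \<le> C" for z unfolding W_def using D(6,7) cell_in(1) by auto
  have lnU: "\<bar>ln (U x)\<bar> \<le> \<kappa>" for x
    using D(3)[of x] D(4)[of x] ln_le_cancel_iff[of "U x" "exp \<kappa>"] by simp
  have "ennreal ((\<integral>z. dv (p z) (k z) \<partial>M) + hell q p) \<le> (\<integral>\<^sup>+z. ennreal (dv (q z) (k z)) \<partial>M)"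
  proof (rule P.dv_projection[where U = "\<lambda>z. U (fst z)" and V = W and C = "max C (exp \<kappa>)" and a = "exp (- \<kappa>)"])
    show "(\<integral>z. q z * ln (U (fst z)) \<partial>M) = (\<integral>z. p z * ln (U (fst z)) \<partial>M)"
      using integral_M_fst(2)[OF q, of "\<lambda>x. ln (U x)" \<kappa>] integral_M_fst(2)[OF D(1), of "\<lambda>x. ln (U x)" \<kappa>] lnU by simp
    fix \<delta> :: real assume \<delta>: "0 < \<delta>"
    define g where "g i y = ln (max (V i y) \<delta>)" for i y
    have gm [measurable]: "g i \<in> borel_measurable \<nu>" if "i \<in> I" for i unfolding g_def using that by measurable
    have g: "\<bar>g i y\<bar> \<le> \<bar>ln \<delta>\<bar> + \<bar>ln (max C \<delta>)\<bar>" if "i \<in> I" for i y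
    proof -
      have "ln \<delta> \<le> g i y" unfolding g_def using \<delta> by (subst ln_le_cancel_iff) auto
      moreover have "g i y \<le> ln (max C \<delta>)" unfolding g_def using \<delta> D(7)[OF that, of y] by (subst ln_le_cancel_iff) auto
      ultimately show ?thesis by linarith
    qed
    have red: "(\<integral>z. r z * ln (max (W z) \<delta>) \<partial>M) = (\<integral>y. (\<Sum>J\<in>\<J>. \<Sum>i\<in>J. Fy r i y * g i y) \<partial>\<nu>)"
      if r: "r \<in> borel_measurable M" "\<And>z. \<bar>r z\<bar> \<le> B" for r B
    proof -
      note c = integral_M_cell[OF r gm g]
      have "(\<integral>z. r z * ln (max (W z) \<delta>) \<partial>M) = (\<integral>z. (\<Sum>i\<in>I. indicator (X i) (fst z) * r z * g i (snd z)) \<partial>M)"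
        unfolding mult.assoc sum_cells by (simp add: g_def W_def)
      also have "\<dots> = (\<Sum>i\<in>I. \<integral>z. indicator (X i) (fst z) * r z * g i (snd z) \<partial>M)"
        using c(1) by (rule Bochner_Integration.integral_sum)
      also have "\<dots> = (\<Sum>i\<in>I. \<integral>y. Fy r i y * g i y \<partial>\<nu>)" using c(2) by (intro sum.cong) auto
      also have "\<dots> = (\<integral>y. (\<Sum>i\<in>I. Fy r i y * g i y) \<partial>\<nu>)"
        by (rule Bochner_Integration.integral_sum[OF c(3), symmetric])
      also have "\<dots> = (\<integral>y. (\<Sum>J\<in>\<J>. \<Sum>i\<in>J. Fy r i y * g i y) \<partial>\<nu>)"
        unfolding sum_partition[OF part] ..
      finally show ?thesis .
    qed
    have subI: "J \<subseteq> I" if "J \<in> \<J>" for J using part that by (auto simp: partition_on_def)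
    have finJ: "finite \<J>" using part fin_I finite_elements by blast
    have "(\<integral>y. (\<Sum>J\<in>\<J>. \<Sum>i\<in>J. Fy q i y * g i y) \<partial>\<nu>) = (\<integral>y. (\<Sum>J\<in>\<J>. \<Sum>i\<in>J. Fy p i y * g i y) \<partial>\<nu>)"
    proof (rule integral_cong_AE)
      show "AE y in \<nu>. (\<Sum>J\<in>\<J>. \<Sum>i\<in>J. Fy q i y * g i y) = (\<Sum>J\<in>\<J>. \<Sum>i\<in>J. Fy p i y * g i y)"
        using F
      proof eventually_elim
        case (elim y)
        show ?case
        proof (rule sum.cong[OF refl])
          fix J assume J: "J \<in> \<J>"
          show "(\<Sum>i\<in>J. Fy q i y * g i y) = (\<Sum>i\<in>J. Fy p i y * g i y)"
          proof (cases "J = {}")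
            case False
            then obtain j where j: "j \<in> J" by blast
            have "g i y = g j y" if "i \<in> J" for i using D(9)[OF J that j] by (simp add: g_def)
            then have "(\<Sum>i\<in>J. Fy r i y * g i y) = (\<Sum>i\<in>J. Fy r i y) * g j y" for r
              by (simp add: sum_distrib_right)
            then show ?thesis using elim J by simp
          qed simp
        qed
      qed
    qed (auto intro!: borel_measurable_sum borel_measurable_times gm Fy_measurable
         bdd_densityD(1)[OF q] bdd_densityD(1)[OF D(1)] subI[THEN subsetD])
    then show "(\<integral>z. q z * ln (max (W z) \<delta>) \<partial>M) = (\<integral>z. p z * ln (max (W z) \<delta>) \<partial>M)"
      using red[of q Bq] red[of p Bp] Bp Bq by simp
  qed (use D(3,4,10) W0 q0 bdd_densityD(4)[OF q] k_ge k_le in \<open>auto simp: le_max_iff_disj W_def\<close>)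
  also have "\<dots> = ennreal (ent q)" unfolding ent_def
    by (rule nn_integral_eq_integral[OF bdd_densityD(5)[OF q]]) (use dv_nonneg q0 k_pos in auto)
  finally show ?thesis unfolding ent_def
    by (subst (asm) ennreal_le_iff) (auto intro!: integral_nonneg_AE simp: dv_nonneg q0 k_pos)
qed

end

subsection \<open>Duality gap and comparison along paths\<close>

lemma (in ot) AE_snd:
  assumes "AE y in \<nu>. P y" shows "AE z in M. P (snd z)"
proof -
  have eq: "distr M \<nu> snd = \<nu>"
  proof (rule measure_eqI)
    fix A assume "A \<in> sets (distr M \<nu> snd)"
    then have A: "A \<in> sets \<nu>" by simp
    then have "emeasure (distr M \<nu> snd) A = emeasure M (space \<mu> \<times> A)"
      by (subst emeasure_distr) (auto intro!: arg_cong[where f = "emeasure M"] simp: space_pair_measure dest: sets.sets_into_space)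
    also have "\<dots> = emeasure \<nu> A"
      using A by (subst M2.emeasure_pair_measure_Times) (auto simp: M1.emeasure_space_1)
    finally show "emeasure (distr M \<nu> snd) A = emeasure \<nu> A" .
  qed simp
  show ?thesis by (rule AE_distrD[of snd M \<nu> P]) (simp_all only: eq assms measurable_snd)
qed

context ot_cells
begin

lemma measurable_cellwise: "(\<lambda>x. g (cell x) :: real) \<in> borel_measurable \<mu>"
proof -
  have "(\<lambda>x. \<Sum>i\<in>I. indicator (X i) x * g i) \<in> borel_measurable \<mu>"
    using X_measurable by (intro borel_measurable_sum borel_measurable_times) auto
  then show ?thesis by (simp add: sum_cells)
qed

lemma integral_cell_product:
  assumes g [measurable]: "g \<in> borel_measurable \<nu>" and C: "\<And>y. \<bar>g y\<bar> \<le> C" and i: "i \<in> I"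
  shows "integrable M (\<lambda>z. indicator (X i) (fst z) * g (snd z))"
    "(\<integral>z. indicator (X i) (fst z) * g (snd z) \<partial>M) = m i * (\<integral>y. g y \<partial>\<nu>)"
proof -
  note c = integral_M_cell[of "\<lambda>_. 1" 1, OF _ _ g C i]
  have "Fy (\<lambda>_. 1) i y = m i" for y
    unfolding Fy_def using integral_indicator_cell[OF i] by (simp del: integral_indicator)
  then show "integrable M (\<lambda>z. indicator (X i) (fst z) * g (snd z))"
    "(\<integral>z. indicator (X i) (fst z) * g (snd z) \<partial>M) = m i * (\<integral>y. g y \<partial>\<nu>)"
    using c by auto
qed

lemma hellinger_bounded:
  fixes a b :: real assumes "0 \<le> a" "0 \<le> b" "a \<le> A" "b \<le> B"
  shows "\<bar>(sqrt a - sqrt b)\<^sup>2\<bar> \<le> A + B"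
  using hellinger_le_add[OF assms(1,2)] assms by simp

text \<open>Weak duality: \<open>\<tau> U\<close> and \<open>V j0\<close> are admissible dual variables.\<close>

lemma duality_gap:
  assumes st: "structured \<J> p U V C" and r: "bdd_density r" and j0: "j0 \<in> I"
    and c0: "0 < c0" "AE y in \<nu>. c0 \<le> V j0 y"
    and tau: "\<And>i. i \<in> I \<Longrightarrow> 0 < \<tau> i" and R: "\<And>i. i \<in> I \<Longrightarrow> 1 \<le> R i"
    and VR: "\<And>i. i \<in> I \<Longrightarrow> AE y in \<nu>. V i y \<le> R i * (\<tau> i * V j0 y)"
  shows "ent p - ent r \<le> (\<Sum>i\<in>I. m i * (4 * R i * exp \<kappa> * (\<integral>y. (sqrt (V i y) - sqrt (\<tau> i * V j0 y))\<^sup>2 \<partial>\<nu>)))"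
proof -
  note D = structuredD[OF st]
  note p0 = bdd_densityD(2)[OF D(1)] and r0 = bdd_densityD(2)[OF r]
  note [measurable] = bdd_densityD(1)[OF r] bdd_densityD(1)[OF D(1)] D(2,5) X_measurable
  define Uh where "Uh x = \<tau> (cell x) * U x" for x
  \<comment> \<open>Almost everywhere equal to \<open>V j0\<close>; the truncation bounds the dual
    variable \<open>B\<close> at every point.\<close>
  define Vh where "Vh y = max (V j0 y) c0" for y
  define ph where "ph z = Uh (fst z) * Vh (snd z) * k z" for z
  define A where "A x = ln (Uh x)" for x
  define B where "B y = ln (Vh y)" for y
  have Uh0: "0 < Uh x" for x unfolding Uh_def using tau[OF cell_in(1)] D(3)[of x] by (intro mult_pos_pos) auto
  have Vh0: "0 < Vh y" for y unfolding Vh_def using c0 by auto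
  have ph0: "0 < ph z" for z unfolding ph_def by (intro mult_pos_pos Uh0 Vh0 k_pos)
  have [measurable]: "Uh \<in> borel_measurable \<mu>" unfolding Uh_def using measurable_cellwise[of \<tau>] by measurable
  have [measurable]: "Vh \<in> borel_measurable \<nu>" unfolding Vh_def using j0 by measurable
  have [measurable]: "ph \<in> borel_measurable M" unfolding ph_def by measurable
  have Am: "A \<in> borel_measurable \<mu>" and Bm: "B \<in> borel_measurable \<nu>" unfolding A_def B_def by measurable
  have Ab: "\<bar>A x\<bar> \<le> (\<Sum>i\<in>I. \<bar>ln (\<tau> i)\<bar>) + \<kappa>" for x
  proof -
    have "A x = ln (\<tau> (cell x)) + ln (U x)"
      unfolding A_def Uh_def using tau[OF cell_in(1)[of x]] D(3)[of x] by (simp add: ln_mult)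
    moreover have "\<bar>ln (U x)\<bar> \<le> \<kappa>" using D(3)[of x] D(4)[of x] ln_le_cancel_iff[of "U x" "exp \<kappa>"] by simp
    moreover have "\<bar>ln (\<tau> (cell x))\<bar> \<le> (\<Sum>i\<in>I. \<bar>ln (\<tau> i)\<bar>)"
      using member_le_sum[of "cell x" I "\<lambda>i. \<bar>ln (\<tau> i)\<bar>"] cell_in(1) fin_I by auto
    ultimately show ?thesis by linarith
  qed
  have Vhb: "Vh y \<le> max C c0" for y unfolding Vh_def using D(7)[OF j0, of y] by auto
  have Bb: "\<bar>B y\<bar> \<le> \<bar>ln c0\<bar> + \<bar>ln (max C c0)\<bar>" for y
  proof -
    have "ln c0 \<le> B y" unfolding B_def Vh_def using c0 by (subst ln_le_cancel_iff) auto
    moreover have "B y \<le> ln (max C c0)" unfolding B_def using Vhb[of y] Vh0[of y] c0 by (subst ln_le_cancel_iff) auto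
    ultimately show ?thesis by linarith
  qed
  have ki: "integrable M k" using k_pos k_le by (intro bounded_integrable_M[of _ 1]) (auto simp: abs_of_pos)
  have phi: "integrable M ph"
  proof (rule bounded_integrable_M)
    fix z :: "'a \<times> 'b"
    have "\<tau> (cell (fst z)) \<le> (\<Sum>i\<in>I. \<tau> i)" using member_le_sum[of "cell (fst z)" I \<tau>] cell_in(1) fin_I tau less_imp_le by auto
    then have "ph z \<le> (\<Sum>i\<in>I. \<tau> i) * exp \<kappa> * max C c0 * 1"
      unfolding ph_def Uh_def using D(3)[of "fst z"] D(4)[of "fst z"] Vhb[of "snd z"] Vh0[of "snd z"] k_pos[of z] k_le[of z] c0 tau less_imp_le
      by (intro mult_mono mult_nonneg_nonneg sum_nonneg) (auto intro: less_imp_le[OF tau[OF cell_in(1)]])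
    then show "\<bar>ph z\<bar> \<le> (\<Sum>i\<in>I. \<tau> i) * exp \<kappa> * max C c0 * 1" using ph0[of z] by simp
  qed measurable
  have split: "dv q (k z) = dv q (ph z) + q * A (fst z) + q * B (snd z) - ph z + k z" if "0 \<le> q" for q z
  proof -
    have "ph z / k z = Uh (fst z) * Vh (snd z)" using k_pos[of z] by (simp add: ph_def)
    then have "ln (ph z / k z) = A (fst z) + B (snd z)"
      unfolding A_def B_def using Uh0[of "fst z"] Vh0[of "snd z"] by (simp add: ln_mult)
    then show ?thesis using dv_split[OF that ph0[of z] k_pos[of z]] by (simp add: algebra_simps)
  qed
  note pA = integral_M_fst[OF D(1) Am Ab] and rA = integral_M_fst[OF r Am Ab]
  note pB = integral_M_snd[OF D(1) Bm Bb] and rB = integral_M_snd[OF r Bm Bb]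
  have dpe: "dv (p z) (ph z) = dv (p z) (k z) - p z * A (fst z) - p z * B (snd z) + ph z - k z" for z
    using split[OF p0, of z z] by simp
  have dpi: "integrable M (\<lambda>z. dv (p z) (ph z))"
    unfolding dpe using bdd_densityD(5)[OF D(1)] pA(1) pB(1) phi ki by auto
  have entp: "ent p = (\<integral>z. dv (p z) (ph z) \<partial>M) + (\<integral>x. A x \<partial>\<mu>) + (\<integral>y. B y \<partial>\<nu>) - (\<integral>z. ph z \<partial>M) + (\<integral>z. k z \<partial>M)"
    unfolding ent_def split[OF p0] using dpi pA pB phi ki by simp
  \<comment> \<open>Dropping the nonnegative term \<open>dv (r z) (ph z)\<close> is weak duality.
    The integrals of \<open>A\<close> and \<open>B\<close> are the same for p and r, both being
    couplings, and cancel in the difference.\<close>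
  have "(\<integral>z. r z * A (fst z) + r z * B (snd z) - ph z + k z \<partial>M) \<le> ent r"
    unfolding ent_def
  proof (rule integral_mono[OF _ bdd_densityD(5)[OF r]])
    fix z show "r z * A (fst z) + r z * B (snd z) - ph z + k z \<le> dv (r z) (k z)"
      unfolding split[OF r0] using dv_nonneg[OF r0[of z] ph0[of z]] by simp
  qed (use rA(1) rB(1) phi ki in auto)
  also have "(\<integral>z. r z * A (fst z) + r z * B (snd z) - ph z + k z \<partial>M)
     = (\<integral>x. A x \<partial>\<mu>) + (\<integral>y. B y \<partial>\<nu>) - (\<integral>z. ph z \<partial>M) + (\<integral>z. k z \<partial>M)"
    using rA rB phi ki by simp
  finally have 1: "ent p - ent r \<le> (\<integral>z. dv (p z) (ph z) \<partial>M)" using entp by simp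
  define g where "g i y = 4 * R i * exp \<kappa> * (sqrt (V i y) - sqrt (\<tau> i * V j0 y))\<^sup>2" for i y
  have gm: "g i \<in> borel_measurable \<nu>" if "i \<in> I" for i unfolding g_def using that j0 by measurable
  have gb: "\<bar>g i y\<bar> \<le> \<bar>4 * R i * exp \<kappa>\<bar> * (C + \<tau> i * C)" if "i \<in> I" for i y
    unfolding g_def using D(6,7)[OF that] D(6,7)[OF j0] tau[OF that]
    by (intro abs_mult_bound order_refl hellinger_bounded mult_nonneg_nonneg mult_left_mono) auto
  note gc = integral_cell_product[OF gm gb]
  have ae1: "AE z in M. c0 \<le> V j0 (snd z)" by (rule AE_snd[OF c0(2)])
  have ae2: "AE z in M. \<forall>i\<in>I. V i (snd z) \<le> R i * (\<tau> i * V j0 (snd z))"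
  proof (rule AE_finite_allI[OF fin_I])
    fix i assume "i \<in> I"
    from AE_snd[OF VR[OF this]] show "AE z in M. V i (snd z) \<le> R i * (\<tau> i * V j0 (snd z))" .
  qed
  have "(\<integral>z. dv (p z) (ph z) \<partial>M) \<le> (\<integral>z. (\<Sum>i\<in>I. indicator (X i) (fst z) * g i (snd z)) \<partial>M)"
  proof (rule integral_mono_AE[OF dpi])
    show "integrable M (\<lambda>z. \<Sum>i\<in>I. indicator (X i) (fst z) * g i (snd z))"
      using gc(1) by (intro Bochner_Integration.integrable_sum) auto
    show "AE z in M. dv (p z) (ph z) \<le> (\<Sum>i\<in>I. indicator (X i) (fst z) * g i (snd z))"
      using ae1 ae2
    proof eventually_elim
      case (elim z)
      obtain x y where z: "z = (x, y)" by force
      define i where "i = cell x"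
      have i: "i \<in> I" unfolding i_def by (rule cell_in)
      \<comment> \<open>\<open>p\<close> and \<open>ph\<close> share the factor U k at this point.
        It comes out of the square roots and is at most exp \<kappa>; what remains compares V_i with
        its multiple of \<open>V j0\<close>.\<close>
      define w a b where "w = U x * k z" and "a = V i y" and "b = \<tau> i * V j0 y"
      have w0: "0 < w" unfolding w_def using D(3)[of x] k_pos[of z] by (intro mult_pos_pos) auto
      have "w \<le> exp \<kappa> * 1"
        unfolding w_def using D(3,4)[of x] k_pos[of z] k_le[of z] by (intro mult_mono) auto
      with w0 have w: "0 < w" "w \<le> exp \<kappa> * 1" by auto
      have a0: "0 \<le> a" unfolding a_def by (rule D(6)[OF i])
      have pa: "p z = w * a" unfolding z D(10) by (simp add: w_def a_def i_def z)
      have phb: "ph z = w * b" using elim(1) by (simp add: ph_def Uh_def Vh_def w_def b_def z i_def)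
      have b0: "0 < b" using phb ph0[of z] w by (simp add: zero_less_mult_iff)
      have "a \<le> R i * b" using elim(2) i by (simp add: a_def b_def z)
      then have "dv (p z) (ph z) \<le> 4 * R i * (sqrt (p z) - sqrt (ph z))\<^sup>2"
        using w R[OF i] by (intro dv_le_hellinger p0 ph0) (auto simp: pa phb mult.left_commute)
      also have "(sqrt (p z) - sqrt (ph z))\<^sup>2 = w * (sqrt a - sqrt b)\<^sup>2"
        using w by (simp add: pa phb real_sqrt_mult power_mult_distrib flip: right_diff_distrib)
      also have "4 * R i * (w * (sqrt a - sqrt b)\<^sup>2) \<le> 4 * R i * (exp \<kappa> * 1 * (sqrt a - sqrt b)\<^sup>2)"
        using w R[OF i] by (intro mult_left_mono mult_right_mono) auto
      also have "\<dots> = (\<Sum>i\<in>I. indicator (X i) (fst z) * g i (snd z))"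
        unfolding sum_cells by (simp add: g_def a_def b_def z i_def)
      finally show ?case .
    qed
  qed
  also have "\<dots> = (\<Sum>i\<in>I. m i * (\<integral>y. g i y \<partial>\<nu>))"
    using gc by (subst Bochner_Integration.integral_sum) auto
  also have "\<dots> = (\<Sum>i\<in>I. m i * (4 * R i * exp \<kappa> * (\<integral>y. (sqrt (V i y) - sqrt (\<tau> i * V j0 y))\<^sup>2 \<partial>\<nu>)))"
    by (simp add: g_def)
  finally show ?thesis using 1 by linarith
qed

section \<open>Cellwise comparison of the factors of two plans\<close>

definition cell_dev :: "('a \<times> 'b \<Rightarrow> real) \<Rightarrow> ('a \<times> 'b \<Rightarrow> real) \<Rightarrow> 'i \<Rightarrow> real" where
  "cell_dev q p i = (\<integral>z. indicator (X i) (fst z) * (sqrt (q z) - sqrt (p z))\<^sup>2 \<partial>M)"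

lemma sqdiff_bounded:
  assumes "bdd_density q" "bdd_density p"
  shows "(\<lambda>z. (sqrt (q z) - sqrt (p z))\<^sup>2) \<in> borel_measurable M" "\<exists>B. \<forall>z. \<bar>(sqrt (q z) - sqrt (p z))\<^sup>2\<bar> \<le> B"
proof -
  note [measurable] = bdd_densityD(1)[OF assms(1)] bdd_densityD(1)[OF assms(2)]
  show "(\<lambda>z. (sqrt (q z) - sqrt (p z))\<^sup>2) \<in> borel_measurable M" by measurable
  obtain B1 where B1: "\<And>z. \<bar>q z\<bar> \<le> B1" using bdd_densityD(3)[OF assms(1)] by blast
  obtain B2 where B2: "\<And>z. \<bar>p z\<bar> \<le> B2" using bdd_densityD(3)[OF assms(2)] by blast
  have "\<bar>(sqrt (q z) - sqrt (p z))\<^sup>2\<bar> \<le> B1 + B2" for z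
    by (intro hellinger_bounded bdd_densityD(2)[OF assms(1)] bdd_densityD(2)[OF assms(2)] abs_le_D1[OF B1] abs_le_D1[OF B2])
  then show "\<exists>B. \<forall>z. \<bar>(sqrt (q z) - sqrt (p z))\<^sup>2\<bar> \<le> B" by blast
qed

text \<open>The third claim selects a point of the cell whose section does not exceed the average;
  if there were none, the integral over the cell would be too large. At a fixed x the factors
  depending on x become numbers.\<close>

lemma cell_dev_props:
  assumes "bdd_density q" "bdd_density p"
  shows "i \<in> I \<Longrightarrow> 0 \<le> cell_dev q p i" "(\<Sum>i\<in>I. cell_dev q p i) = hell q p"
    "i \<in> I \<Longrightarrow> \<exists>x\<in>X i. (\<integral>y. (sqrt (q (x, y)) - sqrt (p (x, y)))\<^sup>2 \<partial>\<nu>) \<le> cell_dev q p i / m i"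
proof -
  define d where "d z = (sqrt (q z) - sqrt (p z))\<^sup>2" for z
  obtain B where dm [measurable]: "d \<in> borel_measurable M" and B: "\<And>z. \<bar>d z\<bar> \<le> B"
    using sqdiff_bounded[OF assms] unfolding d_def by blast
  have dev: "cell_dev q p i = (\<integral>z. indicator (X i) (fst z) * d z \<partial>M)" for i by (simp add: cell_dev_def d_def)
  have d0: "0 \<le> d z" for z by (simp add: d_def)
  note c = integral_M_cell[OF dm B, of "\<lambda>_. 1" 1, simplified]
  show "0 \<le> cell_dev q p i" unfolding dev using d0 by (intro integral_nonneg_AE) auto
  show "(\<Sum>i\<in>I. cell_dev q p i) = hell q p"
  proof -
    have "(\<Sum>i\<in>I. cell_dev q p i) = (\<integral>z. (\<Sum>i\<in>I. indicator (X i) (fst z) * d z) \<partial>M)"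
      unfolding dev by (rule Bochner_Integration.integral_sum[symmetric]) (rule c)
    then show ?thesis unfolding sum_cells by (simp add: d_def)
  qed
  assume i: "i \<in> I"
  note [measurable] = X_measurable[OF i]
  define a where "a x = (\<integral>y. d (x, y) \<partial>\<nu>)" for x
  define t where "t = cell_dev q p i / m i"
  have int: "integrable M (\<lambda>(x, y). indicator (X i) x * d (x, y))" using c(1)[OF i] by (simp add: case_prod_beta')
  have fst: "integrable \<mu> (\<lambda>x. indicator (X i) x * a x)" "(\<integral>x. indicator (X i) x * a x \<partial>\<mu>) = cell_dev q p i"
    using integrable_fst[OF int] integral_fst[OF int] by (auto simp: a_def dev case_prod_beta')
  have "\<exists>x\<in>X i. a x \<le> t"
  proof (rule ccontr)
    assume "\<not> ?thesis"
    then have gt: "t < a x" if "x \<in> X i" for x using that by auto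
    have eq: "(\<integral>x. indicator (X i) x * a x - indicator (X i) x * t \<partial>\<mu>) = 0"
      using fst integrable_indicator_cell[OF i] integral_indicator_cell[OF i] m_pos[OF i]
      by (subst Bochner_Integration.integral_diff) (auto simp: t_def simp del: integral_indicator)
    have "AE x in \<mu>. indicator (X i) x * a x - indicator (X i) x * t = 0"
      using eq fst(1) integrable_indicator_cell[OF i] gt
      by (subst (asm) integral_nonneg_eq_0_iff_AE) (auto simp: indicator_def intro: less_imp_le)
    then have "AE x in \<mu>. x \<notin> X i" by eventually_elim (use gt in \<open>force simp: indicator_def\<close>)
    then have "measure \<mu> (X i) = 0"
      using X_measurable[OF i] by (simp add: AE_iff_null space_mu null_sets_def measure_def)
    then show False using X_pos[OF i] by simp
  qed
  then show "\<exists>x\<in>X i. (\<integral>y. (sqrt (q (x, y)) - sqrt (p (x, y)))\<^sup>2 \<partial>\<nu>) \<le> cell_dev q p i / m i"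
    by (simp add: a_def t_def d_def)
qed

text \<open>At the selected x the two plans are U(x) V_i k and U'(x) V'_i k. Dividing by U(x) k,
  which is at least exp (- \<kappa>), leaves V_i against s V'_i, where s is a quotient of two
  numbers between 1 and exp \<kappa>.\<close>

lemma scaled_hellinger_le_cell_dev:
  assumes st: "structured \<J> p U V C" and st': "structured \<J>' q U' V' C'" and i: "i \<in> I"
  shows "\<exists>s. exp (- \<kappa>) \<le> s \<and> s \<le> exp \<kappa> \<and> (\<integral>y. (sqrt (V i y) - sqrt (s * V' i y))\<^sup>2 \<partial>\<nu>) \<le> exp \<kappa> * (cell_dev q p i / m i)"
proof -
  note D = structuredD[OF st] and D' = structuredD[OF st']
  note [measurable] = D(5)[OF i] D'(5)[OF i] bdd_densityD(1)[OF D(1)] bdd_densityD(1)[OF D'(1)]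
  obtain x where x: "x \<in> X i" "(\<integral>y. (sqrt (q (x, y)) - sqrt (p (x, y)))\<^sup>2 \<partial>\<nu>) \<le> cell_dev q p i / m i"
    using cell_dev_props(3)[OF D'(1) D(1) i] by blast
  define s where "s = U' x / U x"
  have s0: "0 < s" using D(3)[of x] D'(3)[of x] by (simp add: s_def)
  have s1: "s \<le> exp \<kappa>"
    using D(3)[of x] D'(4)[of x] mult_mono[of "U' x" "exp \<kappa>" 1 "U x"] by (simp add: s_def divide_le_eq)
  have s2: "exp (- \<kappa>) \<le> s"
    using D(3,4)[of x] D'(3)[of x] mult_mono[of 1 "U' x" "U x" "exp \<kappa>"] by (simp add: s_def le_divide_eq exp_minus field_simps)
  define e where "e y = (sqrt (V i y) - sqrt (s * V' i y))\<^sup>2" for y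
  have em: "e \<in> borel_measurable \<nu>" unfolding e_def by measurable
  have eb: "\<bar>e y\<bar> \<le> C + s * C'" for y
    unfolding e_def using D(6,7)[OF i] D'(6,7)[OF i] s0 by (intro hellinger_bounded mult_left_mono) auto
  have ei: "integrable \<nu> e" by (rule M2.integrable_bounded[OF em eb])
  have eq: "(sqrt (q (x, y)) - sqrt (p (x, y)))\<^sup>2 = U x * k (x, y) * e y" for y
  proof -
    have c: "cell x = i" using cell_unique[OF i x(1)] .
    have "q (x, y) = U x * k (x, y) * (s * V' i y)" unfolding D'(10) using D(3)[of x] by (simp add: s_def c)
    moreover have "p (x, y) = U x * k (x, y) * V i y" unfolding D(10) by (simp add: c)
    moreover have "0 \<le> U x * k (x, y)" using D(3)[of x] k_pos[of "(x, y)"] by (intro mult_nonneg_nonneg) auto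
    ultimately show ?thesis
      by (simp add: e_def real_sqrt_mult[of "U x * k (x, y)"] power_mult_distrib power2_commute[of "sqrt (V i y)"] flip: right_diff_distrib)
  qed
  have "exp (- \<kappa>) * (\<integral>y. e y \<partial>\<nu>) = (\<integral>y. exp (- \<kappa>) * e y \<partial>\<nu>)" by simp
  also have "\<dots> \<le> (\<integral>y. (sqrt (q (x, y)) - sqrt (p (x, y)))\<^sup>2 \<partial>\<nu>)"
  proof (rule integral_mono)
    obtain B where "\<And>z. \<bar>(sqrt (q z) - sqrt (p z))\<^sup>2\<bar> \<le> B" using sqdiff_bounded(2)[OF D'(1) D(1)] by blast
    then show "integrable \<nu> (\<lambda>y. (sqrt (q (x, y)) - sqrt (p (x, y)))\<^sup>2)"
      by (intro M2.integrable_bounded[where B = B]) auto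
    fix y
    have "1 * exp (- \<kappa>) \<le> U x * k (x, y)" using D(3)[of x] k_ge[of "(x, y)"] by (intro mult_mono) auto
    then show "exp (- \<kappa>) * e y \<le> (sqrt (q (x, y)) - sqrt (p (x, y)))\<^sup>2"
      unfolding eq by (intro mult_right_mono) (auto simp: e_def)
  qed (use ei in auto)
  also note x(2)
  finally have "(\<integral>y. e y \<partial>\<nu>) \<le> exp \<kappa> * (cell_dev q p i / m i)"
    by (simp add: exp_minus field_simps)
  then show ?thesis using s1 s2 unfolding e_def by blast
qed


text \<open>Cauchy-Schwarz with weights 1, 1 and d. Giving weight d to the part accumulated so far
  makes the constants along a path grow linearly instead of geometrically. For d = 0 the quotient is
  0 by convention, and the hypothesis then removes c.\<close>

lemma three_squares:
  fixes a b c :: real assumes "d = 0 \<Longrightarrow> c = 0"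
  shows "(a + b + c)\<^sup>2 \<le> (real d + 2) * (a\<^sup>2 + b\<^sup>2 + c\<^sup>2 / real d)"
proof (cases "d = 0")
  case True
  have "0 \<le> (a - b)\<^sup>2" by simp
  then show ?thesis using True assms by (simp add: power2_eq_square algebra_simps)
next
  case False
  define e where "e = c / real d"
  have c: "c = e * real d" using False by (simp add: e_def)
  have "(real d + 2) * (a\<^sup>2 + b\<^sup>2 + c\<^sup>2 / real d) - (a + b + c)\<^sup>2 = (a - b)\<^sup>2 + real d * (a - e)\<^sup>2 + real d * (b - e)\<^sup>2"
    using False unfolding c by (simp add: field_simps power2_eq_square)
  also have "\<dots> \<ge> 0" by simp
  finally show ?thesis by simp
qed

text \<open>The number of cells at which a path of length \<open>d\<close> to the root compares the factors of two
  consecutive iterates: only every other edge does, and each such edge involves both its ends.\<close>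

definition ncmp :: "nat \<Rightarrow> nat" where
  "ncmp d = (if even d then d else Suc d)"

text \<open>Induction on the distance. If d is odd, the edge from distance d + 1 to d lies in a cell
  of the partition of \<open>p\<close>, and \<open>V\<close> agrees at its ends. If d is even, only
  \<open>V'\<close> agrees there, so the comparison goes from V_i to V'_i = V'_j and back to V_j;
  this costs the deviations at both ends and a scalar between exp (- 2 \<kappa>) and exp (2
  \<kappa>).\<close>

lemma path_comparison:
  assumes st: "structured \<J> p U V C" and st': "structured \<J>' q U' V' C'" and j0: "j0 \<in> I"
    and D0: "\<And>i. i \<in> I \<Longrightarrow> D i = 0 \<Longrightarrow> V i = V j0"
    and Dodd: "\<And>i d. i \<in> I \<Longrightarrow> D i = Suc d \<Longrightarrow> even d \<Longrightarrow> \<exists>j\<in>I. D j = d \<and> V' i = V' j"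
    and Deven: "\<And>i d. i \<in> I \<Longrightarrow> D i = Suc d \<Longrightarrow> odd d \<Longrightarrow> \<exists>j\<in>I. D j = d \<and> V i = V j"
  shows "i \<in> I \<Longrightarrow> D i = d \<Longrightarrow> \<exists>\<tau>. exp (- 2 * \<kappa> * d) \<le> \<tau> \<and> \<tau> \<le> exp (2 * \<kappa> * d) \<and> (d = 0 \<longrightarrow> \<tau> = 1)
    \<and> (\<integral>y. (sqrt (V i y) - sqrt (\<tau> * V j0 y))\<^sup>2 \<partial>\<nu>)
        \<le> ncmp d * exp (\<kappa> + 2 * \<kappa> * d) * (\<Sum>r\<in>{r\<in>I. D r < ncmp d}. cell_dev q p r / m r)"
proof (induction d arbitrary: i)
  case 0
  then have "V i = V j0" by (intro D0)
  then show ?case by (intro exI[of _ 1]) (simp add: ncmp_def)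
next
  case (Suc d)
  note SD = structuredD[OF st] and SD' = structuredD[OF st']
  note sub = cell_dev_props(1)[OF SD'(1) SD(1)]
  define h where "h r = cell_dev q p r / m r" for r
  have h0: "0 \<le> h r" if "r \<in> I" for r using sub[OF that] m_pos[OF that] by (simp add: h_def)
  show ?case
  proof (cases "even d")
    case False
    then obtain j where j: "j \<in> I" "D j = d" "V i = V j" using Deven Suc.prems by blast
    have n: "ncmp (Suc d) = ncmp d" using False by (simp add: ncmp_def)
    obtain \<tau> where \<tau>: "exp (- 2 * \<kappa> * d) \<le> \<tau>" "\<tau> \<le> exp (2 * \<kappa> * d)"
      "(\<integral>y. (sqrt (V j y) - sqrt (\<tau> * V j0 y))\<^sup>2 \<partial>\<nu>) \<le> ncmp d * exp (\<kappa> + 2 * \<kappa> * d) * (\<Sum>r\<in>{r\<in>I. D r < ncmp d}. h r)"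
      using Suc.IH[OF j(1,2)] unfolding h_def by blast
    have "ncmp d * exp (\<kappa> + 2 * \<kappa> * d) * (\<Sum>r\<in>{r\<in>I. D r < ncmp d}. h r)
       \<le> ncmp d * exp (\<kappa> + 2 * \<kappa> * Suc d) * (\<Sum>r\<in>{r\<in>I. D r < ncmp d}. h r)"
      using kappa_nonneg h0 by (intro mult_right_mono mult_left_mono sum_nonneg) (auto simp: algebra_simps)
    moreover have "exp (- 2 * \<kappa> * Suc d) \<le> exp (- 2 * \<kappa> * d)" "exp (2 * \<kappa> * d) \<le> exp (2 * \<kappa> * Suc d)"
      using kappa_nonneg by (auto simp: algebra_simps)
    ultimately show ?thesis using \<tau> unfolding n j(3) h_def[symmetric]
      by (intro exI[of _ \<tau>] conjI) (linarith | simp)+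
  next
    case True
    then obtain j where j: "j \<in> I" "D j = d" "V' i = V' j" using Dodd Suc.prems by blast
    note i = Suc.prems(1)
    note [measurable] = SD(5) SD'(5)
    have n: "ncmp d = d" "ncmp (Suc d) = d + 2" using True by (auto simp: ncmp_def)
    obtain t where t: "exp (- 2 * \<kappa> * d) \<le> t" "t \<le> exp (2 * \<kappa> * d)" "d = 0 \<longrightarrow> t = 1"
      "(\<integral>y. (sqrt (V j y) - sqrt (t * V j0 y))\<^sup>2 \<partial>\<nu>) \<le> d * exp (\<kappa> + 2 * \<kappa> * d) * (\<Sum>r\<in>{r\<in>I. D r < d}. h r)"
      using Suc.IH[OF j(1,2)] unfolding h_def n by blast
    obtain si where si: "exp (- \<kappa>) \<le> si" "si \<le> exp \<kappa>" "(\<integral>y. (sqrt (V i y) - sqrt (si * V' i y))\<^sup>2 \<partial>\<nu>) \<le> exp \<kappa> * h i"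
      using scaled_hellinger_le_cell_dev[OF st st' i] unfolding h_def by blast
    obtain sj where sj: "exp (- \<kappa>) \<le> sj" "sj \<le> exp \<kappa>" "(\<integral>y. (sqrt (V j y) - sqrt (sj * V' j y))\<^sup>2 \<partial>\<nu>) \<le> exp \<kappa> * h j"
      using scaled_hellinger_le_cell_dev[OF st st' j(1)] unfolding h_def by blast
    have pos: "0 < si" "0 < sj" "0 < t" using si(1) sj(1) t(1) by (meson exp_gt_zero less_le_trans)+
    \<comment> \<open>V_i is close to si V'_i, and V_j to sj V'_j. As V'_i = V'_j, this makes V_i
      close to (si / sj) V_j.\<close>
    define s where "s = si / sj"
    have s0: "0 < s" using pos by (simp add: s_def)
    have s1: "s \<le> exp (2 * \<kappa>)"
    proof -
      have "s \<le> exp \<kappa> / exp (- \<kappa>)" unfolding s_def using si sj pos by (intro frac_le) auto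
      then show ?thesis by (simp add: exp_diff[symmetric])
    qed
    have s2: "exp (- 2 * \<kappa>) \<le> s"
    proof -
      have "exp (- \<kappa>) / exp \<kappa> \<le> s" unfolding s_def using si sj pos by (intro frac_le) auto
      then show ?thesis by (simp add: exp_diff[symmetric])
    qed
    define A where "A y = (sqrt (V i y) - sqrt (si * V' i y))\<^sup>2" for y
    define B where "B y = (sqrt (V j y) - sqrt (sj * V' j y))\<^sup>2" for y
    define E where "E y = (sqrt (V j y) - sqrt (t * V j0 y))\<^sup>2" for y
    have bd: "integrable \<nu> (\<lambda>y. (sqrt (V i' y) - sqrt (c * W y))\<^sup>2)"
      if "i' \<in> I" "W \<in> borel_measurable \<nu>" "\<And>y. 0 \<le> W y" "\<And>y. W y \<le> CW" "0 < c" for i' W c CW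
      using SD(6,7)[OF that(1)] that SD(5)[OF that(1)]
      by (intro M2.integrable_bounded[where B = "C + c * CW"] hellinger_bounded mult_left_mono) auto
    have ints: "integrable \<nu> A" "integrable \<nu> B" "integrable \<nu> E"
      "integrable \<nu> (\<lambda>y. (sqrt (V i y) - sqrt (s * t * V j0 y))\<^sup>2)"
      unfolding A_def B_def E_def
      using bd[OF i SD'(5)[OF i] SD'(6,7)[OF i] pos(1)] bd[OF j(1) SD'(5)[OF j(1)] SD'(6,7)[OF j(1)] pos(2)]
        bd[OF j(1) SD(5)[OF j0] SD(6,7)[OF j0] pos(3)] bd[OF i SD(5)[OF j0] SD(6,7)[OF j0], of "s * t"] s0 pos
      by auto
    have pw: "(sqrt (V i y) - sqrt (s * t * V j0 y))\<^sup>2 \<le> (real d + 2) * (A y + s * B y + s * E y / real d)" for y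
    proof -
      define a b c where "a = sqrt (V i y) - sqrt (si * V' i y)" and "b = sqrt s * (sqrt (sj * V' j y) - sqrt (V j y))"
        and "c = sqrt s * (sqrt (V j y) - sqrt (t * V j0 y))"
      have "sqrt s * sqrt (sj * V' j y) = sqrt (si * V' i y)"
        unfolding real_sqrt_mult[symmetric] j(3) using pos by (simp add: s_def)
      then have "sqrt (V i y) - sqrt (s * t * V j0 y) = a + b + c"
        by (simp add: a_def b_def c_def right_diff_distrib real_sqrt_mult mult.assoc)
      moreover have "c = 0" if "d = 0" using that t(3) D0[OF j(1)] j(2) by (simp add: c_def)
      then have "(a + b + c)\<^sup>2 \<le> (real d + 2) * (a\<^sup>2 + b\<^sup>2 + c\<^sup>2 / real d)" by (rule three_squares)
      moreover have "a\<^sup>2 = A y" "b\<^sup>2 = s * B y" "c\<^sup>2 = s * E y"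
        using s0 by (auto simp: a_def b_def c_def A_def B_def E_def power_mult_distrib power2_commute)
      ultimately show ?thesis by simp
    qed
    define S where "S = (\<Sum>r\<in>{r\<in>I. D r < d}. h r)"
    have S0: "0 \<le> S" unfolding S_def using h0 by (intro sum_nonneg) auto
    define e where "e = exp (\<kappa> + 2 * \<kappa> * Suc d)"
    have e1: "exp \<kappa> \<le> e" "exp (2 * \<kappa>) * exp \<kappa> \<le> e" "exp (2 * \<kappa>) * exp (\<kappa> + 2 * \<kappa> * d) \<le> e"
      using kappa_nonneg by (auto simp: e_def exp_add[symmetric] algebra_simps)
    have "(\<integral>y. (sqrt (V i y) - sqrt (s * t * V j0 y))\<^sup>2 \<partial>\<nu>)
        \<le> (\<integral>y. (real d + 2) * (A y + s * B y + s * E y / real d) \<partial>\<nu>)"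
      by (intro integral_mono pw ints) (use ints in auto)
    also have "\<dots> = (real d + 2) * ((\<integral>y. A y \<partial>\<nu>) + s * (\<integral>y. B y \<partial>\<nu>) + s * (\<integral>y. E y \<partial>\<nu>) / real d)"
      using ints by simp
    also have "\<dots> \<le> (real d + 2) * (e * h i + e * h j + e * S)"
    proof (intro mult_left_mono add_mono)
      show "(\<integral>y. A y \<partial>\<nu>) \<le> e * h i"
        using si(3) e1(1) mult_right_mono[OF e1(1) h0[OF i]] unfolding A_def by linarith
      have "s * (\<integral>y. B y \<partial>\<nu>) \<le> exp (2 * \<kappa>) * (exp \<kappa> * h j)"
        using s1 s0 sj(3) unfolding B_def by (intro mult_mono) (auto intro!: integral_nonneg_AE)
      also have "\<dots> \<le> e * h j" using mult_right_mono[OF e1(2) h0[OF j(1)]] by (simp add: mult.assoc)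
      finally show "s * (\<integral>y. B y \<partial>\<nu>) \<le> e * h j" .
      show "s * (\<integral>y. E y \<partial>\<nu>) / real d \<le> e * S"
      proof (cases "d = 0")
        case True then show ?thesis using S0 by (simp add: e_def)
      next
        case False
        have "s * (\<integral>y. E y \<partial>\<nu>) \<le> exp (2 * \<kappa>) * (d * exp (\<kappa> + 2 * \<kappa> * d) * S)"
          using s1 s0 t(4) unfolding E_def S_def by (intro mult_mono) (auto intro!: integral_nonneg_AE)
        also have "\<dots> = real d * ((exp (2 * \<kappa>) * exp (\<kappa> + 2 * \<kappa> * d)) * S)" by simp
        also have "\<dots> \<le> real d * (e * S)" using S0 e1(3) by (intro mult_left_mono mult_right_mono) auto
        finally show ?thesis using False by (simp add: field_simps)
      qed
    qed simp
    also have "\<dots> = (real d + 2) * e * (h i + h j + S)" by (simp add: algebra_simps)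
    also have "\<dots> \<le> (real d + 2) * e * (\<Sum>r\<in>{r\<in>I. D r < d + 2}. h r)"
    proof (intro mult_left_mono)
      \<comment> \<open>The two new cells are at distances d + 1 and d, while the induction
        hypothesis involves distances below d only. So no cell is charged twice.\<close>
      have ij: "i \<noteq> j" "i \<notin> {r\<in>I. D r < d}" "j \<notin> {r\<in>I. D r < d}" using Suc.prems(2) j(2) by auto
      have "h i + h j + S = (\<Sum>r\<in>insert i (insert j {r\<in>I. D r < d}). h r)"
        using ij fin_I by (simp add: S_def)
      also have "\<dots> \<le> (\<Sum>r\<in>{r\<in>I. D r < d + 2}. h r)"
        using fin_I h0 i j Suc.prems(2) by (intro sum_mono2) auto
      finally show "h i + h j + S \<le> (\<Sum>r\<in>{r\<in>I. D r < d + 2}. h r)" .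
    qed (simp add: e_def)
    finally have "(\<integral>y. (sqrt (V i y) - sqrt (s * t * V j0 y))\<^sup>2 \<partial>\<nu>)
      \<le> ncmp (Suc d) * exp (\<kappa> + 2 * \<kappa> * Suc d) * (\<Sum>r\<in>{r\<in>I. D r < ncmp (Suc d)}. h r)"
      unfolding n e_def by (simp add: add.commute)
    moreover have "s * t \<le> exp (2 * \<kappa>) * exp (2 * \<kappa> * d)" using s1 s0 t(2) pos by (intro mult_mono) auto
    moreover have "exp (- 2 * \<kappa>) * exp (- 2 * \<kappa> * d) \<le> s * t" using s2 s0 t(1) by (intro mult_mono) auto
    ultimately show ?thesis unfolding h_def
      by (intro exI[of _ "s * t"]) (auto simp: exp_add[symmetric] algebra_simps)
  qed
qed

end

subsection \<open>Contraction over several steps\<close>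

context ot_cells
begin

text \<open>A plan with a single factor \<open>V\<close> is optimal: with all scalars equal to 1 the
  bound of \<open>duality_gap\<close> is 0. This settles the case M = 0.\<close>

lemma zero_gap:
  assumes st: "structured \<J> p U V C" and r: "bdd_density r" and j0: "j0 \<in> I"
    and V: "\<And>i. i \<in> I \<Longrightarrow> V i = V j0" and low: "0 < c0" "AE y in \<nu>. c0 \<le> V j0 y"
  shows "ent p \<le> ent r"
  using duality_gap[OF st r j0 low, of "\<lambda>_. 1" "\<lambda>_. 1"] V by simp

lemma card_mult_min_mass:
  assumes "\<And>i. i \<in> I \<Longrightarrow> mm \<le> m i" shows "real (card I) * mm \<le> 1"
  using sum_mono[of I "\<lambda>_. mm" m] assms sum_m by simp

lemma step_gap:
  fixes Mx :: nat
  assumes st: "structured \<J> p U V C" and st': "structured \<J>' q U' V' C'" and r: "bdd_density r"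
    and j0: "j0 \<in> I" "D j0 = 0"
    and D0: "\<And>i. i \<in> I \<Longrightarrow> D i = 0 \<Longrightarrow> V i = V j0"
    and Dodd: "\<And>i d. i \<in> I \<Longrightarrow> D i = Suc d \<Longrightarrow> even d \<Longrightarrow> \<exists>j\<in>I. D j = d \<and> V' i = V' j"
    and Deven: "\<And>i d. i \<in> I \<Longrightarrow> D i = Suc d \<Longrightarrow> odd d \<Longrightarrow> \<exists>j\<in>I. D j = d \<and> V i = V j"
    and DM: "\<And>i. i \<in> I \<Longrightarrow> D i \<le> Mx" and Mx: "1 \<le> Mx"
    and mm: "0 < mm" "\<And>i. i \<in> I \<Longrightarrow> mm \<le> m i"
    and low: "AE y in \<nu>. exp (- \<kappa>) * (exp (- 2 * \<kappa>) * mm) ^ Mx \<le> V j0 y"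
  shows "mm ^ (2 * Mx + 1) * (ent p - ent r)
    \<le> 2 * Mx * card I * exp ((6 * Mx + 7) * \<kappa>) * hell q p"
proof -
  note SD = structuredD[OF st] and SD' = structuredD[OF st']
  define H where "H = hell q p"
  have H0: "0 \<le> H" unfolding H_def by (intro integral_nonneg_AE) auto
  note dev0 = cell_dev_props(1)[OF SD'(1) SD(1)]
  define S where "S = (\<Sum>r\<in>I. cell_dev q p r / m r)"
  have S: "S \<le> H / mm"
  proof -
    have "S \<le> (\<Sum>r\<in>I. cell_dev q p r / mm)"
      unfolding S_def using dev0 m_pos mm by (intro sum_mono divide_left_mono) auto
    also have "\<dots> = H / mm" unfolding sum_divide_distrib[symmetric] cell_dev_props(2)[OF SD'(1) SD(1)] H_def ..
    finally show ?thesis .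
  qed
  define Q where "Q i \<tau> \<longleftrightarrow> exp (- 2 * \<kappa> * D i) \<le> \<tau> \<and> \<tau> \<le> exp (2 * \<kappa> * D i) \<and> (D i = 0 \<longrightarrow> \<tau> = 1)
    \<and> (\<integral>y. (sqrt (V i y) - sqrt (\<tau> * V j0 y))\<^sup>2 \<partial>\<nu>)
        \<le> ncmp (D i) * exp (\<kappa> + 2 * \<kappa> * D i) * (\<Sum>r\<in>{r\<in>I. D r < ncmp (D i)}. cell_dev q p r / m r)" for i \<tau>
  have "\<exists>\<tau>. Q i \<tau>" if "i \<in> I" for i
    unfolding Q_def by (rule path_comparison[OF st st' j0(1) D0 Dodd Deven that refl])
  then obtain \<tau> where Q: "\<And>i. i \<in> I \<Longrightarrow> Q i (\<tau> i)" by metis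
  have tau_lo: "exp (- 2 * \<kappa> * Mx) \<le> \<tau> i" if "i \<in> I" for i
  proof -
    have "exp (- 2 * \<kappa> * Mx) \<le> exp (- 2 * \<kappa> * D i)"
      using DM[OF that] kappa_nonneg by (auto intro: mult_left_mono)
    then show ?thesis using Q[OF that] unfolding Q_def by linarith
  qed
  have tau0: "0 < \<tau> i" if "i \<in> I" for i using tau_lo[OF that] by (meson exp_gt_zero less_le_trans)
  define E where "E i = (\<integral>y. (sqrt (V i y) - sqrt (\<tau> i * V j0 y))\<^sup>2 \<partial>\<nu>)" for i
  have E0: "E i \<le> 0" if "i \<in> I" "D i = 0" for i
  proof -
    have "E i \<le> ncmp (D i) * exp (\<kappa> + 2 * \<kappa> * D i) * (\<Sum>r\<in>{r\<in>I. D r < ncmp (D i)}. cell_dev q p r / m r)"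
      using Q[OF that(1)] unfolding Q_def E_def by blast
    then show ?thesis using that(2) by (simp add: ncmp_def)
  qed
  have E: "E i \<le> 2 * Mx * exp (\<kappa> + 2 * \<kappa> * Mx) * (H / mm)" if i: "i \<in> I" for i
  proof (cases "D i = 0")
    case True
    have "0 \<le> 2 * Mx * exp (\<kappa> + 2 * \<kappa> * Mx) * (H / mm)" using H0 mm by (intro mult_nonneg_nonneg) auto
    then show ?thesis using E0[OF i True] by linarith
  next
    case False
    have "(\<Sum>r\<in>{r\<in>I. D r < ncmp (D i)}. cell_dev q p r / m r) \<le> S"
      unfolding S_def using fin_I dev0 m_pos by (intro sum_mono2) (auto intro!: divide_nonneg_pos)
    then have s: "(\<Sum>r\<in>{r\<in>I. D r < ncmp (D i)}. cell_dev q p r / m r) \<le> H / mm" using S by linarith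
    have "ncmp (D i) \<le> 2 * D i" using False by (auto simp: ncmp_def)
    then have n: "ncmp (D i) \<le> 2 * Mx" using DM[OF i] by linarith
    have e: "exp (\<kappa> + 2 * \<kappa> * D i) \<le> exp (\<kappa> + 2 * \<kappa> * Mx)"
      using DM[OF i] kappa_nonneg by (auto intro: mult_left_mono)
    have "E i \<le> ncmp (D i) * exp (\<kappa> + 2 * \<kappa> * D i) * (\<Sum>r\<in>{r\<in>I. D r < ncmp (D i)}. cell_dev q p r / m r)"
      using Q[OF i] unfolding Q_def E_def by blast
    also have "\<dots> \<le> real (2 * Mx) * exp (\<kappa> + 2 * \<kappa> * Mx) * (H / mm)"
      using s e n dev0 m_pos by (intro mult_mono) (auto intro!: sum_nonneg divide_nonneg_pos)
    finally show ?thesis by simp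
  qed
  define c0 where "c0 = exp (- \<kappa>) * (exp (- 2 * \<kappa>) * mm) ^ Mx"
  have c0: "0 < c0" unfolding c0_def using mm by simp
  \<comment> \<open>The upper bound exp \<kappa> / m_i for V_i, divided by the lower bound for the
    multiple of \<open>V j0\<close>. The exponent 4 M + 2 collects 1 from the former, 2 M from the
    scalar of the path and 2 M + 1 from \<open>c0\<close>.\<close>
  define R where "R i = exp ((4 * Mx + 2) * \<kappa>) / (mm ^ Mx * m i)" for i
  have mm1: "mm \<le> 1" using mm(2)[OF j0(1)] m_le_1[of j0] by linarith
  have R1: "1 \<le> R i" if "i \<in> I" for i
  proof -
    have "mm ^ Mx * m i \<le> 1 * 1" using mm mm1 m_le_1 m_pos[OF that] by (intro mult_mono power_le_one) auto
    moreover have "1 \<le> exp ((4 * Mx + 2) * \<kappa>)" using kappa_nonneg by simp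
    ultimately have "mm ^ Mx * m i \<le> exp ((4 * Mx + 2) * \<kappa>)" by linarith
    moreover have "0 < mm ^ Mx * m i" using mm m_pos[OF that] by simp
    ultimately show ?thesis unfolding R_def by (simp only: le_divide_eq_1_pos)
  qed
  have key: "R i * (exp (- 2 * \<kappa> * Mx) * c0) = exp \<kappa> / m i" if "i \<in> I" for i
  proof -
    have "exp ((4 * Mx + 2) * \<kappa>) * (exp (- 2 * \<kappa> * Mx) * (exp (- \<kappa>) * exp (- 2 * \<kappa>) ^ Mx)) = exp \<kappa>"
      unfolding exp_of_nat_mult[symmetric] exp_add[symmetric] by (rule arg_cong[where f = exp]) (simp add: algebra_simps)
    moreover have "R i * (exp (- 2 * \<kappa> * Mx) * c0)
      = exp ((4 * Mx + 2) * \<kappa>) * (exp (- 2 * \<kappa> * Mx) * (exp (- \<kappa>) * exp (- 2 * \<kappa>) ^ Mx)) / m i"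
      unfolding R_def c0_def power_mult_distrib using mm by simp
    ultimately show ?thesis by simp
  qed
  have VR: "AE y in \<nu>. V i y \<le> R i * (\<tau> i * V j0 y)" if i: "i \<in> I" for i
    using V_le[OF st i] low
  proof eventually_elim
    case (elim y)
    have "exp (- 2 * \<kappa> * Mx) * c0 \<le> \<tau> i * V j0 y"
      using elim tau_lo[OF i] tau0[OF i] c0 by (intro mult_mono) (auto simp: c0_def less_imp_le)
    then have "R i * (exp (- 2 * \<kappa> * Mx) * c0) \<le> R i * (\<tau> i * V j0 y)"
      using R1[OF i] by (intro mult_left_mono) auto
    then show ?case using elim(1) key[OF i] by linarith
  qed
  \<comment> \<open>The exponent is (4 M + 2) + 1 + (2 M + 1), from \<open>R\<close>,
    \<open>duality_gap\<close> and \<open>path_comparison\<close>. The mass m_i cancels against the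
    one in \<open>R\<close>, and the extra power of \<open>mm\<close> comes from S <= H /
    mm.\<close>
  define B where "B = 8 * Mx * exp ((6 * Mx + 4) * \<kappa>) * H / mm ^ (Mx + 1)"
  have B0: "0 \<le> B" unfolding B_def using H0 mm by (intro divide_nonneg_nonneg mult_nonneg_nonneg) auto
  \<comment> \<open>The root cell contributes nothing. Counting N - 1 cells instead of N is what
    makes the comparison with N^2 below possible for small N.\<close>
  have cell_term: "m i * (4 * R i * exp \<kappa> * E i) \<le> (if i = j0 then 0 else B)" if i: "i \<in> I" for i
  proof -
    have mR: "m i * R i = exp ((4 * Mx + 2) * \<kappa>) / mm ^ Mx" using m_pos[OF i] by (simp add: R_def)
    have eq: "m i * (4 * R i * exp \<kappa> * e) = 4 * (exp ((4 * Mx + 2) * \<kappa>) / mm ^ Mx) * exp \<kappa> * e" for e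
      unfolding mR[symmetric] by simp
    have pos: "0 \<le> 4 * (exp ((4 * Mx + 2) * \<kappa>) / mm ^ Mx) * exp \<kappa>" using mm by simp
    show ?thesis
    proof (cases "i = j0")
      case True
      have "m i * (4 * R i * exp \<kappa> * E i) \<le> 0"
        unfolding eq by (rule mult_nonneg_nonpos[OF pos E0[OF i]]) (use True j0 in simp)
      then show ?thesis by (simp only: True simp_thms if_True)
    next
      case False
      have "m i * (4 * R i * exp \<kappa> * E i) \<le> 4 * (exp ((4 * Mx + 2) * \<kappa>) / mm ^ Mx) * exp \<kappa> * (2 * Mx * exp (\<kappa> + 2 * \<kappa> * Mx) * (H / mm))"
        unfolding eq by (rule mult_left_mono[OF E[OF i] pos])
      also have "\<dots> = 8 * Mx * (exp ((4 * Mx + 2) * \<kappa>) * exp \<kappa> * exp (\<kappa> + 2 * \<kappa> * Mx)) * H / mm ^ (Mx + 1)"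
        by (simp add: mult_ac)
      also have "exp ((4 * Mx + 2) * \<kappa>) * exp \<kappa> * exp (\<kappa> + 2 * \<kappa> * Mx) = exp ((6 * Mx + 4) * \<kappa>)"
        unfolding exp_add[symmetric] by (rule arg_cong[where f = exp]) (simp add: algebra_simps)
      finally show ?thesis using False by (simp add: B_def)
    qed
  qed
  have "ent p - ent r \<le> (\<Sum>i\<in>I. m i * (4 * R i * exp \<kappa> * E i))"
    unfolding E_def by (rule duality_gap[OF st r j0(1) c0 low[folded c0_def] tau0 R1 VR])
  also have "\<dots> \<le> (\<Sum>i\<in>I. if i = j0 then 0 else B)" by (intro sum_mono cell_term)
  also have "\<dots> = (real (card I) - 1) * B"
  proof -
    have "(\<Sum>i\<in>I. if i = j0 then 0 else B) = (\<Sum>i\<in>I - {j0}. B)"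
      using fin_I j0 by (intro sum.mono_neutral_cong_right) auto
    also have "\<dots> = (real (card I) - 1) * B"
      using fin_I j0 card_gt_0_iff[of I] by (auto simp: card_Diff_singleton of_nat_diff)
    finally show ?thesis .
  qed
  finally have gap: "ent p - ent r \<le> (real (card I) - 1) * B" .
  text \<open>With \<open>N \<mu>\<^sub>m\<^sub>i\<^sub>n \<le> 1\<close> the constants match because \<open>4 (N - 1) \<le> N\<^sup>2\<close>.\<close>
  define N where "N = real (card I)"
  have N1: "1 \<le> N" unfolding N_def using fin_I j0 by (metis One_nat_def Suc_leI card_gt_0_iff empty_iff of_nat_1 of_nat_mono)
  have Nmm: "N * mm \<le> 1" unfolding N_def by (rule card_mult_min_mass[OF mm(2)])
  have "mm ^ Mx * (4 * (N - 1)) \<le> mm * (4 * (N - 1))"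
    using mm mm1 Mx N1 power_decreasing[of 1 Mx mm] by (intro mult_right_mono) auto
  also have "\<dots> \<le> mm * (N * N)"
  proof (rule mult_left_mono)
    have "0 \<le> (N - 2)\<^sup>2" by simp
    then show "4 * (N - 1) \<le> N * N" by (simp add: power2_eq_square algebra_simps)
  qed (use mm in simp)
  also have "\<dots> = N * (N * mm)" by simp
  also have "\<dots> \<le> N * 1" using Nmm N1 by (intro mult_left_mono) auto
  finally have cst: "mm ^ Mx * (4 * (N - 1)) \<le> N" by simp
  have "mm ^ (2 * Mx + 1) * (ent p - ent r) \<le> mm ^ (2 * Mx + 1) * ((N - 1) * B)"
    using gap mm unfolding N_def by (intro mult_left_mono) auto
  also have "\<dots> = (mm ^ Mx * (4 * (N - 1))) * (2 * Mx * exp ((6 * Mx + 4) * \<kappa>) * H)"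
  proof -
    have "mm ^ (2 * Mx + 1) = mm ^ Mx * mm ^ (Mx + 1)" by (simp add: power_add[symmetric] mult_2)
    then show ?thesis unfolding B_def using mm by (simp add: field_simps)
  qed
  \<comment> \<open>Here the exponent 6 M + 4 is relaxed to 6 M + 7.\<close>
  also have "\<dots> \<le> N * (2 * Mx * exp ((6 * Mx + 7) * \<kappa>) * H)"
    using cst H0 N1 mult_right_mono[OF _ kappa_nonneg, of "6 * real Mx + 4" "6 * real Mx + 7"] by (intro mult_mono mult_right_mono mult_left_mono mult_nonneg_nonneg) auto
  finally show ?thesis by (simp add: N_def H_def mult_ac)
qed

section \<open>Lower bounds for the mass over a cell\<close>

lemma sum_Fy_le:
  assumes st: "structured \<J> p U V C" and J: "J \<in> \<J>" "J \<subseteq> I" "j \<in> J"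
  shows "(\<Sum>i\<in>J. Fy p i y) \<le> exp \<kappa> * V j y * (\<Sum>i\<in>J. m i)"
proof -
  have "(\<Sum>i\<in>J. Fy p i y) \<le> (\<Sum>i\<in>J. exp \<kappa> * m i * V i y)"
    using J by (intro sum_mono Fy_bounds(2)[OF st]) auto
  also have "\<dots> = (\<Sum>i\<in>J. exp \<kappa> * V j y * m i)"
    using structuredD(9)[OF st J(1) _ J(3)] by (intro sum.cong) auto
  finally show ?thesis by (simp add: sum_distrib_left)
qed

lemma sum_m_subset: "J \<subseteq> I \<Longrightarrow> (\<Sum>i\<in>J. m i) \<le> 1"
  using sum_mono2[of I J m] fin_I m_pos sum_m by (simp add: less_imp_le)

text \<open>As \<open>V\<close> is constant on the composite cell, whose mass is at most 1, the
  total over J bounds \<open>V j\<close> from below with loss exp (- \<kappa>), and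
  \<open>V j\<close> bounds the marginal over j with loss exp (- \<kappa>) m_j. So one step carries
  mass to every basic cell of J.\<close>

lemma mass_spreads:
  assumes st: "structured \<J> p U V C" and J: "J \<in> \<J>" "J \<subseteq> I" "j \<in> J"
    and mm: "0 \<le> mm" "mm \<le> m j" and c: "0 \<le> c" "c \<le> (\<Sum>i\<in>J. Fy p i y)"
  shows "exp (- 2 * \<kappa>) * mm * c \<le> Fy p j y"
proof -
  have j: "j \<in> I" using J by auto
  have V0: "0 \<le> V j y" using structuredD(6)[OF st j] .
  have "(\<Sum>i\<in>J. Fy p i y) \<le> exp \<kappa> * V j y * 1"
    using order_trans[OF sum_Fy_le[OF st J] mult_left_mono[OF sum_m_subset[OF J(2)]]] V0 by simp
  then have "exp (- \<kappa>) * c \<le> V j y" using c by (simp add: exp_minus field_simps)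
  then have "exp (- \<kappa>) * mm * (exp (- \<kappa>) * c) \<le> exp (- \<kappa>) * m j * V j y"
    using mm c by (intro mult_mono) auto
  also have "\<dots> \<le> Fy p j y" by (rule Fy_bounds(1)[OF st j])
  finally show ?thesis by (simp add: mult_ac flip: exp_add)
qed

text \<open>The cell marginals and the masses both sum to 1, so at the given y some composite cell
  carries at least its own share; which one depends on y. The mass of that cell cancels in the bound
  on \<open>V j\<close>, so starting the chain costs no more than one ordinary step.\<close>

lemma mass_spreads_initial:
  assumes st: "structured \<J> p U V C" and part: "partition_on I \<J>" and one: "(\<Sum>i\<in>I. Fy p i y) = 1"
  shows "\<exists>J\<in>\<J>. \<forall>j\<in>J. exp (- 2 * \<kappa>) * m j \<le> Fy p j y"
proof -
  have sub: "J \<subseteq> I" if "J \<in> \<J>" for J using part that by (auto simp: partition_on_def)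
  note split = sum_partition[OF part]
  have "finite \<J>" using part fin_I finite_elements by blast
  moreover have "\<J> \<noteq> {}" using part one by (auto simp: partition_on_def)
  ultimately have "\<exists>J\<in>\<J>. (\<Sum>i\<in>J. m i) \<le> (\<Sum>i\<in>J. Fy p i y)"
    using sum_strict_mono[of \<J> "\<lambda>J. \<Sum>i\<in>J. Fy p i y" "\<lambda>J. \<Sum>i\<in>J. m i"] one sum_m split[of m] split[of "\<lambda>i. Fy p i y"]
    by force
  then obtain J where J: "J \<in> \<J>" "(\<Sum>i\<in>J. m i) \<le> (\<Sum>i\<in>J. Fy p i y)" by blast
  have "exp (- 2 * \<kappa>) * m j \<le> Fy p j y" if j: "j \<in> J" for j
  proof -
    have jI: "j \<in> I" using j sub J by blast
    have mJ: "0 < (\<Sum>i\<in>J. m i)" using sub[OF J(1)] j fin_I m_pos by (intro sum_pos2[of J j]) (auto intro: finite_subset less_imp_le)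
    have "1 * (\<Sum>i\<in>J. m i) \<le> exp \<kappa> * V j y * (\<Sum>i\<in>J. m i)"
      using order_trans[OF J(2) sum_Fy_le[OF st J(1) sub[OF J(1)] j]] by simp
    then have "1 \<le> exp \<kappa> * V j y" using mJ by (simp only: mult_le_cancel_right)
    then have "exp (- \<kappa>) \<le> V j y" by (simp add: exp_minus field_simps)
    then have "exp (- \<kappa>) * m j * exp (- \<kappa>) \<le> exp (- \<kappa>) * m j * V j y"
      using m_pos[OF jI] by (intro mult_left_mono) auto
    then have "exp (- \<kappa>) * m j * exp (- \<kappa>) \<le> Fy p j y" using Fy_bounds(1)[OF st jI] by (rule order_trans)
    moreover have "exp (- 2 * \<kappa>) = exp (- \<kappa>) * exp (- \<kappa>)" by (simp flip: exp_add)
    ultimately show ?thesis by (simp only: mult_ac)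
  qed
  then show ?thesis using J(1) by blast
qed

end

text \<open>Nothing is assumed at index \<open>0\<close>: the initial plan need not have a density.\<close>

locale dd_run = ot_cells \<mu> \<nu> k \<kappa> I X
  for \<mu> :: "'a::topological_space measure" and \<nu> :: "'b::topological_space measure" and k \<kappa>
    and I :: "'i set" and X +
  fixes Js :: "nat \<Rightarrow> 'i set set" and p :: "nat \<Rightarrow> 'a \<times> 'b \<Rightarrow> real" and U :: "nat \<Rightarrow> 'a \<Rightarrow> real"
    and V :: "nat \<Rightarrow> 'i \<Rightarrow> 'b \<Rightarrow> real" and C :: "nat \<Rightarrow> real"
  assumes run: "\<And>s. 1 \<le> s \<Longrightarrow> structured (Js s) (p s) (U s) (V s) (C s)"
    and part: "\<And>s. partition_on I (Js s)" and period: "\<And>s. Js (Suc (Suc s)) = Js s"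
    and keep: "\<And>s. 1 \<le> s \<Longrightarrow> AE y in \<nu>. \<forall>J\<in>Js (Suc s). (\<Sum>i\<in>J. Fy (p s) i y) = (\<Sum>i\<in>J. Fy (p (Suc s)) i y)"
begin

lemma bdd: "1 \<le> s \<Longrightarrow> bdd_density (p s)"
  using run structuredD(1) by blast

lemma Js_parity: "even d \<Longrightarrow> d \<le> l \<Longrightarrow> Js (l - d) = Js l"
proof (induction d rule: nat_less_induct)
  case (1 d)
  show ?case
  proof (cases "d < 2")
    case True
    then have "d = 0" using 1(2) by (auto simp: less_2_cases_iff)
    then show ?thesis by simp
  next
    case False
    then have "Js (l - (d - 2)) = Js l" by (intro 1(1)[rule_format]) (use 1(2,3) in auto)
    moreover have "l - (d - 2) = Suc (Suc (l - d))" using False 1(3) by linarith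
    ultimately show ?thesis using period[of "l - d"] by metis
  qed
qed

lemma ent_step:
  assumes "1 \<le> s"
  shows "ent (p (Suc s)) + hell (p s) (p (Suc s)) \<le> ent (p s)"
  by (rule ent_decrease[OF run part bdd keep]) (use assms in auto)

lemma ent_mono:
  assumes "1 \<le> s" "s \<le> t" shows "ent (p t) \<le> ent (p s)"
  using assms(2,1)
proof (induction t rule: dec_induct)
  case (step n)
  have "0 \<le> hell (p n) (p (Suc n))" by (intro integral_nonneg_AE) auto
  then show ?case using step ent_step[of n] by linarith
qed simp

text \<open>\<open>path\<close> fixes the timing: the edge from distance d + 1 to distance d belongs
  to the partition of iterate l - (d + 1). Mass can thus follow a shortest path with one edge per
  iterate and arrive in J0 at iterate l - 1.\<close>

context
  fixes l Mx :: nat and J0 :: "'i set" and D :: "'i \<Rightarrow> nat" and mm :: real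
  assumes l: "Mx < l" and J0: "J0 \<in> Js l"
    and D0: "\<And>i. i \<in> I \<Longrightarrow> D i = 0 \<longleftrightarrow> i \<in> J0" and DM: "\<And>i. i \<in> I \<Longrightarrow> D i \<le> Mx"
    and path: "\<And>i d. i \<in> I \<Longrightarrow> D i = Suc d \<Longrightarrow> \<exists>j\<in>I. D j = d \<and> (\<exists>J\<in>Js (l - Suc d). i \<in> J \<and> j \<in> J)"
    and mm: "0 < mm" "\<And>i. i \<in> I \<Longrightarrow> mm \<le> m i"
begin

lemma sub: "J \<in> Js s \<Longrightarrow> J \<subseteq> I"
  using part[of s] by (auto simp: partition_on_def)

text \<open>At iterate l - M some cell at distance at most M - 1 carries at least \<open>b\<close>
  at y. Every further iterate brings mass one edge closer at the cost of a factor \<open>b\<close>,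
  so at iterate l - 1 a cell of J0 carries at least b^M. The passage to iterate l preserves the
  total over J0, which is a cell of its partition.\<close>

lemma J0_mass_bound: "AE y in \<nu>. (exp (- 2 * \<kappa>) * mm) ^ Mx \<le> (\<Sum>i\<in>J0. Fy (p l) i y)"
proof -
  define b where "b = exp (- 2 * \<kappa>) * mm"
  have b: "0 < b" using mm by (simp add: b_def)
  have one: "AE y in \<nu>. (\<Sum>i\<in>I. Fy (p s) i y) = 1" if "1 \<le> s" for s
    using bdd[OF that] by (simp add: bdd_density_def)
  \<comment> \<open>Finitely many almost sure statements, joined so that the whole chain can be
    followed at a fixed y.\<close>
  have kp: "AE y in \<nu>. \<forall>s\<in>{1..<l}. \<forall>J\<in>Js (Suc s). (\<Sum>i\<in>J. Fy (p s) i y) = (\<Sum>i\<in>J. Fy (p (Suc s)) i y)"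
    by (rule AE_finite_allI) (use keep in auto)
  have l1: "1 \<le> l - Mx" using l by simp
  show ?thesis
    using kp one[OF l1]
  proof eventually_elim
    case (elim y)
    note kp = elim(1) and one = elim(2)
    show ?case
    proof (cases "Mx = 0")
      case True
      then have "J0 = I" using D0 DM sub[OF J0] by auto
      then show ?thesis using one True by simp
    next
      case False
      have spread: "b * Fy (p s) i y \<le> Fy (p (Suc s)) j y"
        if s: "1 \<le> s" "Suc s \<le> l" and J: "J \<in> Js (Suc s)" "i \<in> J" "j \<in> J" for s i j J
      proof -
        have JI: "J \<subseteq> I" using sub[OF J(1)] .
        then have ij: "i \<in> I" "j \<in> I" using J by auto
        have "Fy (p s) i y \<le> (\<Sum>i\<in>J. Fy (p s) i y)"
          using J(2) JI fin_I Fy_nonneg[OF run[OF s(1)]] by (intro member_le_sum) (auto intro: finite_subset)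
        also have "\<dots> = (\<Sum>i\<in>J. Fy (p (Suc s)) i y)" using kp s J(1) by auto
        finally show ?thesis unfolding b_def
          using mass_spreads[OF run J(1) JI J(3), of mm "Fy (p s) i y"] mm ij Fy_nonneg[OF run[OF s(1)] ij(1)] by auto
      qed
      have "\<exists>i\<in>I. D i \<le> Mx - 1 - r \<and> b ^ Suc r \<le> Fy (p (l - Mx + r)) i y" if "r \<le> Mx - 1" for r
        using that
      proof (induction r)
        case 0
        obtain J where J: "J \<in> Js (l - Mx)" and Jb: "\<And>j. j \<in> J \<Longrightarrow> exp (- 2 * \<kappa>) * m j \<le> Fy (p (l - Mx)) j y"
          using mass_spreads_initial[OF run[OF l1] part one] by blast
        have JI: "J \<subseteq> I" using sub[OF J] .
        have "J \<noteq> {}" using J part[of "l - Mx"] by (auto simp: partition_on_def)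
        then obtain i where i: "i \<in> J" by blast
        \<comment> \<open>A cell at distance M has a neighbour at distance M - 1 in its composite
          cell of iterate l - M, which is J itself. So the first iterate already gains an
          edge.\<close>
        have "\<exists>j\<in>J. D j \<le> Mx - 1"
        proof (cases "D i \<le> Mx - 1")
          case False
          then have "D i = Suc (Mx - 1)" using DM[of i] i JI \<open>Mx \<noteq> 0\<close> by auto
          then obtain j J' where j: "D j = Mx - 1" "J' \<in> Js (l - Mx)" "i \<in> J'" "j \<in> J'"
            using path[of i "Mx - 1"] i JI \<open>Mx \<noteq> 0\<close> by auto
          then have "J' = J" using part[of "l - Mx"] J i by (auto simp: partition_on_def disjoint_def)
          then show ?thesis using j by (intro bexI[of _ j]) auto
        qed (use i in blast)
        then obtain j where j: "j \<in> J" "D j \<le> Mx - 1" by blast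
        have "b \<le> exp (- 2 * \<kappa>) * m j" unfolding b_def using mm j JI by (intro mult_left_mono) auto
        then show ?case using Jb[OF j(1)] j JI by (intro bexI[of _ j]) auto
      next
        case (Suc r)
        then obtain i where i: "i \<in> I" "D i \<le> Mx - 1 - r" "b ^ Suc r \<le> Fy (p (l - Mx + r)) i y" by auto
        have st: "1 \<le> l - Mx + r" "Suc (l - Mx + r) \<le> l" using l Suc.prems by auto
        \<comment> \<open>If i is already close enough, the mass waits there and j is i
          itself.\<close>
        have "\<exists>j\<in>I. D j \<le> Mx - 1 - Suc r \<and> (\<exists>J\<in>Js (Suc (l - Mx + r)). i \<in> J \<and> j \<in> J)"
        proof (cases "D i \<le> Mx - 1 - Suc r")
          case True
          obtain J where "J \<in> Js (Suc (l - Mx + r))" "i \<in> J"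
            using part[of "Suc (l - Mx + r)"] i(1) by (auto simp: partition_on_def)
          then show ?thesis using True i(1) by blast
        next
          case False
          then have Di: "D i = Suc (Mx - 1 - Suc r)" using i(2) Suc.prems by linarith
          have "l - Suc (Mx - 1 - Suc r) = Suc (l - Mx + r)" using l Suc.prems by linarith
          then show ?thesis using path[OF i(1) Di] by (auto intro: eq_imp_le)
        qed
        then obtain j J where j: "j \<in> I" "D j \<le> Mx - 1 - Suc r" "J \<in> Js (Suc (l - Mx + r))" "i \<in> J" "j \<in> J" by blast
        have "b ^ Suc (Suc r) \<le> b * Fy (p (l - Mx + r)) i y" using mult_left_mono[OF i(3), of b] b by simp
        also have "\<dots> \<le> Fy (p (Suc (l - Mx + r))) j y" by (rule spread[OF st j(3-5)])
        finally show ?case using j by (intro bexI[of _ j]) auto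
      qed
      from this[of "Mx - 1"] obtain i where i: "i \<in> I" "D i = 0" "b ^ Suc (Mx - 1) \<le> Fy (p (l - Mx + (Mx - 1))) i y" by auto
      have eqs: "Suc (Mx - 1) = Mx" "l - Mx + (Mx - 1) = l - 1" "1 \<le> l - 1" "Suc (l - 1) = l" using l False by auto
      have iJ: "i \<in> J0" using i D0 by blast
      have "b ^ Mx \<le> Fy (p (l - 1)) i y" using i(3) unfolding eqs .
      also have "\<dots> \<le> (\<Sum>i\<in>J0. Fy (p (l - 1)) i y)"
        using iJ sub[OF J0] fin_I Fy_nonneg[OF run[OF eqs(3)]] by (intro member_le_sum) (auto intro: finite_subset)
      also have "\<dots> = (\<Sum>i\<in>J0. Fy (p l) i y)" using kp eqs J0 by (auto dest!: bspec[of _ _ "l - 1"])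
      finally show ?thesis by (simp add: b_def)
    qed
  qed
qed

lemma J0_factor_bound: "j \<in> J0 \<Longrightarrow> AE y in \<nu>. exp (- \<kappa>) * (exp (- 2 * \<kappa>) * mm) ^ Mx \<le> V l j y"
  using J0_mass_bound
proof eventually_elim
  case (elim y)
  have st: "structured (Js l) (p l) (U l) (V l) (C l)" using run l by simp
  have "0 \<le> V l j y" using structuredD(6)[OF st] sub[OF J0] elim(1) by blast
  then have "(\<Sum>i\<in>J0. Fy (p l) i y) \<le> exp \<kappa> * V l j y * 1"
    using order_trans[OF sum_Fy_le[OF st J0 sub[OF J0] elim(1)] mult_left_mono[OF sum_m_subset[OF sub[OF J0]]]] by simp
  then have "(exp (- 2 * \<kappa>) * mm) ^ Mx \<le> exp \<kappa> * V l j y" using elim(2) by linarith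
  then show ?case by (simp add: exp_minus field_simps)
qed

text \<open>\<open>step_gap\<close> bounds the gap at l by the last decrease, which is at most the
  whole decrease since iterate l - M. Solving m x <= A (y - x) for the gap x gives the factor A / (m
  + A), with m the power of the minimal mass.\<close>

lemma dd_contraction:
  assumes r: "bdd_density r"
  defines "A \<equiv> 2 * Mx * card I * exp ((6 * Mx + 7) * \<kappa>)"
  shows "ent (p l) - ent r \<le> A / (mm ^ (2 * Mx + 1) + A) * (ent (p (l - Mx)) - ent r)"
proof -
  have st: "structured (Js l) (p l) (U l) (V l) (C l)" using run l by simp
  note SD = structuredD[OF st]
  have "J0 \<noteq> {}" using J0 part[of l] by (auto simp: partition_on_def)
  then obtain j0 where j0: "j0 \<in> J0" by blast
  then have j0I: "j0 \<in> I" using sub[OF J0] by blast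
  note low = J0_factor_bound[OF j0]
  have lowpos: "0 < exp (- \<kappa>) * (exp (- 2 * \<kappa>) * mm) ^ Mx" using mm by simp
  have V0: "V l i = V l j0" if "i \<in> I" "D i = 0" for i
    using SD(9)[OF J0 _ j0, of i] that D0 by blast
  show ?thesis
  \<comment> \<open>If M = 0, the index l - 1 may be 0, where no density is given; but then J0 is
    all of I and the gap is already closed.\<close>
  proof (cases "Mx = 0")
    case True
    then have "ent (p l) \<le> ent r"
      using DM by (intro zero_gap[OF st r j0I V0 lowpos low]) auto
    then show ?thesis using True by (simp add: A_def)
  next
    case False
    have l1: "1 \<le> l - 1" "Suc (l - 1) = l" using l False by auto
    have st': "structured (Js (l - 1)) (p (l - 1)) (U (l - 1)) (V (l - 1)) (C (l - 1))" using run l1 by simp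
    have "mm ^ (2 * Mx + 1) * (ent (p l) - ent r)
        \<le> 2 * Mx * card I * exp ((6 * Mx + 7) * \<kappa>) * hell (p (l - 1)) (p l)"
    proof (rule step_gap[OF st st' r j0I _ V0 _ _ DM _ mm low])
      show "D j0 = 0" using D0 j0 j0I by blast
      show "1 \<le> Mx" using False by simp
    next
      fix i d assume i: "i \<in> I" "D i = Suc d" "even d"
      obtain j J where j: "j \<in> I" "D j = d" "J \<in> Js (l - Suc d)" "i \<in> J" "j \<in> J" using path[OF i(1,2)] by blast
      have "Js (l - 1 - d) = Js (l - 1)" using DM[OF i(1)] i l by (intro Js_parity) auto
      then show "\<exists>j\<in>I. D j = d \<and> V (l - 1) i = V (l - 1) j"
        using j structuredD(9)[OF st' _ j(4,5)] by auto
    next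
      fix i d assume i: "i \<in> I" "D i = Suc d" "odd d"
      obtain j J where j: "j \<in> I" "D j = d" "J \<in> Js (l - Suc d)" "i \<in> J" "j \<in> J" using path[OF i(1,2)] by blast
      have "Js (l - Suc d) = Js l" using DM[OF i(1)] i l by (intro Js_parity) auto
      then show "\<exists>j\<in>I. D j = d \<and> V l i = V l j"
        using j SD(9)[OF _ j(4,5)] by auto
    qed auto
    also have "\<dots> \<le> A * (ent (p (l - Mx)) - ent (p l))"
      unfolding A_def
    proof (rule mult_left_mono)
      have "ent (p (l - 1)) \<le> ent (p (l - Mx))" using False l by (intro ent_mono) auto
      then show "hell (p (l - 1)) (p l) \<le> ent (p (l - Mx)) - ent (p l)"
        using ent_step[OF l1(1)] unfolding l1(2) by linarith
    qed simp
    finally have main: "mm ^ (2 * Mx + 1) * (ent (p l) - ent r) \<le> A * (ent (p (l - Mx)) - ent (p l))" .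
    have A0: "0 \<le> A" by (simp add: A_def)
    have m0: "0 < mm ^ (2 * Mx + 1)" using mm by simp
    have "(mm ^ (2 * Mx + 1) + A) * (ent (p l) - ent r) \<le> A * (ent (p (l - Mx)) - ent r)"
      using main by (simp add: algebra_simps)
    then show ?thesis using A0 m0 by (simp add: pos_le_divide_eq mult.commute)
  qed
qed

end

end

subsection \<open>Partition graph and the iterates as densities\<close>

lemma partition_on_unique_cell:
  "partition_on I P \<Longrightarrow> J \<in> P \<Longrightarrow> J' \<in> P \<Longrightarrow> x \<in> J \<Longrightarrow> x \<in> J' \<Longrightarrow> J = J'"
  unfolding partition_on_def disjoint_def by blast

lemma part_graph_commute: "part_graph I \<J>A \<J>B = part_graph I \<J>B \<J>A"
  by (simp add: part_graph_def Un_commute)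

context
  fixes I :: "'i set" and \<A> \<B> :: "'i set set" and G J0
  assumes G: "G = part_graph I \<A> \<B>" and conn: "graph_connected I G" and finI: "finite I"
    and A: "partition_on I \<A>" and B: "partition_on I \<B>" and J0: "J0 \<in> \<A>"
begin

lemma J0_props: "J0 \<subseteq> I" "finite J0" "J0 \<noteq> {}"
proof -
  show sub: "J0 \<subseteq> I" using A J0 by (auto simp: partition_on_def)
  show "finite J0" using sub finI by (rule finite_subset)
  show "J0 \<noteq> {}" using A J0 by (auto simp: partition_on_def)
qed

lemma cell_dist_le: "(i, j) \<in> G ^^ n \<Longrightarrow> j \<in> J0 \<Longrightarrow> cell_dist G J0 i \<le> n"
proof -
  assume *: "(i, j) \<in> G ^^ n" "j \<in> J0"
  have "cell_dist G J0 i \<le> graph_dist G i j" unfolding cell_dist_def using J0_props *(2) by (intro Min_le) auto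
  also have "\<dots> \<le> n" unfolding graph_dist_def by (rule Least_le[of "\<lambda>n. (i, j) \<in> G ^^ n", OF *(1)])
  finally show ?thesis .
qed

lemma cell_dist_walk:
  assumes "i \<in> I" shows "\<exists>j\<in>J0. (i, j) \<in> G ^^ (cell_dist G J0 i)"
proof -
  have "cell_dist G J0 i \<in> (\<lambda>j. graph_dist G i j) ` J0"
    unfolding cell_dist_def using J0_props by (intro Min_in) auto
  then obtain j where j: "j \<in> J0" "cell_dist G J0 i = graph_dist G i j" by auto
  have "(i, j) \<in> G\<^sup>*" using conn assms j J0_props by (auto simp: graph_connected_def)
  then have "\<exists>n. (i, j) \<in> G ^^ n" by (rule rtrancl_imp_relpow)
  then have "(i, j) \<in> G ^^ (graph_dist G i j)" unfolding graph_dist_def by (rule LeastI_ex)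
  then show ?thesis using j by auto
qed

lemma cell_dist_0_iff: "i \<in> I \<Longrightarrow> cell_dist G J0 i = 0 \<longleftrightarrow> i \<in> J0"
  using cell_dist_walk[of i] cell_dist_le[of i i 0] by auto

lemma cell_dist_neighbour:
  assumes "(i, j) \<in> G" shows "cell_dist G J0 i \<le> Suc (cell_dist G J0 j)"
proof -
  have "j \<in> I" using assms by (auto simp: G part_graph_def)
  then obtain z where "z \<in> J0" "(j, z) \<in> G ^^ (cell_dist G J0 j)" using cell_dist_walk by blast
  then show ?thesis using relpow_Suc_I2[OF assms] cell_dist_le by blast
qed

lemma cell_dist_step:
  assumes "i \<in> I" "cell_dist G J0 i = Suc d" shows "\<exists>j\<in>I. (i, j) \<in> G \<and> cell_dist G J0 j = d"
proof -
  obtain z where z: "z \<in> J0" "(i, z) \<in> G ^^ Suc d" using cell_dist_walk[OF assms(1)] assms(2) by auto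
  obtain j where j: "(i, j) \<in> G" "(j, z) \<in> G ^^ d" using relpow_Suc_D2[OF z(2)] by blast
  have "j \<in> I" using j by (auto simp: G part_graph_def)
  moreover have "cell_dist G J0 j = d" using cell_dist_le[OF j(2) z(1)] cell_dist_neighbour[OF j(1)] assms(2) by simp
  ultimately show ?thesis using j by blast
qed

text \<open>Two consecutive edges within cells of the same partition could be replaced by one.\<close>

lemma shortest_path_alternates:
  assumes "i \<in> I" "cell_dist G J0 i = Suc d"
  shows "\<exists>j\<in>I. cell_dist G J0 j = d \<and> (\<exists>J\<in>(if even d then \<B> else \<A>). i \<in> J \<and> j \<in> J)"
  using assms
proof (induction d arbitrary: i)
  case 0
  obtain j where j: "j \<in> I" "(i, j) \<in> G" "cell_dist G J0 j = 0" using cell_dist_step[OF 0] by blast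
  then obtain J where J: "J \<in> \<A> \<union> \<B>" "i \<in> J" "j \<in> J" by (auto simp: G part_graph_def)
  \<comment> \<open>A cell of the first partition that meets J0 equals J0, which does not contain
    i.\<close>
  have "J \<notin> \<A>"
  proof
    assume "J \<in> \<A>"
    moreover have "j \<in> J0" using cell_dist_0_iff j by blast
    ultimately have "J = J0" using A J0 J by (auto simp: partition_on_def disjoint_def)
    then show False using 0 cell_dist_0_iff[of i] J by simp
  qed
  then show ?case using j J by (intro bexI[of _ j]) auto
next
  case (Suc d)
  obtain j where j: "j \<in> I" "(i, j) \<in> G" "cell_dist G J0 j = Suc d" using cell_dist_step[OF Suc.prems] by blast
  then obtain J where J: "J \<in> \<A> \<union> \<B>" "i \<in> J" "j \<in> J" by (auto simp: G part_graph_def)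
  obtain z J' where z: "z \<in> I" "cell_dist G J0 z = d" "J' \<in> (if even d then \<B> else \<A>)" "j \<in> J'" "z \<in> J'"
    using Suc.IH[OF j(1,3)] by blast
  \<comment> \<open>Otherwise i, j and z lie in one cell, and i has distance at most d + 1 instead
    of d + 2.\<close>
  have "J \<notin> (if even d then \<B> else \<A>)"
  proof
    assume "J \<in> (if even d then \<B> else \<A>)"
    then have "J = J'" using partition_on_unique_cell[OF A, of J J' j] partition_on_unique_cell[OF B, of J J' j] z J
      by (auto split: if_splits)
    then have "(i, z) \<in> G" using Suc.prems(1) z J by (auto simp: G part_graph_def)
    then show False using cell_dist_neighbour[of i z] z Suc.prems(2) by simp
  qed
  then show ?case using j J by (intro bexI[of _ j]) (auto split: if_splits)
qed

end

text \<open>A singular initial plan still has cell marginals dominated by \<nu>, and these are all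
  that the next step sees. Truncating the derivative at 1 makes the bounds hold at every
  point.\<close>

lemma (in prob_space) dominated_density:
  assumes "sets \<sigma> = sets M" and le: "\<And>B. B \<in> sets M \<Longrightarrow> emeasure \<sigma> B \<le> emeasure M B"
  shows "\<exists>f. f \<in> borel_measurable M \<and> (\<forall>x. 0 \<le> f x \<and> f x \<le> 1) \<and> \<sigma> = density M (\<lambda>x. ennreal (f x))"
proof -
  have ac: "absolutely_continuous M \<sigma>"
    unfolding absolutely_continuous_def using le assms(1)
    by (auto simp: null_sets_def) (metis le_zero_eq)
  define r where "r = RN_deriv M \<sigma>"
  have [measurable]: "r \<in> borel_measurable M" by (simp add: r_def)
  have dr: "density M r = \<sigma>" unfolding r_def by (rule density_RN_deriv[OF ac assms(1)])
  \<comment> \<open>If the set where the derivative exceeds 1 were not null, it would have larger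
    measure under \<sigma> than under M.\<close>
  define A where "A = {x\<in>space M. 1 < r x}"
  have A [measurable]: "A \<in> sets M" unfolding A_def by measurable
  have eA: "(\<integral>\<^sup>+x. indicator A x \<partial>M) = emeasure M A" by simp
  have "(\<integral>\<^sup>+x. r x * indicator A x - indicator A x \<partial>M) = (\<integral>\<^sup>+x. r x * indicator A x \<partial>M) - (\<integral>\<^sup>+x. indicator A x \<partial>M)"
  proof (rule nn_integral_diff)
    show "(\<integral>\<^sup>+x. indicator A x \<partial>M) \<noteq> \<infinity>" unfolding eA by (simp add: emeasure_eq_measure)
    show "AE x in M. indicator A x \<le> r x * indicator A x" by (auto simp: A_def indicator_def intro: less_imp_le)
  qed auto
  also have "(\<integral>\<^sup>+x. r x * indicator A x \<partial>M) = emeasure \<sigma> A"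
    unfolding dr[symmetric] by (simp add: emeasure_density)
  also have "emeasure \<sigma> A - (\<integral>\<^sup>+x. indicator A x \<partial>M) = 0"
  proof -
    have "emeasure \<sigma> A \<noteq> \<top>" using le[OF A] by (auto simp: emeasure_eq_measure top_unique)
    then show ?thesis unfolding eA using le[OF A] by (simp add: diff_eq_0_iff_ennreal less_top)
  qed
  finally have "AE x in M. r x * indicator A x - indicator A x = 0"
    by (subst (asm) nn_integral_0_iff_AE) auto
  then have r1: "AE x in M. r x \<le> 1"
  proof (rule AE_mp, intro AE_I2 impI)
    fix x assume x: "x \<in> space M" "r x * indicator A x - indicator A x = 0"
    show "r x \<le> 1"
    proof (rule ccontr)
      assume "\<not> r x \<le> 1"
      then have "r x - 1 = 0" and "1 < r x" using x by (auto simp: A_def indicator_def not_le)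
      then have "r x \<le> 1" by (simp add: diff_eq_0_iff_ennreal)
      then show False using \<open>1 < r x\<close> by simp
    qed
  qed
  define f where "f x = min 1 (enn2real (r x))" for x
  have "\<sigma> = density M (\<lambda>x. ennreal (f x))"
    unfolding dr[symmetric]
  proof (rule density_cong)
    show "AE x in M. r x = ennreal (f x)" using r1
    proof eventually_elim
      case (elim x)
      have "r x < \<top>" using elim by (simp add: order_le_less_trans[OF elim])
      then have eq: "ennreal (enn2real (r x)) = r x" by simp
      then have "enn2real (r x) \<le> 1" using elim by (metis ennreal_1 ennreal_le_iff zero_le_one)
      then show ?case using eq by (simp add: f_def)
    qed
  qed (auto simp: f_def)
  moreover have "f \<in> borel_measurable M" unfolding f_def by measurable
  moreover have "0 \<le> f x \<and> f x \<le> 1" for x by (simp add: f_def)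
  ultimately show ?thesis by blast
qed

section \<open>One step of the algorithm in terms of densities\<close>

context ot_cells
begin

lemma comp_cell_sets:
  assumes "J \<subseteq> I" shows "comp_cell X J \<in> sets borel"
  unfolding comp_cell_def using assms fin_I X_sets by (intro sets.finite_UN) (auto intro: finite_subset)

lemma in_comp_cell_iff:
  assumes "J \<subseteq> I" shows "x \<in> comp_cell X J \<longleftrightarrow> cell x \<in> J"
proof
  assume "x \<in> comp_cell X J"
  then obtain i where i: "i \<in> J" "x \<in> X i" unfolding comp_cell_def by blast
  then have "cell x = i" using assms by (intro cell_unique) auto
  then show "cell x \<in> J" using i by simp
next
  assume "cell x \<in> J" then show "x \<in> comp_cell X J"
    unfolding comp_cell_def using cell_in(2)[of x] by blast
qed

lemma indicator_comp_cell:
  assumes "J \<subseteq> I" shows "indicator (comp_cell X J) x = (\<Sum>i\<in>J. indicator (X i) x :: real)"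
proof -
  have "(\<Sum>i\<in>J. indicator (X i) x :: real) = (\<Sum>i\<in>J. if i = cell x then 1 else 0)"
    using assms by (intro sum.cong) (auto simp: indicator_cell)
  also have "\<dots> = (if cell x \<in> J then 1 else 0)" using finite_subset[OF assms fin_I] by simp
  also have "\<dots> = indicator (comp_cell X J) x"
    by (simp add: in_comp_cell_iff[OF assms] indicator_def)
  finally show ?thesis by simp
qed

lemma measure_comp_cell:
  assumes "J \<subseteq> I" shows "measure \<mu> (comp_cell X J) = (\<Sum>i\<in>J. m i)"
  unfolding comp_cell_def m_def
  using assms X_disj fin_I X_measurable
  by (intro M1.finite_measure_finite_Union) (auto intro: finite_subset disjoint_family_on_mono)

lemma Fy_sum:
  assumes p: "p \<in> borel_measurable M" and B: "\<And>z. \<bar>p z\<bar> \<le> B" and J: "J \<subseteq> I"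
  shows "(\<Sum>i\<in>J. Fy p i y) = (\<integral>x. indicator (comp_cell X J) x * p (x, y) \<partial>\<mu>)"
proof -
  note [measurable] = p
  have int: "integrable \<mu> (\<lambda>x. indicator (X i) x * p (x, y))" if "i \<in> J" for i
  proof (rule M1.integrable_bounded)
    have [measurable]: "X i \<in> sets \<mu>" using X_measurable J that by blast
    show "(\<lambda>x. indicator (X i) x * p (x, y)) \<in> borel_measurable \<mu>" by measurable
    show "\<bar>indicator (X i) x * p (x, y)\<bar> \<le> 1 * B" for x
      by (rule abs_mult_bound[OF _ B]) (auto simp: indicator_def)
  qed
  have "(\<Sum>i\<in>J. Fy p i y) = (\<integral>x. (\<Sum>i\<in>J. indicator (X i) x * p (x, y)) \<partial>\<mu>)"
    unfolding Fy_def using int by (rule Bochner_Integration.integral_sum[symmetric])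
  then show ?thesis unfolding indicator_comp_cell[OF J] sum_distrib_right .
qed

lemma restr_cylinder_density:
  assumes [measurable]: "q \<in> borel_measurable M" and S [measurable]: "S \<in> sets borel" and q: "\<And>z. 0 \<le> q z"
  shows "restr (dens q) (S \<times> UNIV) = density M (\<lambda>z. ennreal (indicator S (fst z) * q z))"
  unfolding restr_eq_density
  by (subst density_density_eq)
     (auto intro!: density_cong simp: indicator_times ennreal_mult[symmetric] q mult.commute)

text \<open>Of the given plan only the coupling property enters, which admits an arbitrary initial
  plan. When the plan does have a bounded density, the last clause records that the step leaves the
  marginals over composite cells unchanged.\<close>

lemma dd_step_structured:
  assumes \<pi>: "\<pi> \<in> couplings \<mu> \<nu>" and part: "partition_on I \<J>" and step: "dd_step \<epsilon> K \<mu> X \<J> \<pi> \<pi>'" and eps: "0 < \<epsilon>"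
  shows "\<pi>' \<in> couplings \<mu> \<nu> \<and> (\<exists>p U V C. structured \<J> p U V C \<and> \<pi>' = dens p
    \<and> (\<forall>q. bdd_density q \<longrightarrow> \<pi> = dens q \<longrightarrow>
        (AE y in \<nu>. \<forall>J\<in>\<J>. (\<Sum>i\<in>J. Fy q i y) = (\<Sum>i\<in>J. Fy p i y))))"
proof -
  have sub: "J \<subseteq> I" if "J \<in> \<J>" for J using part that by (auto simp: partition_on_def)
  have finJ: "finite \<J>" using part fin_I finite_elements by blast
  note split = sum_partition[OF part]
  define S where "S J = comp_cell X J" for J
  have Sb: "S J \<in> sets borel" if "J \<in> \<J>" for J unfolding S_def by (rule comp_cell_sets[OF sub[OF that]])
  have Sm: "S J \<in> sets \<mu>" if "J \<in> \<J>" for J using Sb[OF that] sets_mu by simp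
  have mS: "0 < measure \<mu> (S J)" if J: "J \<in> \<J>" for J
  proof -
    have "J \<noteq> {}" using part J by (auto simp: partition_on_def)
    then show ?thesis unfolding S_def measure_comp_cell[OF sub[OF J]]
      using sub[OF J] finite_subset[OF sub[OF J] fin_I] m_pos by (intro sum_pos) auto
  qed
  have sum_S: "(\<Sum>J\<in>\<J>. indicator (S J) x :: real) = 1" for x
    unfolding S_def using split[of "\<lambda>i. indicator (X i) x"] sum_cells[of x "\<lambda>_. 1"] indicator_comp_cell[OF sub, of _ x]
    by simp
  have pi_sets: "sets \<pi> = sets M" and pi_X: "marg_X \<pi> = \<mu>" and pi_Y: "marg_Y \<pi> = \<nu>"
    using \<pi> sets_M by (auto simp: couplings_def)
  have pi_space: "space \<pi> = UNIV" using sets_eq_imp_space_eq[OF pi_sets] space_M by simp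
  have cyl: "S J \<times> B \<in> sets \<pi>" if "J \<in> \<J>" "B \<in> sets \<nu>" for J B
    unfolding pi_sets using Sm[OF that(1)] that(2) by (rule pair_measureI)
  define \<sigma> where "\<sigma> J = marg_Y (restr \<pi> (S J \<times> UNIV))" for J
  have sets_\<sigma>: "sets (\<sigma> J) = sets \<nu>" for J by (simp add: \<sigma>_def marg_Y_def sets_nu)
  have snd_meas: "snd \<in> measurable N borel" if "sets N = sets M" for N :: "('a \<times> 'b) measure"
  proof -
    have "(snd :: 'a \<times> 'b \<Rightarrow> 'b) \<in> measurable M borel" using measurable_snd[of \<mu> \<nu>] measurable_cong_sets[OF refl sets_nu] by blast
    then show ?thesis using measurable_cong_sets[OF that refl] by blast
  qed
  have fst_meas: "fst \<in> measurable N borel" if "sets N = sets M" for N :: "('a \<times> 'b) measure"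
  proof -
    have "(fst :: 'a \<times> 'b \<Rightarrow> 'a) \<in> measurable M borel" using measurable_fst[of \<mu> \<nu>] measurable_cong_sets[OF refl sets_mu] by blast
    then show ?thesis using measurable_cong_sets[OF that refl] by blast
  qed
  have em\<sigma>: "emeasure (\<sigma> J) B = emeasure \<pi> (S J \<times> B)" if J: "J \<in> \<J>" and B: "B \<in> sets \<nu>" for J B
  proof -
    have "emeasure (\<sigma> J) B = emeasure (restr \<pi> (S J \<times> UNIV)) (UNIV \<times> B)"
      unfolding \<sigma>_def marg_Y_def using B snd_meas[of "restr \<pi> (S J \<times> UNIV)"] pi_sets sets_nu
      by (subst emeasure_distr) (auto simp: pi_space intro!: arg_cong[where f = "emeasure _"])
    also have "\<dots> = emeasure \<pi> ((S J \<times> UNIV) \<inter> (UNIV \<times> B))"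
      using cyl[OF J, of UNIV] B sets.top[of \<nu>] sets.top[of \<mu>]
      by (intro emeasure_restr) (auto simp: pi_sets space_mu space_nu intro!: pair_measureI)
    also have "(S J \<times> UNIV) \<inter> (UNIV \<times> B) = S J \<times> B" by auto
    finally show ?thesis .
  qed
  have em_nu: "emeasure \<pi> (UNIV \<times> B) = emeasure \<nu> B" if "B \<in> sets \<nu>" for B
  proof -
    have "emeasure \<nu> B = emeasure (marg_Y \<pi>) B" using pi_Y by simp
    also have "\<dots> = emeasure \<pi> (UNIV \<times> B)"
      unfolding marg_Y_def using that snd_meas[OF pi_sets] sets_nu
      by (subst emeasure_distr) (auto simp: pi_space intro!: arg_cong[where f = "emeasure _"])
    finally show ?thesis by simp
  qed
  have em_mu: "emeasure \<pi> (A \<times> UNIV) = emeasure \<mu> A" if "A \<in> sets \<mu>" for A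
  proof -
    have "emeasure \<mu> A = emeasure (marg_X \<pi>) A" using pi_X by simp
    also have "\<dots> = emeasure \<pi> (A \<times> UNIV)"
      unfolding marg_X_def using that fst_meas[OF pi_sets] sets_mu
      by (subst emeasure_distr) (auto simp: pi_space intro!: arg_cong[where f = "emeasure _"])
    finally show ?thesis by simp
  qed
  have UB: "UNIV \<times> B \<in> sets \<pi>" if "B \<in> sets \<nu>" for B
    unfolding pi_sets using sets.top[of \<mu>] that by (auto simp: space_mu intro!: pair_measureI)
  have le\<sigma>: "emeasure (\<sigma> J) B \<le> emeasure \<nu> B" if "J \<in> \<J>" "B \<in> sets \<nu>" for J B
    unfolding em\<sigma>[OF that] em_nu[OF that(2), symmetric] using UB[OF that(2)] by (intro emeasure_mono) auto
  have "\<forall>J\<in>\<J>. \<exists>f. f \<in> borel_measurable \<nu> \<and> (\<forall>x. 0 \<le> f x \<and> f x \<le> 1) \<and> \<sigma> J = density \<nu> (\<lambda>x. ennreal (f x))"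
    using M2.dominated_density[OF sets_\<sigma> le\<sigma>] by blast
  then obtain f where f: "\<And>J. J \<in> \<J> \<Longrightarrow> f J \<in> borel_measurable \<nu>" "\<And>J x. J \<in> \<J> \<Longrightarrow> 0 \<le> f J x" "\<And>J x. J \<in> \<J> \<Longrightarrow> f J x \<le> 1"
    and \<sigma>f: "\<And>J. J \<in> \<J> \<Longrightarrow> \<sigma> J = density \<nu> (\<lambda>x. ennreal (f J x))"
    using bchoice[of \<J>] by metis
  have fi: "integrable \<nu> (f J)" if "J \<in> \<J>" for J
    using f that by (intro M2.integrable_bounded[where B = 1]) auto
  have mass_f: "(\<integral>y. f J y \<partial>\<nu>) = measure \<mu> (S J)" if J: "J \<in> \<J>" for J
  proof -
    have "ennreal (\<integral>y. f J y \<partial>\<nu>) = (\<integral>\<^sup>+y. ennreal (f J y) \<partial>\<nu>)"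
      using fi[OF J] f(2)[OF J] by (intro nn_integral_eq_integral[symmetric]) auto
    also have "\<dots> = emeasure (\<sigma> J) (space \<nu>)" unfolding \<sigma>f[OF J] using f(1)[OF J] by (simp add: emeasure_density)
    also have "\<dots> = emeasure \<mu> (S J)" using em\<sigma>[OF J sets.top] em_mu[OF Sm[OF J]] by (simp add: space_nu)
    finally have "ennreal (\<integral>y. f J y \<partial>\<nu>) = ennreal (measure \<mu> (S J))" by (simp add: M1.emeasure_eq_measure)
    then show ?thesis using f(2)[OF J] by (subst (asm) ennreal_inj) (auto intro!: integral_nonneg_AE)
  qed
  obtain \<pi>J where min: "\<And>J. J \<in> \<J> \<Longrightarrow> is_entropic_minimizer \<epsilon> K (restr \<mu> (S J)) (\<sigma> J) (\<pi>J J)" and \<pi>': "\<pi>' = measure_sum \<J> \<pi>J"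
    using step unfolding dd_step_def S_def \<sigma>_def by blast
  \<comment> \<open>The data for one composite cell are bundled into a triple, so that a single
    choice provides them for all cells.\<close>
  define good where "good J W \<longleftrightarrow> (case W of (U, V, C) \<Rightarrow> U \<in> borel_measurable \<mu> \<and> (\<forall>x. 1 \<le> U x \<and> U x \<le> exp \<kappa>)
    \<and> V \<in> borel_measurable \<nu> \<and> (\<forall>y. 0 \<le> V y \<and> V y \<le> C) \<and> (\<integral>y. V y \<partial>\<nu>) = 1
    \<and> (\<forall>x. (\<integral>y. U x * V y * k (x, y) \<partial>\<nu>) = 1) \<and> (\<forall>y. (\<integral>x. indicator (S J) x * (U x * V y * k (x, y)) \<partial>\<mu>) = f J y)
    \<and> \<pi>J J = density M (\<lambda>(x, y). ennreal (indicator (S J) x * (U x * V y * k (x, y)))))" for J W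
  have "\<exists>W. good J W" if J: "J \<in> \<J>" for J
    using minimizer_density[OF Sb[OF J] mS[OF J] f(1)[OF J] f(2)[OF J] f(3)[OF J] mass_f[OF J] min[OF J, unfolded \<sigma>f[OF J]] eps]
    unfolding good_def by (simp only: split_paired_Ex prod.case)
  then obtain W where W: "\<And>J. J \<in> \<J> \<Longrightarrow> good J (W J)" by metis
  define UJ VJ CJ where "UJ J = fst (W J)" and "VJ J = fst (snd (W J))" and "CJ J = snd (snd (W J))" for J
  have good: "UJ J \<in> borel_measurable \<mu>" "1 \<le> UJ J x" "UJ J x \<le> exp \<kappa>" "VJ J \<in> borel_measurable \<nu>" "0 \<le> VJ J y" "VJ J y \<le> CJ J"
    "(\<integral>y. VJ J y \<partial>\<nu>) = 1" "(\<integral>y. UJ J x * VJ J y * k (x, y) \<partial>\<nu>) = 1"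
    "(\<integral>x. indicator (S J) x * (UJ J x * VJ J y * k (x, y)) \<partial>\<mu>) = f J y"
    "\<pi>J J = density M (\<lambda>(x, y). ennreal (indicator (S J) x * (UJ J x * VJ J y * k (x, y))))" if "J \<in> \<J>" for J x y
    using W[OF that] unfolding good_def UJ_def VJ_def CJ_def by (auto simp: case_prod_beta)
  define jc where "jc i = (THE J. J \<in> \<J> \<and> i \<in> J)" for i
  have jc_eq: "jc i = J" if "J \<in> \<J>" "i \<in> J" for i J
    unfolding jc_def using part that by (intro the_equality) (auto simp: partition_on_def disjoint_def)
  have jc: "jc i \<in> \<J>" "i \<in> jc i" if i: "i \<in> I" for i
  proof -
    obtain J where "J \<in> \<J>" "i \<in> J" using part i unfolding partition_on_def by blast
    then show "jc i \<in> \<J>" "i \<in> jc i" using jc_eq by auto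
  qed
  define U where "U x = UJ (jc (cell x)) x" for x
  define V where "V i = VJ (jc i)" for i
  define C where "C = (\<Sum>J\<in>\<J>. CJ J)"
  define p where "p z = U (fst z) * V (cell (fst z)) (snd z) * k z" for z
  have memS: "x \<in> S J \<longleftrightarrow> jc (cell x) = J" if J: "J \<in> \<J>" for J x
    unfolding S_def in_comp_cell_iff[OF sub[OF J]] using jc[OF cell_in(1)[of x]] jc_eq[OF J] by auto
  have indS: "indicator (S J) x = (if jc (cell x) = J then 1 else 0 :: real)" if J: "J \<in> \<J>" for J x
    by (simp add: indicator_def memS[OF J])
  have jcell: "jc (cell x) \<in> \<J>" for x using jc cell_in(1) by blast
  have pick: "(\<Sum>J\<in>\<J>. indicator (S J) x * g J) = g (jc (cell x))" for x and g :: "'i set \<Rightarrow> real"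
  proof -
    have "(\<Sum>J\<in>\<J>. indicator (S J) x * g J) = (\<Sum>J\<in>\<J>. if J = jc (cell x) then g J else 0)"
      by (intro sum.cong) (auto simp: indS)
    then show ?thesis using finJ jcell[of x] by simp
  qed
  have CJ0: "0 \<le> CJ J" if "J \<in> \<J>" for J using good(5,6)[OF that] order_trans by blast
  have CJC: "CJ J \<le> C" if "J \<in> \<J>" for J unfolding C_def using that finJ CJ0 by (intro member_le_sum) auto
  have p_sum: "p z = (\<Sum>J\<in>\<J>. indicator (S J) (fst z) * (UJ J (fst z) * VJ J (snd z) * k z))" for z
    unfolding pick by (simp add: p_def U_def V_def)
  have Um: "U \<in> borel_measurable \<mu>"
  proof -
    have "U x = (\<Sum>J\<in>\<J>. indicator (S J) x * UJ J x)" for x unfolding pick U_def ..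
    moreover have "(\<lambda>x. \<Sum>J\<in>\<J>. indicator (S J) x * UJ J x) \<in> borel_measurable \<mu>"
      using Sm good(1) by (intro borel_measurable_sum borel_measurable_times) auto
    ultimately show ?thesis by presburger
  qed
  have pJm: "(\<lambda>z. indicator (S J) (fst z) * (UJ J (fst z) * VJ J (snd z) * k z)) \<in> borel_measurable M" if "J \<in> \<J>" for J
  proof -
    note [measurable] = Sm[OF that] good(1,4)[OF that]
    show ?thesis by measurable
  qed
  have pm: "p \<in> borel_measurable M" unfolding p_sum[abs_def] using pJm by (intro borel_measurable_sum)
  have U1: "1 \<le> U x" "U x \<le> exp \<kappa>" for x using good(2,3)[OF jcell] by (auto simp: U_def)
  have V0: "0 \<le> V i y" "V i y \<le> C" if "i \<in> I" for i y
    using good(5,6)[OF jc(1)[OF that]] CJC[OF jc(1)[OF that]] by (auto simp: V_def intro: order_trans)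
  have p0: "0 \<le> p z" for z
    unfolding p_def using U1(1)[of "fst z"] V0(1)[OF cell_in(1)] k_pos[of z] by (intro mult_nonneg_nonneg) auto
  have pB: "p z \<le> exp \<kappa> * C * 1" for z
    unfolding p_def using U1[of "fst z"] V0[OF cell_in(1), of "fst z" "snd z"] k_pos[of z] k_le[of z]
    by (intro mult_mono mult_nonneg_nonneg) auto
  have pB': "\<bar>p z\<bar> \<le> exp \<kappa> * C * 1" for z using p0[of z] pB[of z] by simp
  have pX: "(\<integral>y. p (x, y) \<partial>\<nu>) = 1" for x
    using good(8)[OF jcell[of x], of x] by (simp add: p_def U_def V_def)
  have FJ: "(\<Sum>i\<in>J. Fy p i y) = f J y" if J: "J \<in> \<J>" for J y
  proof -
    have "(\<Sum>i\<in>J. Fy p i y) = (\<integral>x. indicator (S J) x * p (x, y) \<partial>\<mu>)"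
      unfolding S_def by (rule Fy_sum[OF pm pB' sub[OF J]])
    also have "\<dots> = (\<integral>x. indicator (S J) x * (UJ J x * VJ J y * k (x, y)) \<partial>\<mu>)"
      by (intro Bochner_Integration.integral_cong) (auto simp: indS[OF J] p_def U_def V_def)
    finally show ?thesis using good(9)[OF J] by simp
  qed
  \<comment> \<open>The f J are the second marginals of the parts of \<pi> over the disjoint sets S
    J, which cover the space, so they add up to \<nu>.\<close>
  have sum_f_density: "density \<nu> (\<lambda>y. ennreal (\<Sum>J\<in>\<J>. f J y)) = \<nu>"
  proof (rule measure_eqI)
    fix B assume "B \<in> sets (density \<nu> (\<lambda>y. ennreal (\<Sum>J\<in>\<J>. f J y)))"
    then have B: "B \<in> sets \<nu>" by simp
    have eq: "ennreal (\<Sum>J\<in>\<J>. f J y) = (\<Sum>J\<in>\<J>. ennreal (f J y))" for y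
      by (rule sum_ennreal[symmetric]) (rule f(2))
    have "(\<lambda>y. ennreal (\<Sum>J\<in>\<J>. f J y)) \<in> borel_measurable \<nu>"
      using f(1) by (intro measurable_compose[OF _ measurable_ennreal] borel_measurable_sum)
    then have "emeasure (density \<nu> (\<lambda>y. ennreal (\<Sum>J\<in>\<J>. f J y))) B = (\<integral>\<^sup>+y. ennreal (\<Sum>J\<in>\<J>. f J y) * indicator B y \<partial>\<nu>)"
      using B by (rule emeasure_density)
    also have "\<dots> = (\<integral>\<^sup>+y. (\<Sum>J\<in>\<J>. ennreal (f J y) * indicator B y) \<partial>\<nu>)"
      by (simp only: eq sum_distrib_right)
    also have "\<dots> = (\<Sum>J\<in>\<J>. \<integral>\<^sup>+y. ennreal (f J y) * indicator B y \<partial>\<nu>)"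
      using f B by (intro nn_integral_sum) auto
    also have "\<dots> = (\<Sum>J\<in>\<J>. emeasure \<pi> (S J \<times> B))"
      using f B by (intro sum.cong) (auto simp: em\<sigma>[symmetric] \<sigma>f emeasure_density)
    also have "\<dots> = emeasure \<pi> (\<Union>J\<in>\<J>. S J \<times> B)"
    proof (rule sum_emeasure)
      show "(\<lambda>J. S J \<times> B) ` \<J> \<subseteq> sets \<pi>" using cyl B by auto
      show "disjoint_family_on (\<lambda>J. S J \<times> B) \<J>"
        unfolding disjoint_family_on_def using memS by blast
    qed (rule finJ)
    also have "(\<Union>J\<in>\<J>. S J \<times> B) = UNIV \<times> B"
    proof -
      have "x \<in> S (jc (cell x))" for x using memS[OF jcell] by simp
      then show ?thesis using jcell by auto
    qed
    also have "emeasure \<pi> (UNIV \<times> B) = emeasure \<nu> B" by (rule em_nu[OF B])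
    finally show "emeasure (density \<nu> (\<lambda>y. ennreal (\<Sum>J\<in>\<J>. f J y))) B = emeasure \<nu> B" .
  qed simp
  have sum_f: "AE y in \<nu>. (\<Sum>J\<in>\<J>. f J y) = 1"
  proof -
    have "AE y in \<nu>. ennreal (\<Sum>J\<in>\<J>. f J y) = 1"
      by (rule M2.density_unique) (use f sum_f_density in \<open>auto simp: density_1\<close>)
    then show ?thesis by eventually_elim (use f in \<open>simp add: sum_nonneg\<close>)
  qed
  have bdd: "bdd_density p"
    unfolding bdd_density_def using pm p0 pB pX sum_f split by (auto simp: FJ)
  have st: "structured \<J> p U V C"
    unfolding structured_def
  proof (intro conjI ballI allI bdd Um U1)
    fix i assume i: "i \<in> I"
    show "V i \<in> borel_measurable \<nu>" "(\<integral>y. V i y \<partial>\<nu>) = 1" using good(4,7)[OF jc(1)[OF i]] by (auto simp: V_def)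
    show "0 \<le> V i y" "V i y \<le> C" for y using V0[OF i] by auto
  next
    fix J i j assume "J \<in> \<J>" "i \<in> J" "j \<in> J"
    then show "V i = V j" using jc_eq by (simp add: V_def)
  qed (simp add: p_def)
  have \<pi>'p: "\<pi>' = dens p"
  proof -
    let ?N = "dens p"
    \<comment> \<open>\<open>measure_of\<close> returns the intended measure once its set function
      is shown to agree with that of an actual measure.\<close>
    have "\<pi>' = measure_of UNIV (sets (borel \<Otimes>\<^sub>M borel)) (emeasure ?N)"
      unfolding \<pi>' measure_sum_def
    proof (rule measure_of_eq)
      fix B assume "B \<in> sigma_sets UNIV (sets (borel \<Otimes>\<^sub>M borel :: ('a \<times> 'b) measure))"
      then have B: "B \<in> sets M"
        using sets.sigma_sets_eq[of "borel \<Otimes>\<^sub>M borel :: ('a \<times> 'b) measure"] sets_M by (simp add: space_pair_measure)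
      have "(\<Sum>J\<in>\<J>. emeasure (\<pi>J J) B) = (\<Sum>J\<in>\<J>. \<integral>\<^sup>+z. ennreal (indicator (S J) (fst z) * (UJ J (fst z) * VJ J (snd z) * k z)) * indicator B z \<partial>M)"
        using pJm B by (intro sum.cong refl, subst good(10)) (auto simp: case_prod_beta' emeasure_density)
      also have "\<dots> = (\<integral>\<^sup>+z. (\<Sum>J\<in>\<J>. ennreal (indicator (S J) (fst z) * (UJ J (fst z) * VJ J (snd z) * k z)) * indicator B z) \<partial>M)"
        using pJm B by (intro nn_integral_sum[symmetric]) auto
      also have "\<dots> = (\<integral>\<^sup>+z. ennreal (p z) * indicator B z \<partial>M)"
      proof (intro nn_integral_cong)
        fix z
        have nn: "0 \<le> indicator (S J) (fst z) * (UJ J (fst z) * VJ J (snd z) * k z)" if "J \<in> \<J>" for J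
          using good(2)[OF that, of "fst z"] good(5)[OF that, of "snd z"] k_pos[of z]
          by (intro mult_nonneg_nonneg) auto
        show "(\<Sum>J\<in>\<J>. ennreal (indicator (S J) (fst z) * (UJ J (fst z) * VJ J (snd z) * k z)) * indicator B z) = ennreal (p z) * indicator B z"
          unfolding p_sum sum_distrib_right[symmetric] using nn by (subst sum_ennreal) auto
      qed
      also have "\<dots> = emeasure ?N B" using pm B by (simp add: emeasure_density)
      finally show "(\<Sum>J\<in>\<J>. emeasure (\<pi>J J) B) = emeasure ?N B" .
    qed auto
    also have "\<dots> = measure_of (space ?N) (sets ?N) (emeasure ?N)" by (simp add: space_M sets_M)
    also have "\<dots> = ?N" by (rule measure_of_of_measure)
    finally show ?thesis .
  qed
  have sec: "integrable \<nu> (\<lambda>y. p (x, y))" "integrable \<mu> (\<lambda>x. p (x, y))" for x y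
    using section_X[OF pm] section_Y[OF pm] pB'
    by (auto intro!: M2.integrable_bounded[where B = "exp \<kappa> * C * 1"] M1.integrable_bounded[where B = "exp \<kappa> * C * 1"])
  have cpl: "\<pi>' \<in> couplings \<mu> \<nu>"
  proof -
    have "marg_X \<pi>' = density \<mu> (\<lambda>_. 1)" unfolding \<pi>'p
    proof (rule marg_X_density)
      fix x
      have "(\<integral>\<^sup>+y. ennreal (p (x, y)) \<partial>\<nu>) = ennreal (\<integral>y. p (x, y) \<partial>\<nu>)"
        by (rule nn_integral_eq_integral) (use sec p0 in auto)
      then show "(\<integral>\<^sup>+y. ennreal (p (x, y)) \<partial>\<nu>) = 1" by (simp add: pX)
    qed (use pm in auto)
    moreover have "marg_Y \<pi>' = density \<nu> (\<lambda>y. ennreal (\<Sum>J\<in>\<J>. f J y))" unfolding \<pi>'p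
    proof (rule marg_Y_density)
      fix y
      have "(\<integral>x. p (x, y) \<partial>\<mu>) = (\<Sum>i\<in>I. Fy p i y)"
        unfolding Fy_sum[OF pm pB' order_refl] indicator_comp_cell[OF order_refl] using sum_cells[of _ "\<lambda>_. 1"] by simp
      also have "\<dots> = (\<Sum>J\<in>\<J>. f J y)" unfolding split by (simp add: FJ)
      finally have "(\<integral>x. p (x, y) \<partial>\<mu>) = (\<Sum>J\<in>\<J>. f J y)" .
      moreover have "(\<integral>\<^sup>+x. ennreal (p (x, y)) \<partial>\<mu>) = ennreal (\<integral>x. p (x, y) \<partial>\<mu>)"
        by (rule nn_integral_eq_integral) (use sec p0 in auto)
      ultimately show "(\<integral>\<^sup>+x. ennreal (p (x, y)) \<partial>\<mu>) = ennreal (\<Sum>J\<in>\<J>. f J y)" by simp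
    qed (use pm f in auto)
    ultimately show ?thesis using sets_M unfolding couplings_def sum_f_density density_1 by (simp add: \<pi>'p)
  qed
  have "AE y in \<nu>. \<forall>J\<in>\<J>. (\<Sum>i\<in>J. Fy q i y) = (\<Sum>i\<in>J. Fy p i y)"
    if q: "bdd_density q" and \<pi>q: "\<pi> = dens q" for q
  proof (rule AE_finite_allI[OF finJ])
    fix J assume J: "J \<in> \<J>"
    note qD = bdd_densityD[OF q]
    note [measurable] = qD(1) Sm[OF J]
    obtain B where B: "\<And>z. \<bar>q z\<bar> \<le> B" using qD(3) by blast
    have g: "(\<Sum>i\<in>J. Fy q i y) = (\<integral>x. indicator (S J) x * q (x, y) \<partial>\<mu>)" for y
      unfolding S_def by (rule Fy_sum[OF qD(1) B sub[OF J]])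
    have gm: "(\<lambda>y. \<Sum>i\<in>J. Fy q i y) \<in> borel_measurable \<nu>" using sub[OF J] qD(1) by (intro borel_measurable_sum Fy_measurable) auto
    have g0: "0 \<le> (\<Sum>i\<in>J. Fy q i y)" for y unfolding g by (intro integral_nonneg_AE) (auto simp: qD(2))
    have "\<sigma> J = marg_Y (density M (\<lambda>z. ennreal (indicator (S J) (fst z) * q z)))"
      unfolding \<sigma>_def \<pi>q by (simp add: restr_cylinder_density[OF qD(1) Sb[OF J] qD(2)])
    also have "\<dots> = density \<nu> (\<lambda>y. ennreal (\<Sum>i\<in>J. Fy q i y))"
    proof (rule marg_Y_density)
      fix y
      have "integrable \<mu> (\<lambda>x. indicator (S J) x * q (x, y))"
        by (rule M1.integrable_bounded[of _ "1 * B"]) (measurable, rule abs_mult_bound[OF _ B], auto simp: indicator_def)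
      then show "(\<integral>\<^sup>+x. ennreal (indicator (S J) (fst (x, y)) * q (x, y)) \<partial>\<mu>) = ennreal (\<Sum>i\<in>J. Fy q i y)"
        unfolding g by (subst nn_integral_eq_integral) (auto simp: qD(2))
    qed (use gm in measurable)
    finally have "density \<nu> (\<lambda>y. ennreal (\<Sum>i\<in>J. Fy q i y)) = density \<nu> (\<lambda>y. ennreal (f J y))" using \<sigma>f[OF J] by simp
    then have "AE y in \<nu>. ennreal (\<Sum>i\<in>J. Fy q i y) = ennreal (f J y)"
      using gm f(1)[OF J] by (intro M2.density_unique) auto
    then show "AE y in \<nu>. (\<Sum>i\<in>J. Fy q i y) = (\<Sum>i\<in>J. Fy p i y)"
      by eventually_elim (use g0 f(2)[OF J] in \<open>simp add: FJ[OF J]\<close>)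
  qed
  then show ?thesis using cpl st \<pi>'p by blast
qed

end

subsection \<open>Convergence\<close>

context ot_cells
begin

text \<open>The difference of two numbers factors into the difference and the sum of their roots,
  and Young's inequality with parameter t separates these factors. A free t takes the place of the
  Cauchy-Schwarz inequality and is chosen along the sequence later.\<close>

lemma L1_le_hellinger:
  assumes p: "bdd_density p" and r: "bdd_density r" and t: "0 < t"
  shows "(\<integral>z. \<bar>p z - r z\<bar> \<partial>M) \<le> hell p r / (2 * t) + 2 * t"
proof -
  note pD = bdd_densityD[OF p] and rD = bdd_densityD[OF r]
  obtain B where B: "\<And>z. \<bar>(sqrt (p z) - sqrt (r z))\<^sup>2\<bar> \<le> B" using sqdiff_bounded(2)[OF p r] by blast
  have hi: "integrable M (\<lambda>z. (sqrt (p z) - sqrt (r z))\<^sup>2)"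
    by (rule bounded_integrable_M[OF sqdiff_bounded(1)[OF p r] B])
  have one: "(\<integral>z. p z \<partial>M) = 1" "(\<integral>z. r z \<partial>M) = 1"
    using integral_M_fst(2)[OF p, of "\<lambda>_. 1" 1] integral_M_fst(2)[OF r, of "\<lambda>_. 1" 1] by (auto simp: M1.prob_space)
  have "(\<integral>z. \<bar>p z - r z\<bar> \<partial>M) \<le> (\<integral>z. (sqrt (p z) - sqrt (r z))\<^sup>2 / (2 * t) + t * (p z + r z) \<partial>M)"
  proof (rule integral_mono)
    fix z
    define a b where "a = sqrt (p z)" and "b = sqrt (r z)"
    have ab: "0 \<le> a" "0 \<le> b" "p z = a * a" "r z = b * b" using pD(2)[of z] rD(2)[of z] by (auto simp: a_def b_def)
    have "p z - r z = (a - b) * (a + b)" using ab by (simp add: algebra_simps)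
    then have "\<bar>p z - r z\<bar> = \<bar>a - b\<bar> * (a + b)" using ab by (simp add: abs_mult)
    also have "\<dots> \<le> \<bar>a - b\<bar>\<^sup>2 / (2 * t) + t / 2 * (a + b)\<^sup>2"
    proof -
      have "0 \<le> (\<bar>a - b\<bar> - t * (a + b))\<^sup>2 / (2 * t)" using t by simp
      also have "\<dots> = \<bar>a - b\<bar>\<^sup>2 / (2 * t) + t / 2 * (a + b)\<^sup>2 - \<bar>a - b\<bar> * (a + b)"
        using t unfolding power2_diff power_mult_distrib by (simp add: field_simps power2_eq_square)
      finally show ?thesis by simp
    qed
    also have "\<bar>a - b\<bar>\<^sup>2 = (a - b)\<^sup>2" by simp
    also have "t / 2 * (a + b)\<^sup>2 \<le> t * (p z + r z)"
    proof -
      have "0 \<le> (a - b)\<^sup>2" by simp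
      then have "(a + b)\<^sup>2 \<le> 2 * (p z + r z)" using ab by (simp add: power2_eq_square algebra_simps)
      then show ?thesis using t mult_left_mono[of "(a + b)\<^sup>2" "2 * (p z + r z)" "t / 2"] by simp
    qed
    finally show "\<bar>p z - r z\<bar> \<le> (sqrt (p z) - sqrt (r z))\<^sup>2 / (2 * t) + t * (p z + r z)" by (simp add: a_def b_def)
  qed (use pD(4) rD(4) hi in auto)
  also have "\<dots> = hell p r / (2 * t) + 2 * t"
    using pD(4) rD(4) hi one by simp
  finally show ?thesis .
qed

lemma integral_density_diff:
  fixes f :: "'a \<times> 'b \<Rightarrow> real"
  assumes p: "bdd_density p" and r: "bdd_density r" and f [measurable]: "f \<in> borel_measurable M" and B: "\<And>z. \<bar>f z\<bar> \<le> B"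
  shows "\<bar>(\<integral>z. f z \<partial>dens p) - (\<integral>z. f z \<partial>dens r)\<bar> \<le> B * (\<integral>z. \<bar>p z - r z\<bar> \<partial>M)"
proof -
  note pD = bdd_densityD[OF p] and rD = bdd_densityD[OF r]
  note [measurable] = pD(1) rD(1)
  have int: "integrable M (\<lambda>z. q z * f z)" if "integrable M q" for q :: "'a \<times> 'b \<Rightarrow> real"
  proof (rule Bochner_Integration.integrable_bound[of M "\<lambda>z. \<bar>q z\<bar> * B"])
    show "integrable M (\<lambda>z. \<bar>q z\<bar> * B)" using that by auto
    show "AE z in M. norm (q z * f z) \<le> norm (\<bar>q z\<bar> * B)"
    proof (rule AE_I2)
      fix z show "norm (q z * f z) \<le> norm (\<bar>q z\<bar> * B)"
        using mult_left_mono[OF B abs_ge_zero, of "q z" z] abs_ge_self[of "\<bar>q z\<bar> * B"] by (simp only: real_norm_def abs_mult)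
    qed
  qed (use that in measurable)
  have dens: "(\<integral>z. f z \<partial>dens q) = (\<integral>z. q z * f z \<partial>M)" if "bdd_density q" for q
    using bdd_densityD(1,2)[OF that] by (subst integral_density) auto
  have "\<bar>(\<integral>z. p z * f z \<partial>M) - (\<integral>z. r z * f z \<partial>M)\<bar> = \<bar>\<integral>z. (p z - r z) * f z \<partial>M\<bar>"
    using int[OF pD(4)] int[OF rD(4)] by (simp add: left_diff_distrib)
  also have "\<dots> \<le> (\<integral>z. \<bar>(p z - r z) * f z\<bar> \<partial>M)" by (rule integral_abs_bound)
  also have "\<dots> \<le> (\<integral>z. B * \<bar>p z - r z\<bar> \<partial>M)"
  proof (rule integral_mono)
    show "integrable M (\<lambda>z. \<bar>(p z - r z) * f z\<bar>)" using int[of "\<lambda>z. p z - r z"] pD(4) rD(4) by auto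
    show "integrable M (\<lambda>z. B * \<bar>p z - r z\<bar>)" using pD(4) rD(4) by auto
    fix z show "\<bar>(p z - r z) * f z\<bar> \<le> B * \<bar>p z - r z\<bar>"
      using mult_left_mono[OF B abs_ge_zero, of "p z - r z" z] by (simp add: abs_mult mult.commute)
  qed
  finally show ?thesis unfolding dens[OF p] dens[OF r] by simp
qed

lemma comp_cell_I: "comp_cell X I = UNIV"
  by (simp add: comp_cell_def X_cover)

lemma I_nonempty: "I \<noteq> {}"
  using cell_in(1) by blast

text \<open>The full problem is a step with the one-cell partition, and the optimal plan reproduces
  itself under it. So the analysis of steps applies and yields a single factor
  \<open>V\<close>.\<close>

lemma optimal_structured:
  assumes min: "is_entropic_minimizer \<epsilon> K \<mu> \<nu> \<pi>" and eps: "0 < \<epsilon>"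
  shows "\<exists>r U V C. structured {I} r U V C \<and> \<pi> = dens r"
proof -
  have cpl: "\<pi> \<in> couplings \<mu> \<nu>" by (rule is_entropic_minimizerD(1)[OF min eps])
  then have sets: "sets \<pi> = sets (borel \<Otimes>\<^sub>M borel)" and Y: "marg_Y \<pi> = \<nu>" by (auto simp: couplings_def)
  have restr_UNIV: "restr \<rho> UNIV = \<rho>" for \<rho> :: "'z measure"
    unfolding restr_eq_density by (simp add: density_1)
  have space: "space \<pi> = UNIV" using sets_eq_imp_space_eq[OF sets] by (simp add: space_pair_measure)
  have "\<pi> = measure_sum {I} (\<lambda>_. \<pi>)"
    unfolding measure_sum_def using measure_of_of_measure[of \<pi>] by (simp add: space sets)
  then have "dd_step \<epsilon> K \<mu> X {I} \<pi> \<pi>"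
    unfolding dd_step_def using min
    by (intro exI[of _ "\<lambda>_. \<pi>"]) (simp add: comp_cell_I restr_UNIV Y)
  moreover have "partition_on I {I}" using I_nonempty by (simp add: partition_on_def)
  ultimately show ?thesis using dd_step_structured[OF cpl _ _ eps] by blast
qed

lemma ent_ge_optimal:
  assumes st: "structured {I} r U V C" and p: "bdd_density p"
  shows "ent r + hell p r \<le> ent p"
proof (rule ent_decrease[OF st _ p])
  show "partition_on I {I}" using I_nonempty by (simp add: partition_on_def)
  show "AE y in \<nu>. \<forall>J\<in>{I}. (\<Sum>i\<in>J. Fy p i y) = (\<Sum>i\<in>J. Fy r i y)"
    using p structuredD(1)[OF st] unfolding bdd_density_def by (auto elim!: eventually_elim2)
qed

lemma ent_nonneg: "bdd_density p \<Longrightarrow> 0 \<le> ent p"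
  unfolding ent_def by (intro integral_nonneg_AE AE_I2 dv_nonneg bdd_densityD(2) k_pos)

lemma KL_bdd_density:
  assumes "bdd_density p" shows "KL (dens p) K = ennreal (ent p)"
proof -
  obtain B where "\<And>z. \<bar>p z\<bar> \<le> B" using bdd_densityD(3)[OF assms] by blast
  then show ?thesis
    by (intro KL_density_bounded[where C = B] bdd_densityD(1,2)[OF assms]) (auto intro: abs_le_D1)
qed

lemma subopt_density:
  assumes p: "bdd_density p" and r: "bdd_density r"
  shows "subopt K (dens r) (dens p) = ereal (ent p - ent r)"
  unfolding subopt_def KL_bdd_density[OF p] KL_bdd_density[OF r]
  using ent_nonneg[OF p] ent_nonneg[OF r] by (simp add: enn2ereal_ennreal)

lemma dd_iterates_run:
  assumes eps: "0 < \<epsilon>" and A: "partition_on I \<J>A" and B: "partition_on I \<J>B"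
    and it: "dd_iterates \<epsilon> K \<mu> \<nu> X \<J>A \<J>B \<pi>"
  shows "\<exists>p U V C. dd_run \<mu> \<nu> k \<kappa> I X (\<lambda>s. if odd s then \<J>A else \<J>B) p U V C
    \<and> (\<forall>s\<ge>1. \<pi> s = dens (p s))"
proof -
  define Js where "Js s = (if odd s then \<J>A else \<J>B)" for s :: nat
  have part: "partition_on I (Js s)" for s using A B by (simp add: Js_def)
  have step: "dd_step \<epsilon> K \<mu> X (Js (Suc s)) (\<pi> s) (\<pi> (Suc s))" for s
    using it unfolding dd_iterates_def Js_def by (auto dest!: spec[of _ "Suc s"])
  have cpl: "\<pi> s \<in> couplings \<mu> \<nu>" for s
  proof (induction s)
    case 0 then show ?case using it by (simp add: dd_iterates_def)
  next
    case (Suc s) then show ?case using dd_step_structured[OF Suc part step eps] by blast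
  qed
  define good where "good s W \<longleftrightarrow> (case W of (p, U, V, C) \<Rightarrow> structured (Js (Suc s)) p U V C
    \<and> \<pi> (Suc s) = dens p \<and> (\<forall>q. bdd_density q \<longrightarrow> \<pi> s = dens q \<longrightarrow>
        (AE y in \<nu>. \<forall>J\<in>Js (Suc s). (\<Sum>i\<in>J. Fy q i y) = (\<Sum>i\<in>J. Fy p i y))))" for s W
  have "\<exists>W. good s W" for s
    using dd_step_structured[OF cpl part step eps, of s] unfolding good_def by (simp only: split_paired_Ex prod.case)
  then obtain W where W: "\<And>s. good s (W s)" by metis
  \<comment> \<open>\<open>W s\<close> describes the passage from iterate s to iterate s + 1, hence
    the shift. At index 0 the truncated subtraction repeats the data of index 1, and nothing is
    claimed about them.\<close>
  define p U V C where "p s = fst (W (s - 1))" and "U s = fst (snd (W (s - 1)))"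
    and "V s = fst (snd (snd (W (s - 1))))" and "C s = snd (snd (snd (W (s - 1))))" for s
  have st: "structured (Js (Suc s)) (p (Suc s)) (U (Suc s)) (V (Suc s)) (C (Suc s))"
    and dens: "\<pi> (Suc s) = density M (\<lambda>z. ennreal (p (Suc s) z))"
    and keep: "bdd_density q \<Longrightarrow> \<pi> s = dens q \<Longrightarrow>
      AE y in \<nu>. \<forall>J\<in>Js (Suc s). (\<Sum>i\<in>J. Fy q i y) = (\<Sum>i\<in>J. Fy (p (Suc s)) i y)" for s q
    using W[of s] unfolding good_def p_def U_def V_def C_def by (auto simp: case_prod_beta)
  have "dd_run \<mu> \<nu> k \<kappa> I X Js p U V C"
  proof unfold_locales
    fix s :: nat
    show "partition_on I (Js s)" by (rule part)
    show "Js (Suc (Suc s)) = Js s" by (simp add: Js_def)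
    assume "1 \<le> s"
    then obtain s' where s: "s = Suc s'" by (cases s) auto
    show "structured (Js s) (p s) (U s) (V s) (C s)" unfolding s by (rule st)
    show "AE y in \<nu>. \<forall>J\<in>Js (Suc s). (\<Sum>i\<in>J. Fy (p s) i y) = (\<Sum>i\<in>J. Fy (p (Suc s)) i y)"
      by (rule keep) (use st dens s structuredD(1) in blast)+
  qed
  moreover have "\<pi> s = dens (p s)" if "1 \<le> s" for s
    using dens[of "s - 1"] that by simp
  ultimately show ?thesis unfolding Js_def[abs_def] by blast
qed

end

context dd_run
begin

text \<open>The divergence is nonincreasing and bounded below, so the gap has a limit L; contraction
  at odd iterates already gives L <= q L.\<close>

lemma ent_converges:
  assumes low: "\<And>s. 1 \<le> s \<Longrightarrow> e \<le> ent (p s)" and q: "q < 1"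
    and con: "\<And>l. odd l \<Longrightarrow> Mx < l \<Longrightarrow> ent (p l) - e \<le> q * (ent (p (l - Mx)) - e)"
  shows "(\<lambda>s. ent (p s) - e) \<longlonglongrightarrow> 0"
proof -
  define d where "d s = ent (p (Suc s)) - e" for s
  have dec: "decseq d" unfolding d_def decseq_def using ent_mono by simp
  have d0: "0 \<le> d s" for s unfolding d_def using low by simp
  obtain L where L: "d \<longlonglongrightarrow> L" using decseq_convergent[OF dec] d0 by blast
  have L0: "0 \<le> L" by (rule LIMSEQ_le_const[OF L]) (use d0 in auto)
  have "(\<lambda>n. d (2 * n + 2 * Mx)) \<longlonglongrightarrow> L"
    using LIMSEQ_subseq_LIMSEQ[OF L, of "\<lambda>n. 2 * n + 2 * Mx"] by (simp add: strict_mono_def o_def)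
  moreover have "(\<lambda>n. q * d (2 * n + Mx)) \<longlonglongrightarrow> q * L"
    using LIMSEQ_subseq_LIMSEQ[OF L, of "\<lambda>n. 2 * n + Mx"] by (intro tendsto_mult) (auto simp: strict_mono_def o_def)
  \<comment> \<open>As \<open>d s\<close> belongs to iterate s + 1, the index 2 n + 2 M stands for
    an odd iterate beyond M.\<close>
  moreover have "d (2 * n + 2 * Mx) \<le> q * d (2 * n + Mx)" for n
  proof -
    have eq: "Suc (2 * n + 2 * Mx) - Mx = Suc (2 * n + Mx)" by simp
    have "ent (p (Suc (2 * n + 2 * Mx))) - e \<le> q * (ent (p (Suc (2 * n + 2 * Mx) - Mx)) - e)"
      by (rule con) simp_all
    then show ?thesis unfolding eq d_def .
  qed
  ultimately have "L \<le> q * L" by (intro LIMSEQ_le) auto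
  then have "(1 - q) * L \<le> 0" by (simp add: algebra_simps)
  then have "L = 0" using q L0 by (simp add: mult_le_0_iff)
  then have "(\<lambda>s. ent (p (Suc s)) - e) \<longlonglongrightarrow> 0" using L by (simp add: d_def[abs_def])
  then show ?thesis by (rule LIMSEQ_imp_Suc)
qed

lemma integral_converges:
  fixes f :: "'a \<times> 'b \<Rightarrow> real"
  assumes st: "structured {I} r Ur Vr Cr" and conv: "(\<lambda>s. ent (p s) - ent r) \<longlonglongrightarrow> 0"
    and f: "f \<in> borel_measurable M" and B: "\<And>z. \<bar>f z\<bar> \<le> B"
  shows "(\<lambda>s. \<integral>z. f z \<partial>dens (p s)) \<longlonglongrightarrow> (\<integral>z. f z \<partial>dens r)"
proof -
  have r: "bdd_density r" by (rule structuredD(1)[OF st])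
  have B0: "0 \<le> B" using B[of undefined] by linarith
  define d where "d s = ent (p s) - ent r" for s
  define I1 where "I1 s = (\<integral>z. f z \<partial>dens (p s))" for s
  define I2 where "I2 = (\<integral>z. f z \<partial>dens r)"
  \<comment> \<open>This is \<open>L1_le_hellinger\<close> with t = sqrt (d s) + 1 / s: the root
    balances the two terms, and 1 / s keeps t positive when the gap is 0.\<close>
  define b where "b s = B * (sqrt (d s) / 2 + 2 * (sqrt (d s) + 1 / real s))" for s
  have "b \<longlonglongrightarrow> B * (sqrt 0 / 2 + 2 * (sqrt 0 + 0))"
    unfolding b_def using conv unfolding d_def[symmetric] by (intro tendsto_intros lim_1_over_n) auto
  then have b: "b \<longlonglongrightarrow> 0" by simp
  have le: "\<bar>I1 s - I2\<bar> \<le> b s" if s: "1 \<le> s" for s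
  proof -
    note pb = bdd[OF s]
    define H where "H = hell (p s) r"
    have H: "0 \<le> H" "H \<le> d s" using ent_ge_optimal[OF st pb] by (auto simp: H_def d_def intro!: integral_nonneg_AE)
    define t where "t = sqrt (d s) + 1 / real s"
    have t: "0 < t" unfolding t_def using H s by (intro add_nonneg_pos) auto
    have "H \<le> sqrt (d s) * t"
    proof -
      have "H \<le> sqrt (d s) * sqrt (d s)" using H by simp
      also have "\<dots> \<le> sqrt (d s) * t" unfolding t_def using H by (intro mult_left_mono) auto
      finally show ?thesis .
    qed
    then have "H / (2 * t) \<le> sqrt (d s) / 2" using t by (simp add: field_simps)
    then have "(\<integral>z. \<bar>p s z - r z\<bar> \<partial>M) \<le> sqrt (d s) / 2 + 2 * t"
      using L1_le_hellinger[OF pb r t] unfolding H_def by linarith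
    then have "B * (\<integral>z. \<bar>p s z - r z\<bar> \<partial>M) \<le> b s" unfolding b_def t_def using B0 by (intro mult_left_mono) auto
    then show ?thesis using integral_density_diff[OF pb r f B] unfolding I1_def I2_def by linarith
  qed
  have "(\<lambda>s. I1 s - I2) \<longlonglongrightarrow> 0"
    by (rule Lim_null_comparison[OF _ b]) (use le in \<open>auto intro!: eventually_sequentiallyI[of 1]\<close>)
  then show ?thesis unfolding I1_def I2_def by (rule LIM_zero_cancel)
qed

end

context ot_cells
begin

text \<open>Taking J0 from the partition of iterate l covers both parities at once. Convergence
  holds for all bounded measurable integrands because it is obtained in the L1 norm of the
  densities.\<close>

lemma dd_main:
  fixes \<J>A \<J>B \<pi> \<pi>opt mm
  defines "Js \<equiv> (\<lambda>s::nat. if odd s then \<J>A else \<J>B)" and "G \<equiv> part_graph I \<J>A \<J>B"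
    and "q \<equiv> (\<lambda>Mx. 2 * real Mx * real (card I) * exp ((6 * real Mx + 7) * \<kappa>) /
      (mm ^ (2 * Mx + 1) + 2 * real Mx * real (card I) * exp ((6 * real Mx + 7) * \<kappa>)))"
  assumes eps: "0 < \<epsilon>" and opt: "is_entropic_minimizer \<epsilon> K \<mu> \<nu> \<pi>opt"
    and A: "partition_on I \<J>A" and B: "partition_on I \<J>B" and conn: "graph_connected I G"
    and it: "dd_iterates \<epsilon> K \<mu> \<nu> X \<J>A \<J>B \<pi>"
    and mm: "0 < mm" "\<And>i. i \<in> I \<Longrightarrow> mm \<le> m i"
  shows "\<And>J0 l. J0 \<in> Js l \<Longrightarrow> max_cell_dist G I J0 < l \<Longrightarrow>
      subopt K \<pi>opt (\<pi> l) \<le> ereal (q (max_cell_dist G I J0)) * subopt K \<pi>opt (\<pi> (l - max_cell_dist G I J0))"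
    and "\<And>(f :: 'a \<times> 'b \<Rightarrow> real) C. f \<in> borel_measurable M \<Longrightarrow> (\<And>z. \<bar>f z\<bar> \<le> C) \<Longrightarrow> (\<lambda>n. \<integral>z. f z \<partial>\<pi> n) \<longlonglongrightarrow> (\<integral>z. f z \<partial>\<pi>opt)"
proof -
  obtain p U V C where run: "dd_run \<mu> \<nu> k \<kappa> I X Js p U V C"
    and dens: "\<And>s. 1 \<le> s \<Longrightarrow> \<pi> s = dens (p s)"
    using dd_iterates_run[OF eps A B it] unfolding Js_def by blast
  interpret run: dd_run \<mu> \<nu> k \<kappa> I X Js p U V C by (rule run)
  obtain r Ur Vr Cr where st: "structured {I} r Ur Vr Cr" and opt_r: "\<pi>opt = dens r"
    using optimal_structured[OF opt eps] by blast
  have r: "bdd_density r" by (rule structuredD(1)[OF st])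
  have con: "ent (p l) - ent r \<le> q (max_cell_dist G I J0) * (ent (p (l - max_cell_dist G I J0)) - ent r)"
    if J0: "J0 \<in> Js l" and l: "max_cell_dist G I J0 < l" for J0 l
  proof -
    \<comment> \<open>The graph is symmetric in the two partitions, so the one that contains J0 can
      be listed first, as the alternation of shortest paths requires.\<close>
    have Gl: "G = part_graph I (Js l) (Js (Suc l))"
      unfolding G_def Js_def using part_graph_commute[of I \<J>A \<J>B] by simp
    have path: "\<exists>j\<in>I. cell_dist G J0 j = d \<and> (\<exists>J\<in>Js (l - Suc d). i \<in> J \<and> j \<in> J)"
      if i: "i \<in> I" "cell_dist G J0 i = Suc d" and d: "Suc d \<le> l" for i d
    proof -
      have "Js (l - Suc d) = (if even d then Js (Suc l) else Js l)"
        using d by (auto simp: Js_def)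
      then show ?thesis
        using shortest_path_alternates[OF Gl conn fin_I run.part run.part J0 i] by simp
    qed
    have le: "cell_dist G J0 i \<le> max_cell_dist G I J0" if "i \<in> I" for i
      unfolding max_cell_dist_def using that fin_I by (intro Max_ge) auto
    have "ent (p l) - ent r \<le> real (2 * max_cell_dist G I J0 * card I) * exp (real (6 * max_cell_dist G I J0 + 7) * \<kappa>) /
      (mm ^ (2 * max_cell_dist G I J0 + 1) + real (2 * max_cell_dist G I J0 * card I) * exp (real (6 * max_cell_dist G I J0 + 7) * \<kappa>))
      * (ent (p (l - max_cell_dist G I J0)) - ent r)"
    proof (rule run.dd_contraction[where D = "cell_dist G J0" and ?J0.0 = J0])
      fix i d assume i: "i \<in> I" "cell_dist G J0 i = Suc d"
      have "Suc d \<le> l" using le[OF i(1)] i(2) l by simp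
      then show "\<exists>j\<in>I. cell_dist G J0 j = d \<and> (\<exists>J\<in>Js (l - Suc d). i \<in> J \<and> j \<in> J)" by (rule path[OF i])
    qed (use l J0 le mm r cell_dist_0_iff[OF Gl conn fin_I run.part run.part J0] in auto)
    then show ?thesis by (simp add: q_def)
  qed
  show "subopt K \<pi>opt (\<pi> l) \<le> ereal (q (max_cell_dist G I J0)) * subopt K \<pi>opt (\<pi> (l - max_cell_dist G I J0))"
    if J0: "J0 \<in> Js l" and l: "max_cell_dist G I J0 < l" for J0 l
  proof -
    have "1 \<le> l" "1 \<le> l - max_cell_dist G I J0" using l by auto
    then show ?thesis
      unfolding opt_r using con[OF J0 l] by (simp add: dens subopt_density run.bdd r)
  qed
  fix f :: "'a \<times> 'b \<Rightarrow> real" and Cf assume f: "f \<in> borel_measurable M" "\<And>z. \<bar>f z\<bar> \<le> Cf"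
  have "\<J>A \<noteq> {}" using A I_nonempty by (auto simp: partition_on_def)
  then obtain J0 where J0: "J0 \<in> \<J>A" by blast
  have "(\<lambda>s. ent (p s) - ent r) \<longlonglongrightarrow> 0"
  proof (rule run.ent_converges)
    show "ent r \<le> ent (p s)" if "1 \<le> s" for s
    proof -
      have "0 \<le> hell (p s) r" by (intro integral_nonneg_AE) auto
      then show ?thesis using ent_ge_optimal[OF st run.bdd[OF that]] by linarith
    qed
    show "q (max_cell_dist G I J0) < 1"
    proof -
      have "0 < mm ^ (2 * max_cell_dist G I J0 + 1)" using mm by simp
      moreover have "0 \<le> 2 * real (max_cell_dist G I J0) * real (card I) * exp ((6 * real (max_cell_dist G I J0) + 7) * \<kappa>)" by simp
      ultimately show ?thesis unfolding q_def by (subst divide_less_eq_1_pos) linarith+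
    qed
    show "ent (p l) - ent r \<le> q (max_cell_dist G I J0) * (ent (p (l - max_cell_dist G I J0)) - ent r)"
      if "odd l" "max_cell_dist G I J0 < l" for l
      by (rule con) (use that J0 in \<open>auto simp: Js_def\<close>)
  qed
  then have "(\<lambda>s. \<integral>z. f z \<partial>dens (p s)) \<longlonglongrightarrow> (\<integral>z. f z \<partial>\<pi>opt)"
    unfolding opt_r by (rule run.integral_converges[OF st _ f])
  then show "(\<lambda>n. \<integral>z. f z \<partial>\<pi> n) \<longlonglongrightarrow> (\<integral>z. f z \<partial>\<pi>opt)"
    by (rule Lim_transform_eventually) (auto intro!: eventually_sequentiallyI[of 1] simp: dens)
qed

end

section \<open>Essentially bounded costs and the final statement\<close>

lemma mass_restr: "S \<in> sets \<mu> \<Longrightarrow> mass (restr \<mu> S) = measure \<mu> S"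
  unfolding mass_def measure_def by (simp add: emeasure_restr)

lemma Linf_norm_bound:
  assumes "prob_space M" "in_Linf M f"
  shows "0 \<le> Linf_norm M f" "AE z in M. \<bar>f z\<bar> \<le> Linf_norm M f"
proof -
  interpret prob_space M by fact
  let ?e = "esssup M (\<lambda>x. ereal \<bar>f x\<bar>)"
  have ae: "AE z in M. ereal \<bar>f z\<bar> \<le> ?e" by (rule esssup_AE)
  \<comment> \<open>On a null space the essential supremum would be minus infinity; a probability
    space excludes this.\<close>
  have e0: "0 \<le> ?e"
  proof (rule ccontr)
    assume n: "\<not> 0 \<le> ?e"
    have "AE z in M. \<not> ereal \<bar>f z\<bar> \<le> ?e"
    proof (rule AE_I2)
      fix z have "0 \<le> ereal \<bar>f z\<bar>" by simp
      then show "\<not> ereal \<bar>f z\<bar> \<le> ?e" using n order_trans by blast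
    qed
    with ae show False by (rule AE_contr)
  qed
  have e: "ereal (Linf_norm M f) = ?e"
    unfolding Linf_norm_def using e0 assms(2) by (intro ereal_real') (auto simp: in_Linf_def)
  show "0 \<le> Linf_norm M f" using e0 unfolding e[symmetric] by simp
  show "AE z in M. \<bar>f z\<bar> \<le> Linf_norm M f" using ae unfolding e[symmetric] by simp
qed

theorem theorem4p8:
  fixes \<mu> :: "'a::metric_space measure" and \<nu> :: "'b::metric_space measure"
    and c :: "'a \<times> 'b \<Rightarrow> real" and \<epsilon> :: real
    and I :: "'i set" and X :: "'i \<Rightarrow> 'a set" and \<J>A \<J>B :: "'i set set"
    and \<pi> :: "nat \<Rightarrow> ('a \<times> 'b) measure" and \<pi>opt :: "('a \<times> 'b) measure"
  defines "K \<equiv> gibbs \<mu> \<nu> c \<epsilon>"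
    and "G \<equiv> part_graph I \<J>A \<J>B"
    and "q \<equiv> (\<lambda>M. contraction_factor M (card I) (min_mass \<mu> I X) (Linf_norm (\<mu> \<Otimes>\<^sub>M \<nu>) c) \<epsilon>)"
  assumes "compact (UNIV :: 'a set)" and "compact (UNIV :: 'b set)"
    and "prob_space \<mu>" and "sets \<mu> = sets borel"
    and "prob_space \<nu>" and "sets \<nu> = sets borel"
    and "in_Linf (\<mu> \<Otimes>\<^sub>M \<nu>) c" and "AE z in \<mu> \<Otimes>\<^sub>M \<nu>. 0 \<le> c z"
    and "\<epsilon> > 0"
    and "is_entropic_minimizer \<epsilon> K \<mu> \<nu> \<pi>opt"
    and "basic_partition \<mu> I X"
    and "partition_on I \<J>A" and "partition_on I \<J>B"
    and "\<forall>i\<in>I. \<forall>j\<in>I. i \<noteq> j \<longrightarrow> \<not> ((\<exists>J\<in>\<J>A. {i, j} \<subseteq> J) \<and> (\<exists>J\<in>\<J>B. {i, j} \<subseteq> J))"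
    and "graph_connected I G"
    and "dd_iterates \<epsilon> K \<mu> \<nu> X \<J>A \<J>B \<pi>"
  shows "(\<forall>J0\<in>\<J>A. let M = max_cell_dist G I J0 in
            \<forall>l. odd l \<and> l > M \<longrightarrow> subopt K \<pi>opt (\<pi> l) \<le> ereal (q M) * subopt K \<pi>opt (\<pi> (l - M)))
       \<and> (\<forall>J0\<in>\<J>B. let M = max_cell_dist G I J0 in
            \<forall>l. even l \<and> l > M \<longrightarrow> subopt K \<pi>opt (\<pi> l) \<le> ereal (q M) * subopt K \<pi>opt (\<pi> (l - M)))
       \<and> weak_star_tendsto \<pi> \<pi>opt"
proof -
  interpret mu: prob_space \<mu> by fact
  interpret nu: prob_space \<nu> by fact
  interpret pp: pair_prob_space \<mu> \<nu> ..
  define \<kappa> where "\<kappa> = Linf_norm (\<mu> \<Otimes>\<^sub>M \<nu>) c / \<epsilon>"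
  note c_bound = Linf_norm_bound[OF pp.P.prob_space_axioms assms(10)]
  have c_meas [measurable]: "c \<in> borel_measurable (\<mu> \<Otimes>\<^sub>M \<nu>)" using assms(10) by (simp add: in_Linf_def)
  have kap0: "0 \<le> \<kappa>" unfolding \<kappa>_def using c_bound(1) assms(12) by simp
  \<comment> \<open>Clipping changes exp (- c / \<epsilon>) only on a null set, so the Gibbs measure
    stays the same while the bounds on the kernel hold at every point.\<close>
  define k where "k z = max (exp (- \<kappa>)) (min 1 (exp (- c z / \<epsilon>)))" for z
  interpret ot_cells \<mu> \<nu> k \<kappa> I X
  proof unfold_locales
    show "k \<in> borel_measurable (\<mu> \<Otimes>\<^sub>M \<nu>)" unfolding k_def by measurable
    show "sets \<mu> = sets borel" "sets \<nu> = sets borel" "0 \<le> \<kappa>" by fact+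
    show "exp (- \<kappa>) \<le> k z" "k z \<le> 1" for z using kap0 by (auto simp: k_def)
    show "finite I" "disjoint_family_on X I" "(\<Union>i\<in>I. X i) = UNIV" "\<And>i. i \<in> I \<Longrightarrow> X i \<in> sets borel"
      using assms(14) by (auto simp: basic_partition_def)
    fix i assume "i \<in> I"
    then show "0 < measure \<mu> (X i)" using assms(14) mass_restr[of "X i" \<mu>] assms(7) by (auto simp: basic_partition_def)
  qed
  have K_eq: "K = ot.K \<mu> \<nu> k"
  proof -
    have "AE z in \<mu> \<Otimes>\<^sub>M \<nu>. exp (- c z / \<epsilon>) = k z" using c_bound(2) assms(11)
    proof eventually_elim
      case (elim z)
      have "c z / \<epsilon> \<le> \<kappa>" unfolding \<kappa>_def using elim assms(12) by (intro divide_right_mono) auto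
      moreover have "0 \<le> c z / \<epsilon>" using elim assms(12) by simp
      ultimately show ?case by (simp add: k_def max_def min_def)
    qed
    then show ?thesis unfolding assms(1) gibbs_def K_def
      by (intro density_cong) (auto elim!: eventually_mono simp: k_def)
  qed
  have mmass: "min_mass \<mu> I X = Min (m ` I)"
    unfolding min_mass_def m_def using X_measurable by (intro arg_cong[where f = Min] image_cong) (auto simp: mass_restr)
  have mm: "0 < min_mass \<mu> I X" "\<And>i. i \<in> I \<Longrightarrow> min_mass \<mu> I X \<le> m i"
    unfolding mmass using fin_I I_nonempty m_pos by auto
  have q_eq: "q M = 2 * real M * real (card I) * exp ((6 * real M + 7) * \<kappa>) /
      (min_mass \<mu> I X ^ (2 * M + 1) + 2 * real M * real (card I) * exp ((6 * real M + 7) * \<kappa>))" for M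
    by (simp add: assms(3) contraction_factor_def \<kappa>_def)
  note main = dd_main[OF assms(12) assms(13)[unfolded K_eq] assms(15,16) assms(18)[unfolded assms(2)] assms(19)[unfolded K_eq] mm]
  have "weak_star_tendsto \<pi> \<pi>opt"
    unfolding weak_star_tendsto_def
  proof (intro allI impI)
    fix f :: "'a \<times> 'b \<Rightarrow> real" assume f: "continuous_on UNIV f"
    have cpt: "compact (UNIV :: ('a \<times> 'b) set)"
      using compact_Times[OF assms(4,5)] by simp
    have "bounded (range f)" using compact_imp_bounded[OF compact_continuous_image[OF f cpt]] .
    then obtain C where C: "\<And>z. \<bar>f z\<bar> \<le> C" by (auto simp: bounded_iff)
    show "(\<lambda>n. \<integral>x. f x \<partial>\<pi> n) \<longlonglongrightarrow> (\<integral>x. f x \<partial>\<pi>opt)"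
    proof (cases "f \<in> borel_measurable M")
      case True
      show ?thesis by (rule main(2)[OF _ True C])
    next
      case False
      have "sets (\<pi> n) = sets M" for n
      proof (cases n)
        case 0 then show ?thesis using assms(19) sets_M by (simp add: dd_iterates_def couplings_def)
      next
        case (Suc n')
        then have "1 \<le> n" by simp
        then have "dd_step \<epsilon> K \<mu> X (if odd n then \<J>A else \<J>B) (\<pi> (n - 1)) (\<pi> n)"
          using assms(19) unfolding dd_iterates_def by blast
        then obtain \<pi>J where "\<pi> n = measure_sum (if odd n then \<J>A else \<J>B) \<pi>J"
          unfolding dd_step_def by blast
        then show ?thesis
          using sets.sigma_sets_eq[of "borel \<Otimes>\<^sub>M borel :: ('a \<times> 'b) measure"]
          by (simp add: measure_sum_def sets_measure_of sets_M space_pair_measure)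
      qed
      moreover have "sets \<pi>opt = sets M"
        using is_entropic_minimizerD(1)[OF assms(13,12)] sets_M by (simp add: couplings_def)
      moreover have "(\<integral>x. f x \<partial>N) = 0" if "sets N = sets M" for N
        using False borel_measurable_integrable[of N f] measurable_cong_sets[OF that refl]
        by (intro not_integrable_integral_eq) blast
      ultimately show ?thesis by simp
    qed
  qed
  moreover have "subopt K \<pi>opt (\<pi> l) \<le> ereal (q (max_cell_dist G I J0)) * subopt K \<pi>opt (\<pi> (l - max_cell_dist G I J0))"
    if "J0 \<in> (if odd l then \<J>A else \<J>B)" "max_cell_dist G I J0 < l" for J0 l
    unfolding q_eq K_eq assms(2) by (rule main(1)) (use that in \<open>simp_all add: assms(2)\<close>)
  ultimately show ?thesis by (simp add: Let_def)
qed

end
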